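(* Let $v\leq 0$ be an integer. The generalised T-links $T((r_1,s_1),\dots,(r_k,s_k),(r_{k+1},s_{k+1}),d)$ with $s_{k+1}\geq v\,r_{k+1}$ are in equivalence with the Lorenz-like links in the Lorenz-like template $\mathscr{L}(0,2v)$; that is, every generalised T-link with $s_{k+1}\geq v\,r_{k+1}$ is ambient isotopic in $S^3$ to a link embedded in $\mathscr{L}(0,2v)$, and every link embedded in $\mathscr{L}(0,2v)$ is ambient isotopic in $S^3$ to a generalised T-link with $s_{k+1}\geq v\,r_{k+1}$.
   Context: Let $\sigma_1,\dots,\sigma_{m-1}$ denote the standard Artin generators of the braid group $B_m$ (words are read from top to bottom; $\sigma_i$ is the positive crossing in which the strand in position $i$ passes over the strand in position $i+1$). Generalised T-links: let $k\ge 0$ and let $r_1,\dots,r_{k+1},s_1,\dots,s_{k+1},d$ be integers with $2\leq r_1<\cdots<r_k<r_{k+1}$, $s_1,\dots,s_k>0$, $s_{k+1}\in\mathbb{Z}\setminus\{-1,0,1\}$ and $d\geq 0$. The generalised T-link $T((r_1,s_1),\dots,(r_k,s_k),(r_{k+1},s_{k+1}),d)$ is the closure of the braid $$(\sigma_{d+1}\cdots\sigma_{d+r_1-1})^{s_1}\cdots(\sigma_{d+1}\cdots\sigma_{d+r_k-1})^{s_k}(\sigma_{d+1}\cdots\sigma_{d+r_{k+1}-1})^{s_{k+1}}\in B_{d+r_{k+1}}.$$ Lorenz-like templates: the Lorenz template is the branched surface in $S^3$ with one branch line and two strips, the left strip leaving the left part and the right strip leaving the right part of the branch line; each strip returns stretched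 over the whole branch line, the left strip passing over the right one. For integers $u,v$, the Lorenz-like template $\mathscr{L}(u,v)$ is obtained by cutting the Lorenz template along its branch line and regluing the left strip with $u$ half twists and the right strip with $v$ half twists (positive half twists giving positive crossings). A link embedded in $\mathscr{L}(u,v)$ (a Lorenz-like link) is a nonempty link carried by the template along its semiflow, parallel components being allowed. Concretely, after cutting along the branch line, it is given by integers $N\geq 1$, $0\leq p\leq N$ and a strictly increasing map $f:\{1,\dots,p\}\to\{1,\dots,N\}$, and it is the closure of the $N$-strand braid $\Delta_L^{u}\Delta_R^{v}\lambda$. Here $\Delta_L$ is the positive half twist on the first $p$ strands, $\Delta_R$ is the positive half twist on the last $N-p$ strands (a half twist on at most one strand is trivial), and $\lambda$ is the positive braid in which the strand starting in position $i\leq p$ ends in position $f(i)$, the strands starting in positions $p+1,\dots,N$ end in increasing order in the positions not in the image of $f$, any two strands cross at most once, and at every crossing a strand from the first $p$ passes over a strand from the last $N-p$.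
   Formalization: For v = 0 the converse excepts unlinks: they are embedded in L(0,0), but a generalised T-link with s_{k+1} ≥ 0 has s_{k+1} ≥ 2 and is never an unlink, so the claim as stated fails for exactly these links. *)

theory Defs
  imports "HOL-Analysis.Analysis" "HOL-Combinatorics.Transposition"
begin

section \<open>The 3-sphere and ambient isotopy\<close>

definition S3 :: "(complex \<times> complex) set" where
  "S3 = sphere 0 1"

text \<open>Links are subsets of \<^term>\<open>S3\<close>, unoriented and without ordering of the components.\<close>

definition ambient_isotopic ::
    "(complex \<times> complex) set \<Rightarrow> (complex \<times> complex) set \<Rightarrow> bool" where
  "ambient_isotopic A B \<longleftrightarrow>
     (\<exists>H :: real \<Rightarrow> complex \<times> complex \<Rightarrow> complex \<times> complex.
        continuous_on ({0..1} \<times> S3) (\<lambda>(t, x). H t x) \<and>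
        (\<forall>t\<in>{0..1}. \<exists>G. homeomorphism S3 S3 (H t) G) \<and>
        (\<forall>x\<in>S3. H 0 x = x) \<and>
        H 1 ` A = B)"

section \<open>Braid words\<close>

text \<open>The letter \<open>(i, True)\<close> is the Artin generator \<open>\<sigma>\<^sub>i\<close> and \<open>(i, False)\<close> is its inverse.
  Strand positions and generators are numbered from 1; a word on \<open>m\<close> strands uses the
  letters with \<open>1 \<le> i < m\<close>. Words are read from top to bottom.\<close>

type_synonym braid_word = "(nat \<times> bool) list"

definition word_inverse :: "braid_word \<Rightarrow> braid_word" where
  "word_inverse w = rev (map (\<lambda>(i, e). (i, \<not> e)) w)"

definition word_power :: "braid_word \<Rightarrow> int \<Rightarrow> braid_word" where
  "word_power w n =
     (if 0 \<le> n then concat (replicate (nat n) w)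
      else concat (replicate (nat (- n)) (word_inverse w)))"

text \<open>\<open>\<sigma>\<^bsub>a+1\<^esub> \<sigma>\<^bsub>a+2\<^esub> \<dots> \<sigma>\<^bsub>a+n-1\<^esub>\<close>, the empty word for \<open>n \<le> 1\<close>.\<close>

definition sigma_run :: "nat \<Rightarrow> nat \<Rightarrow> braid_word" where
  "sigma_run a n = map (\<lambda>i. (i, True)) [a + 1..<a + n]"

text \<open>The positive half twist on the \<open>n\<close> strands in positions \<open>a + 1, \<dots>, a + n\<close>:
  \<open>(\<sigma>\<^bsub>a+1\<^esub> \<dots> \<sigma>\<^bsub>a+n-1\<^esub>) (\<sigma>\<^bsub>a+1\<^esub> \<dots> \<sigma>\<^bsub>a+n-2\<^esub>) \<dots> (\<sigma>\<^bsub>a+1\<^esub>)\<close>.\<close>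

definition half_twist :: "nat \<Rightarrow> nat \<Rightarrow> braid_word" where
  "half_twist a n = concat (map (\<lambda>j. sigma_run a (n - j)) [0..<n])"

text \<open>\<open>strand_at w q\<close> is the starting position of the strand which, after the word \<open>w\<close>,
  is in position \<open>q\<close>.\<close>

definition strand_at :: "braid_word \<Rightarrow> nat \<Rightarrow> nat" where
  "strand_at w = foldl (\<lambda>\<pi> (i, e). \<pi> \<circ> Transposition.transpose i (i + 1)) id w"

section \<open>The closure of a braid\<close>

text \<open>The complement in \<^term>\<open>S3\<close> of the braid axis, the circle \<open>w = 0\<close>, is identified with
  (open unit disc) \<open>\<times>\<close> (circle) by sending the disc point \<open>z\<close> and the angle \<open>\<theta>\<close> to
  \<open>(z, sqrt (1 - |z|\<^sup>2) e\<^bsup>i\<theta>\<^esup>)\<close>. The braid runs downwards in the direction of increasing \<open>\<theta>\<close>.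
  In each disc the real part of \<open>z\<close> increases from left to right and the imaginary part points
  towards the viewer, so that over-strands have the larger imaginary part; these coordinates
  are compatible with the usual orientations of space and of \<^term>\<open>S3\<close>.\<close>

definition solid_torus_point :: "complex \<Rightarrow> real \<Rightarrow> complex \<times> complex" where
  "solid_torus_point z \<theta> = (z, complex_of_real (sqrt (1 - (cmod z)\<^sup>2)) * cis \<theta>)"

definition base_point :: "nat \<Rightarrow> nat \<Rightarrow> complex" where
  "base_point m j = complex_of_real ((2 * real j - real m - 1) / (real m + 1))"

text \<open>At time \<open>s \<in> {0..1}\<close> of the letter \<open>(i, e)\<close>, \<open>letter_point m (i, e) s j\<close> is the point of the
  strand that was in position \<open>j\<close> at time \<open>0\<close>. The points in positions \<open>i\<close> and \<open>i + 1\<close> are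
  exchanged by a half turn around their midpoint, clockwise for \<open>\<sigma>\<^sub>i\<close> (so that strand \<open>i\<close> passes
  over strand \<open>i + 1\<close>) and counterclockwise for its inverse.\<close>

definition letter_point :: "nat \<Rightarrow> nat \<times> bool \<Rightarrow> real \<Rightarrow> nat \<Rightarrow> complex" where
  "letter_point m l s j =
     (let i = fst l;
          c = (base_point m i + base_point m (i + 1)) / 2;
          turn = cis (if snd l then - pi * s else pi * s)
      in if j = i \<or> j = i + 1 then c + turn * (base_point m j - c) else base_point m j)"

text \<open>The circle is divided into \<open>length w + 1\<close> equal arcs. Arc number \<open>k < length w\<close> carries
  the letter \<open>w ! k\<close>; on the last arc all strands are constant, which closes up the braid and
  also makes sense of the closure of the empty word.\<close>

definition braid_closure :: "nat \<Rightarrow> braid_word \<Rightarrow> (complex \<times> complex) set" where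
  "braid_closure m w =
     {solid_torus_point
        (if k < length w then letter_point m (w ! k) s j else base_point m j)
        (2 * pi * (real k + s) / real (length w + 1))
      | k s j. k \<le> length w \<and> 0 \<le> s \<and> s \<le> 1 \<and> 1 \<le> j \<and> j \<le> m}"

section \<open>Generalised T-links\<close>

definition gen_T_parameters :: "nat \<Rightarrow> (nat \<Rightarrow> nat) \<Rightarrow> (nat \<Rightarrow> int) \<Rightarrow> bool" where
  "gen_T_parameters k r s \<longleftrightarrow>
     2 \<le> r 1 \<and> (\<forall>i\<in>{1..k}. r i < r (i + 1)) \<and>
     (\<forall>i\<in>{1..k}. 0 < s i) \<and> s (k + 1) \<notin> {-1, 0, 1}"

definition gen_T_word :: "nat \<Rightarrow> (nat \<Rightarrow> nat) \<Rightarrow> (nat \<Rightarrow> int) \<Rightarrow> nat \<Rightarrow> braid_word" where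
  "gen_T_word k r s d =
     concat (map (\<lambda>i. word_power (sigma_run d (r i)) (s i)) [1..<k + 2])"

definition gen_T_link ::
    "nat \<Rightarrow> (nat \<Rightarrow> nat) \<Rightarrow> (nat \<Rightarrow> int) \<Rightarrow> nat \<Rightarrow> (complex \<times> complex) set" where
  "gen_T_link k r s d = braid_closure (d + r (k + 1)) (gen_T_word k r s d)"

section \<open>Lorenz-like links\<close>

text \<open>\<open>w\<close> is a word for the braid \<open>\<lambda>\<close> determined by \<open>N\<close>, \<open>p\<close>, \<open>f\<close>. At the letter \<open>w ! k\<close> with index
  \<open>i\<close> the strands \<open>strand_at (take k w) i\<close> and \<open>strand_at (take k w) (i + 1)\<close> cross, and the
  former is the upper one since the letter is positive. The conditions determine the word up
  to commutations of distant generators, hence determine the braid.\<close>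

definition lorenz_lambda_word ::
    "nat \<Rightarrow> nat \<Rightarrow> (nat \<Rightarrow> nat) \<Rightarrow> braid_word \<Rightarrow> bool" where
  "lorenz_lambda_word N p f w \<longleftrightarrow>
     (\<forall>(i, e)\<in>set w. 1 \<le> i \<and> i < N \<and> e) \<and>
     (\<forall>i\<in>{1..p}. strand_at w (f i) = i) \<and>
     strict_mono_on ({1..N} - f ` {1..p}) (strand_at w) \<and>
     inj_on (\<lambda>k. {strand_at (take k w) (fst (w ! k)), strand_at (take k w) (fst (w ! k) + 1)})
       {..<length w} \<and>
     (\<forall>k<length w. strand_at (take k w) (fst (w ! k)) \<in> {1..p} \<and>
        strand_at (take k w) (fst (w ! k) + 1) \<in> {p + 1..N})"

text \<open>The links embedded in the Lorenz-like template with \<open>u\<close> left and \<open>v\<close> right half twists.\<close>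

definition lorenz_like_links :: "int \<Rightarrow> int \<Rightarrow> (complex \<times> complex) set set" where
  "lorenz_like_links u v =
     {braid_closure N
        (word_power (half_twist 0 p) u @ word_power (half_twist p (N - p)) v @ w)
      | N p f w. 1 \<le> N \<and> p \<le> N \<and> f ` {1..p} \<subseteq> {1..N} \<and> strict_mono_on {1..p} f \<and>
          lorenz_lambda_word N p f w}"

section \<open>Trivial links\<close>

text \<open>Needed for \<open>v = 0\<close> only. Trivial links are embedded in the Lorenz template, but a generalised
  T-link with \<open>s\<^bsub>k+1\<^esub> \<ge> 0\<close> has \<open>s\<^bsub>k+1\<^esub> \<ge> 2\<close>, so it is the split union of \<open>d\<close> unknots and the closure of a
  positive braid on \<open>r\<^bsub>k+1\<^esub> \<ge> 2\<close> strands in which every generator occurs at least twice, and is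
  never trivial.\<close>

definition is_unlink :: "(complex \<times> complex) set \<Rightarrow> bool" where
  "is_unlink L \<longleftrightarrow> (\<exists>n\<ge>1. ambient_isotopic L (braid_closure n []))"

end

theory Submission
  imports Defs
begin

text \<open>All isotopies are built from two kinds of moves. Points of an open disc that move without
  colliding drag the disc along, so a homotopy of loops of configurations gives an isotopy of closed
  braids; this yields conjugation and, by interpolating linearly between strands kept at different
  heights, every braid relation that is needed. A strand that is monotone in the imaginary part of
  the first coordinate can be pushed across the braid axis; this yields Markov destabilisation.

  In the braid \<open>\<Delta>\<^sub>R\<^sup>2\<^sup>v \<lambda>\<close> the left strands that cross some right strand are then
  destabilised from left to right. A left strand over \<open>d\<close> right strands leaves behind the run
  \<open>\<sigma>\<^sub>1 \<dots> \<sigma>\<^bsub>d-1\<^esub>\<close>, and the full twists on \<open>n\<close> right strands are powers of \<open>(\<sigma>\<^sub>1 \<dots> \<sigma>\<^bsub>n-1\<^esub>)\<^sup>n\<close>, which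
  gives the braid of a generalised T-link. Last exponents \<open>0\<close> and \<open>\<plusminus>1\<close> are removed by further
  destabilisations.\<close>

section \<open>Ambient isotopies\<close>

text \<open>Let n be the number of right strands. Before exceptional last exponents are treated, the
  parameters correspond as follows: left strands that cross nothing are the \<open>d\<close> free
  strands, the left strands that cross exactly r right strands with 2 \<le> r < n give the pair (r,
  s) with s their number, those that cross a single one leave an empty run, and if t left strands
  cross all n right strands, the last exponent is t + v n. So the bound on the last exponent says
  precisely that t \<ge> 0.

  The obstacle is that links are subsets of the sphere while braids are handled as words. Equality
  of braids is therefore defined by homotopy of paths of configurations, which acts on closures
  directly; the price is that each relation needs a geometric proof. One argument serves for all of
  them: if the strands can be given distinct heights such that the higher strand is the upper one at
  every crossing, then the heights and the permutation determine the braid. This covers the Artin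
  relations as well as the uniqueness of the Lorenz braid.\<close>

lemma S3_eq: "(z, w) \<in> S3 \<longleftrightarrow> (cmod z)\<^sup>2 + (cmod w)\<^sup>2 = 1"
  by (simp add: S3_def norm_Pair)

lemma compact_S3: "compact S3"
  by (simp add: S3_def)

lemma ambient_isotopic_refl: "ambient_isotopic A A"
  unfolding ambient_isotopic_def
proof (intro exI[of _ "\<lambda>t x. x"] conjI ballI)
  show "continuous_on ({0..1::real} \<times> S3) (\<lambda>(t::real, x). x)"
    by (simp add: case_prod_beta continuous_on_snd)
  show "\<exists>G. homeomorphism S3 S3 (\<lambda>x. x) G" for t
    by (rule exI, rule homeomorphism_ident)
qed auto

lemma ambient_isotopic_trans [trans]:
  assumes "ambient_isotopic A B" "ambient_isotopic B C"
  shows "ambient_isotopic A C"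
proof -
  obtain H where H: "continuous_on ({0..1::real} \<times> S3) (\<lambda>(t, x). H t x)"
    "\<And>t. t \<in> {0..1} \<Longrightarrow> \<exists>G. homeomorphism S3 S3 (H t) G" "\<And>x. x \<in> S3 \<Longrightarrow> H 0 x = x"
    "H (1::real) ` A = B"
    using assms(1) unfolding ambient_isotopic_def by blast
  obtain K where K: "continuous_on ({0..1::real} \<times> S3) (\<lambda>(t, x). K t x)"
    "\<And>t. t \<in> {0..1} \<Longrightarrow> \<exists>G. homeomorphism S3 S3 (K t) G" "\<And>x. x \<in> S3 \<Longrightarrow> K 0 x = x"
    "K (1::real) ` B = C"
    using assms(2) unfolding ambient_isotopic_def by blast
  have HS: "H t x \<in> S3" if "t \<in> {0..1}" "x \<in> S3" for t x
    using H(2)[OF that(1)] that(2) by (auto simp: homeomorphism_def)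
  show ?thesis unfolding ambient_isotopic_def
  proof (intro exI[of _ "\<lambda>t x. K t (H t x)"] conjI ballI)
    have "continuous_on ({0..1::real} \<times> S3) (\<lambda>p. (fst p, (\<lambda>(t, x). H t x) p))"
      by (intro continuous_intros H(1))
    moreover have "(\<lambda>p. (fst p, (\<lambda>(t, x). H t x) p)) ` ({0..1::real} \<times> S3) \<subseteq> {0..1::real} \<times> S3"
      using HS by auto
    ultimately have "continuous_on ({0..1::real} \<times> S3) ((\<lambda>(t, x). K t x) \<circ> (\<lambda>p. (fst p, (\<lambda>(t, x). H t x) p)))"
      by (intro continuous_on_compose) (auto intro: continuous_on_subset[OF K(1)])
    then show "continuous_on ({0..1::real} \<times> S3) (\<lambda>(t, x). K t (H t x))"
      by (simp add: o_def case_prod_beta)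
    show "\<exists>G. homeomorphism S3 S3 (\<lambda>x. K t (H t x)) G" if t: "t \<in> {0..1}" for t
    proof -
      obtain G1 G2 where "homeomorphism S3 S3 (H t) G1" "homeomorphism S3 S3 (K t) G2"
        using H(2)[OF t] K(2)[OF t] by blast
      from homeomorphism_compose[OF this] show ?thesis
        unfolding o_def by blast
    qed
    show "(\<lambda>x. K 1 (H 1 x)) ` A = C"
      by (simp add: image_image[of "K 1" "H 1" A, symmetric] H(4) K(4))
    show "K 0 (H 0 x) = x" if "x \<in> S3" for x
      using H(3)[OF that] K(3)[OF that] by simp
  qed
qed

lemma ambient_isotopic_sym:
  assumes "ambient_isotopic A B" "A \<subseteq> S3"
  shows "ambient_isotopic B A"
proof -
  obtain H where H: "continuous_on ({0..1::real} \<times> S3) (\<lambda>(t, x). H t x)"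
    "\<And>t. t \<in> {0..1} \<Longrightarrow> \<exists>G. homeomorphism S3 S3 (H t) G" "\<And>x. x \<in> S3 \<Longrightarrow> H 0 x = x"
    "H (1::real) ` A = B"
    using assms(1) unfolding ambient_isotopic_def by blast
  obtain G where G: "homeomorphism S3 S3 (H 1) G"
    using H(2)[of 1] by auto
  have GS: "G x \<in> S3" if "x \<in> S3" for x
    using G that by (auto simp: homeomorphism_def)
  show ?thesis unfolding ambient_isotopic_def
  proof (intro exI[of _ "\<lambda>t x. H (1 - t) (G x)"] conjI ballI)
    have "continuous_on ({0..1::real} \<times> S3) (\<lambda>p. G (snd p))"
      using homeomorphism_cont2[OF G]
      by (rule continuous_on_compose2) (auto intro: continuous_on_snd continuous_on_id)
    then have "continuous_on ({0..1::real} \<times> S3) (\<lambda>p. (1 - fst p, G (snd p)))"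
      by (intro continuous_intros)
    moreover have "(\<lambda>p. (1 - fst p, G (snd p))) ` ({0..1::real} \<times> S3) \<subseteq> {0..1::real} \<times> S3"
      using GS by auto
    ultimately have "continuous_on ({0..1::real} \<times> S3) ((\<lambda>(t, x). H t x) \<circ> (\<lambda>p. (1 - fst p, G (snd p))))"
      by (intro continuous_on_compose) (auto intro: continuous_on_subset[OF H(1)])
    then show "continuous_on ({0..1::real} \<times> S3) (\<lambda>(t, x). H (1 - t) (G x))"
      by (simp add: o_def case_prod_beta)
    show "\<exists>G'. homeomorphism S3 S3 (\<lambda>x. H (1 - t) (G x)) G'" if t: "t \<in> {0..1}" for t
    proof -
      obtain G1 where "homeomorphism S3 S3 (H (1 - t)) G1"
        using H(2)[of "1 - t"] t by auto
      from homeomorphism_compose[OF homeomorphism_symD[OF G] this] show ?thesis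
        unfolding o_def by blast
    qed
    have "H (1 - 1) (G (H 1 x)) = x" if "x \<in> A" for x
      using H(3)[OF subsetD[OF assms(2) that]] homeomorphism_apply1[OF G subsetD[OF assms(2) that]] by simp
    then show "(\<lambda>x. H (1 - 1) (G x)) ` B = A"
      unfolding H(4)[symmetric] image_image by auto
    show "H (1 - 0) (G x) = x" if "x \<in> S3" for x
      using G that by (auto simp: homeomorphism_def)
  qed
qed

text \<open>Surjectivity is automatic: a non-surjective self-map of the sphere is null-homotopic, while
  all \<^term>\<open>H t\<close> are homotopic to the identity.\<close>

lemma ambient_isotopicI:
  fixes H :: "real \<Rightarrow> complex \<times> complex \<Rightarrow> complex \<times> complex"
  assumes cont: "continuous_on ({0..1::real} \<times> S3) (\<lambda>(t, x). H t x)"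
    and S3: "\<And>t x. t \<in> {0..1} \<Longrightarrow> x \<in> S3 \<Longrightarrow> H t x \<in> S3"
    and inj: "\<And>t. t \<in> {0..1} \<Longrightarrow> inj_on (H t) S3"
    and id: "\<And>x. x \<in> S3 \<Longrightarrow> H 0 x = x"
    and img: "H 1 ` A = B"
  shows "ambient_isotopic A B"
  unfolding ambient_isotopic_def
proof (intro exI[of _ H] conjI ballI cont img)
  fix t :: real assume t: "t \<in> {0..1}"
  have contH: "continuous_on S3 (H t)"
    using continuous_on_compose2[OF cont, of S3 "\<lambda>x. (t, x)"] t
    by (simp add: continuous_on_Pair continuous_on_const continuous_on_id image_subset_iff)
  have "S3 \<subseteq> H t ` S3"
  proof
    fix y assume y: "y \<in> S3"
    show "y \<in> H t ` S3"
    proof (rule ccontr)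
      assume not: "y \<notin> H t ` S3"
      have "homotopic_with_canon (\<lambda>x. True) S3 S3 id (H t)"
      proof (subst homotopic_with, simp, intro exI[of _ "\<lambda>p. H (t * fst p) (snd p)"] conjI)
        have "continuous_on ({0..1::real} \<times> S3) (\<lambda>p. (t * fst p, snd p))"
          by (intro continuous_intros)
        moreover have "(\<lambda>p. (t * fst p, snd p)) ` ({0..1::real} \<times> S3) \<subseteq> {0..1::real} \<times> S3"
          using t by (auto simp: mult_le_one)
        ultimately have "continuous_on ({0..1::real} \<times> S3) ((\<lambda>(t, x). H t x) \<circ> (\<lambda>p. (t * fst p, snd p)))"
          by (intro continuous_on_compose) (auto intro: continuous_on_subset[OF cont])
        then have "continuous_on ({0..1::real} \<times> S3) (\<lambda>p. H (t * fst p) (snd p))"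
          by (simp add: o_def case_prod_beta)
        moreover have "(\<lambda>p. H (t * fst p) (snd p)) \<in> {0..1::real} \<times> S3 \<rightarrow> S3"
          using t S3 by (auto simp: mult_le_one)
        ultimately show "continuous_map (prod_topology (top_of_set {0..1}) (top_of_set S3)) (top_of_set S3)
          (\<lambda>p. H (t * fst p) (snd p))"
          by (simp flip: subtopology_Times)
      qed (use id in auto)
      \<comment> \<open>As \<open>y\<close> is missed, \<open>H t x\<close> is never antipodal to
        \<open>- y\<close>. The segment between these two points avoids 0 and can be projected
        radially to the sphere.\<close>
      moreover have "homotopic_with_canon (\<lambda>x. True) S3 S3 (H t) (\<lambda>x. - y)"
      proof -
        have nz: "(1 - u) *\<^sub>R a + u *\<^sub>R (- y) \<noteq> 0"
          if "a \<in> S3" "a \<noteq> y" "0 \<le> u" "u \<le> 1" for a u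
        proof
          assume "(1 - u) *\<^sub>R a + u *\<^sub>R (- y) = 0"
          then have *: "(1 - u) *\<^sub>R a = u *\<^sub>R y" by simp
          then have "norm ((1 - u) *\<^sub>R a) = norm (u *\<^sub>R y)" by (rule arg_cong)
          then have "1 - u = u" using that y by (simp add: S3_def)
          then have "u = 1/2" by simp
          with * that(2) show False by simp
        qed
        have "homotopic_with_canon (\<lambda>x. True) S3 (- {0}) (H t) (\<lambda>x. - y)"
        proof (rule homotopic_with_linear)
          fix x assume x: "x \<in> S3"
          have "H t x \<noteq> y" using x not by auto
          then show "closed_segment (H t x) (- y) \<subseteq> - {0}"
            using nz[OF S3[OF t x]] by (auto simp: closed_segment_def)
        qed (auto intro: contH)
        then have "homotopic_with_canon (\<lambda>x. True) S3 S3
            ((\<lambda>x. x /\<^sub>R norm x) \<circ> H t) ((\<lambda>x. x /\<^sub>R norm x) \<circ> (\<lambda>x. - y))"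
          by (rule homotopic_with_compose_continuous_map_left) (auto simp: S3_def intro!: continuous_intros)
        then show ?thesis
          by (rule homotopic_with_eq) (use S3[OF t] y in \<open>auto simp: S3_def\<close>)
      qed
      ultimately have "homotopic_with_canon (\<lambda>x. True) S3 S3 id (\<lambda>x. - y)"
        by (rule homotopic_with_trans)
      then have "contractible S3"
        unfolding contractible_def by blast
      then show False
        by (simp add: S3_def contractible_sphere)
    qed
  qed
  moreover have "H t ` S3 \<subseteq> S3" using S3[OF t] by auto
  ultimately have "H t ` S3 = S3" by auto
  then show "\<exists>G. homeomorphism S3 S3 (H t) G"
    using homeomorphism_compact[OF compact_S3 contH _ inj[OF t]] by blast
qed (use id in auto)

text \<open>A continuous surjection from a compact space to a Hausdorff space is a quotient map, so
  continuity can be tested upstairs. It is needed for the sphere as a quotient of an interval times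
  a disc.\<close>

lemma continuous_on_quotient:
  fixes q :: "'a::t2_space \<Rightarrow> 'b::t2_space" and f :: "'b \<Rightarrow> 'c::topological_space"
  assumes "compact S" "continuous_on S q" "continuous_on S (f \<circ> q)"
  shows "continuous_on (q ` S) f"
  unfolding continuous_openin_preimage_eq
proof (intro allI impI)
  fix T :: "'c set" assume T: "open T"
  have "openin (top_of_set S) (S \<inter> (f \<circ> q) -` T)"
    using assms(3) T unfolding continuous_openin_preimage_eq by blast
  moreover have "S \<inter> (f \<circ> q) -` T = S \<inter> q -` (q ` S \<inter> f -` T)" by auto
  ultimately show "openin (top_of_set (q ` S)) (q ` S \<inter> f -` T)"
    using Abstract_Topology_2.continuous_imp_quotient_map[OF assms(2) refl assms(1), of "q ` S \<inter> f -` T"] by auto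
qed

section \<open>Perturbations of the identity of a disc\<close>

text \<open>The distance of \<open>z\<close> to the circle on which \<open>U\<close> vanishes is
  \<open>r - cmod z\<close>, and by the Lipschitz bound the displacement is at most that.\<close>

lemma norm_perturbation_le:
  fixes U :: "complex \<Rightarrow> complex"
  assumes lip: "\<And>z z'. cmod (U z - U z') \<le> c * cmod (z - z')" and c: "c \<le> 1"
    and zero: "\<And>z. cmod z = r \<Longrightarrow> U z = 0" and z: "cmod z \<le> r" and t: "0 \<le> t" "t \<le> 1"
  shows "cmod (z + complex_of_real t * U z) \<le> r"
proof -
  \<comment> \<open>The point of the circle nearest to \<open>z\<close>; from the centre every point
    of the circle is equally near.\<close>
  define u where "u = (if z = 0 then complex_of_real r else complex_of_real (r / cmod z) * z)"
  have r: "0 \<le> r" using z norm_ge_zero[of z] by linarith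
  have u: "cmod u = r" using r by (auto simp: u_def norm_mult norm_divide)
  have "cmod (z - u) = r - cmod z"
  proof (cases "z = 0")
    case False
    have "z - u = complex_of_real (1 - r / cmod z) * z"
      by (simp add: u_def False algebra_simps)
    moreover have "1 - r / cmod z \<le> 0" using z False by (simp add: field_simps)
    ultimately have "cmod (z - u) = (r / cmod z - 1) * cmod z"
      by (simp only: norm_mult norm_of_real) simp
    then show ?thesis using False by (simp add: left_diff_distrib)
  qed (use r in \<open>simp add: u_def\<close>)
  then have "cmod (U z) \<le> c * (r - cmod z)"
    using lip[of z u] zero[OF u] by simp
  also have "\<dots> \<le> r - cmod z" using c z by (simp add: mult_left_le_one_le mult_right_le_one_le mult_le_cancel_right2)
  finally have "t * cmod (U z) \<le> r - cmod z"
    using t mult_left_le_one_le[of "cmod (U z)" t] by simp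
  then show ?thesis
    using norm_triangle_ineq[of z "complex_of_real t * U z"] t by (simp add: norm_mult)
qed

text \<open>The identity plus a map with Lipschitz constant below 1 cannot identify two points.
  Surjectivity being automatic, the perturbations are homeomorphisms without any inverse being
  written down.\<close>

lemma inj_perturbation:
  fixes U :: "complex \<Rightarrow> complex"
  assumes lip: "\<And>z z'. cmod (U z - U z') \<le> c * cmod (z - z')" and c: "c < 1"
    and t: "0 \<le> t" "t \<le> 1"
  shows "inj (\<lambda>z. z + complex_of_real t * U z)"
proof (rule injI, rule ccontr)
  fix z z' assume eq: "z + complex_of_real t * U z = z' + complex_of_real t * U z'" and ne: "z \<noteq> z'"
  then have "z - z' = complex_of_real t * (U z' - U z)" by (simp add: algebra_simps)
  then have "cmod (z - z') = t * cmod (U z' - U z)" using t by (simp add: norm_mult)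
  also have "\<dots> \<le> cmod (U z' - U z)" using t by (simp add: mult_left_le_one_le)
  also have "\<dots> \<le> c * cmod (z - z')" using lip[of z' z] by (simp add: norm_minus_commute)
  also have "\<dots> < cmod (z - z')" using c ne by simp
  finally show False by simp
qed

text \<open>A cone rather than a smooth cutoff: only continuity and the Lipschitz constant
  1/\<delta> are going to matter.\<close>

definition bump :: "real \<Rightarrow> complex \<Rightarrow> complex \<Rightarrow> real" where
  "bump \<delta> c z = max 0 (1 - cmod (z - c) / \<delta>)"

lemma bump_center [simp]: "bump \<delta> c c = 1"
  by (simp add: bump_def)

lemma bump_eq_0: "0 < \<delta> \<Longrightarrow> \<delta> \<le> cmod (z - c) \<Longrightarrow> bump \<delta> c z = 0"
  by (simp add: bump_def)

lemma bump_lipschitz: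
  assumes "0 < \<delta>"
  shows "\<bar>bump \<delta> c z - bump \<delta> c z'\<bar> \<le> cmod (z - z') / \<delta>"
proof -
  have "\<bar>bump \<delta> c z - bump \<delta> c z'\<bar> \<le> \<bar>cmod (z - c) / \<delta> - cmod (z' - c) / \<delta>\<bar>"
    unfolding bump_def by linarith
  also have "\<dots> = \<bar>cmod (z - c) - cmod (z' - c)\<bar> / \<delta>"
    using assms by (simp add: diff_divide_distrib[symmetric] abs_divide)
  also have "\<dots> \<le> cmod (z - z') / \<delta>"
    using norm_triangle_ineq3[of "z - c" "z' - c"] assms by (intro divide_right_mono) auto
  finally show ?thesis .
qed

lemma continuous_on_bump [continuous_intros]:
  assumes "continuous_on S c" "continuous_on S z" "\<delta> \<noteq> 0"
  shows "continuous_on S (\<lambda>x. bump \<delta> (c x) (z x))"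
  unfolding bump_def using assms by (intro continuous_intros) auto

section \<open>Solid torus coordinates on the sphere\<close>

lemma solid_torus_point_in_S3: "cmod z \<le> 1 \<Longrightarrow> solid_torus_point z \<theta> \<in> S3"
  by (simp add: solid_torus_point_def S3_eq norm_mult power_mult_distrib abs_square_le_1)

lemma cis_2pi_eq_iff:
  assumes "0 \<le> x" "x \<le> 1" "0 \<le> y" "y \<le> 1"
  shows "cis (2 * pi * x) = cis (2 * pi * y) \<longleftrightarrow> x = y \<or> {x, y} = {0, 1}"
proof
  assume "cis (2 * pi * x) = cis (2 * pi * y)"
  then have "sin (2 * pi * x) = sin (2 * pi * y) \<and> cos (2 * pi * x) = cos (2 * pi * y)"
    by (auto simp: complex_eq_iff)
  then obtain n :: int where "2 * pi * x = 2 * pi * y + 2 * pi * of_int n"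
    using sin_cos_eq_iff[of "2 * pi * x" "2 * pi * y"] by (auto simp: algebra_simps)
  then have "2 * pi * x = 2 * pi * (y + of_int n)" by (simp add: algebra_simps)
  then have n: "x = y + of_int n" by simp
  then have "real_of_int n \<le> 1" "real_of_int n \<ge> -1" using assms by linarith+
  then have "n = -1 \<or> n = 0 \<or> n = 1" by linarith
  then show "x = y \<or> {x, y} = {0, 1}" using n assms by auto
next
  assume "x = y \<or> {x, y} = {0, 1}"
  then show "cis (2 * pi * x) = cis (2 * pi * y)"
    by (auto simp: doubleton_eq_iff cis_2pi)
qed

lemma solid_torus_point_eq_iff:
  assumes "cmod z \<le> 1" "cmod z' \<le> 1"
  shows "solid_torus_point z x = solid_torus_point z' y \<longleftrightarrow> z = z' \<and> (cmod z = 1 \<or> cis x = cis y)"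
proof -
  have "1 - (cmod z)\<^sup>2 = 0 \<longleftrightarrow> cmod z = 1"
    using abs_square_eq_1[of "cmod z"] by auto
  then show ?thesis by (auto simp: solid_torus_point_def)
qed

text \<open>The sphere is the product of an interval and a closed disc with the end discs glued and,
  for each boundary point \<open>z\<close> of the disc, the interval over \<open>z\<close> collapsed
  to the point \<open>(z, 0)\<close> of the axis.\<close>

lemma S3_solid_torus_point:
  "S3 = (\<lambda>(\<theta>, z). solid_torus_point z (2 * pi * \<theta>)) ` ({0..1} \<times> cball 0 1)"
proof (intro equalityI subsetI)
  fix p assume p: "p \<in> S3"
  obtain z w where zw: "p = (z, w)" by fastforce
  have eq: "(cmod w)\<^sup>2 = 1 - (cmod z)\<^sup>2" using p by (simp add: zw S3_eq)
  have z: "cmod z \<le> 1" using eq zero_le_power2[of "cmod w"] abs_square_le_1[of "cmod z"] by auto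
  have "w = complex_of_real (cmod w) * cis (2 * pi * (Arg2pi w / (2 * pi)))"
    using Arg2pi[of w] by (simp add: is_Arg_def cis_conv_exp)
  moreover have "cmod w = sqrt (1 - (cmod z)\<^sup>2)"
    by (simp add: eq[symmetric])
  ultimately have "p = solid_torus_point z (2 * pi * (Arg2pi w / (2 * pi)))"
    by (simp add: zw solid_torus_point_def)
  moreover have "Arg2pi w / (2 * pi) \<in> {0..1}"
    using Arg2pi[of w] by (auto simp: field_simps)
  ultimately show "p \<in> (\<lambda>(\<theta>, z). solid_torus_point z (2 * pi * \<theta>)) ` ({0..1} \<times> cball 0 1)"
    using z by (intro image_eqI[of _ _ "(Arg2pi w / (2 * pi), z)"]) auto
qed (auto intro: solid_torus_point_in_S3)

lemma continuous_on_solid_torus_point [continuous_intros]: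
  assumes "continuous_on S z" "continuous_on S \<theta>"
  shows "continuous_on S (\<lambda>x. solid_torus_point (z x) (\<theta> x))"
  unfolding solid_torus_point_def using assms by (intro continuous_intros)

text \<open>A loop of disc isotopies fixing the boundary respects the identifications that produce
  the sphere: \<open>closed\<close> handles the glued end discs and \<open>boundary\<close> the
  collapsed intervals.\<close>

lemma fiberwise_isotopy:
  fixes h :: "real \<Rightarrow> real \<Rightarrow> complex \<Rightarrow> complex"
  assumes cont: "continuous_on ({0..1} \<times> {0..1} \<times> cball 0 1) (\<lambda>(t, \<theta>, z). h t \<theta> z)"
    and into: "\<And>t \<theta> z. \<lbrakk>t \<in> {0..1}; \<theta> \<in> {0..1}; cmod z \<le> 1\<rbrakk> \<Longrightarrow> cmod (h t \<theta> z) \<le> 1"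
    and inj: "\<And>t \<theta>. \<lbrakk>t \<in> {0..1}; \<theta> \<in> {0..1}\<rbrakk> \<Longrightarrow> inj_on (h t \<theta>) (cball 0 1)"
    and start: "\<And>\<theta> z. h 0 \<theta> z = z"
    and boundary: "\<And>t \<theta> z. \<lbrakk>t \<in> {0..1}; \<theta> \<in> {0..1}; cmod z = 1\<rbrakk> \<Longrightarrow> h t \<theta> z = z"
    and closed: "\<And>t z. h t 0 z = h t 1 z"
    and P: "P \<subseteq> {0..1} \<times> cball 0 1"
  shows "ambient_isotopic ((\<lambda>(\<theta>, z). solid_torus_point z (2 * pi * \<theta>)) ` P)
    ((\<lambda>(\<theta>, z). solid_torus_point (h 1 \<theta> z) (2 * pi * \<theta>)) ` P)"
proof -
  define D where "D = {0..1::real} \<times> cball (0::complex) 1"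
  define q where "q = (\<lambda>(\<theta>, z). solid_torus_point z (2 * pi * \<theta>))"
  define g where "g = (\<lambda>t (\<theta>, z). solid_torus_point (h t \<theta> z) (2 * pi * \<theta>))"
  \<comment> \<open>An arbitrary preimage under \<open>q\<close> is chosen; \<open>geq\<close> shows
    that the value does not depend on it.\<close>
  define H where "H = (\<lambda>t x. g t (SOME p. p \<in> D \<and> q p = x))"
  have qeq: "q (a, z) = q (b, z') \<longleftrightarrow> z = z' \<and> (cmod z = 1 \<or> a = b \<or> {a, b} = {0, 1})"
    if "(a, z) \<in> D" "(b, z') \<in> D" for a b z z'
    using that unfolding q_def D_def by (simp add: solid_torus_point_eq_iff cis_2pi_eq_iff)
  have h01: "h t a = h t b" if "{a, b} = {0, 1}" for t a b
    using that closed by (auto simp: doubleton_eq_iff fun_eq_iff)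
  have gq: "g t p = q (fst p, h t (fst p) (snd p))" for t p
    by (simp add: g_def q_def case_prod_beta)
  have hD: "(a, h t a z) \<in> D" if "t \<in> {0..1}" "(a, z) \<in> D" for t a z
    using that into by (auto simp: D_def)
  have geq: "g t p = g t p'" if t: "t \<in> {0..1}" and pp: "p \<in> D" "p' \<in> D" "q p = q p'" for t p p'
  proof -
    obtain a z b z' where p: "p = (a, z)" "p' = (b, z')" by fastforce
    have D: "(a, z) \<in> D" "(b, z') \<in> D" using pp p by auto
    have *: "z = z'" "cmod z = 1 \<or> a = b \<or> {a, b} = {0, 1}"
      using qeq[OF D] pp p by auto
    have "h t a z = h t b z'" "cmod (h t a z) = 1 \<or> a = b \<or> {a, b} = {0, 1}"
      using * h01 boundary[OF t, of a z] boundary[OF t, of b z'] D by (auto simp: D_def)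
    then show ?thesis
      using qeq[OF hD[OF t D(1)] hD[OF t D(2)]] by (simp add: p gq)
  qed
  have Hq: "H t (q p) = g t p" if "t \<in> {0..1}" "p \<in> D" for t p
  proof -
    have "(SOME p'. p' \<in> D \<and> q p' = q p) \<in> D \<and> q (SOME p'. p' \<in> D \<and> q p' = q p) = q p"
      by (rule someI[of _ p]) (use that in auto)
    then show ?thesis unfolding H_def using geq[OF that(1)] that(2) by blast
  qed
  have S3: "S3 = q ` D" by (simp add: S3_solid_torus_point q_def D_def)
  have qD: "q p \<in> S3" if "p \<in> D" for p using that S3 by auto
  have A: "ambient_isotopic (q ` P) (H 1 ` q ` P)"
  proof (rule ambient_isotopicI)
    have compD: "compact ({0..1::real} \<times> D)"
      unfolding D_def by (intro compact_Times) auto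
    have eq: "(\<lambda>(t, p). (t, q p)) ` ({0..1} \<times> D) = {0..1} \<times> S3"
      by (force simp: S3)
    have c1: "continuous_on ({0..1::real} \<times> D) (\<lambda>(t, p). (t, q p))"
      unfolding q_def case_prod_beta by (intro continuous_intros)
    have "continuous_on ({0..1::real} \<times> D) (\<lambda>(t, p). g t p)"
      unfolding g_def case_prod_beta
      using cont unfolding D_def case_prod_beta
      by (intro continuous_intros)
    moreover have "((\<lambda>(t, x). H t x) \<circ> (\<lambda>(t, p). (t, q p))) y = (\<lambda>(t, p). g t p) y"
      if "y \<in> {0..1} \<times> D" for y
      using that Hq by auto
    ultimately have "continuous_on ({0..1::real} \<times> D) ((\<lambda>(t, x). H t x) \<circ> (\<lambda>(t, p). (t, q p)))"
      by (simp cong: continuous_on_cong)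
    from continuous_on_quotient[OF compD c1 this]
    show "continuous_on ({0..1} \<times> S3) (\<lambda>(t, x). H t x)"
      unfolding eq .
  next
    fix t x assume t: "t \<in> {0..1::real}" and "x \<in> S3"
    then obtain p where p: "p \<in> D" "x = q p" unfolding S3 by auto
    show "H t x \<in> S3"
      using hD[OF t, of "fst p" "snd p"] p Hq[OF t p(1)] qD by (simp add: gq)
  next
    fix t :: real assume t: "t \<in> {0..1}"
    show "inj_on (H t) S3"
    proof (rule inj_onI)
      fix x y assume xy: "x \<in> S3" "y \<in> S3" "H t x = H t y"
      obtain a z where p: "(a, z) \<in> D" "x = q (a, z)" using xy(1) unfolding S3 by auto
      obtain b z' where p': "(b, z') \<in> D" "y = q (b, z')" using xy(2) unfolding S3 by auto
      have ab: "a \<in> {0..1}" "b \<in> {0..1}" "cmod z \<le> 1" "cmod z' \<le> 1"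
        using p(1) p'(1) by (auto simp: D_def)
      have "q (a, h t a z) = q (b, h t b z')"
        using xy Hq[OF t p(1)] Hq[OF t p'(1)] p p' by (simp add: gq)
      then have *: "h t a z = h t b z'" "cmod (h t a z) = 1 \<or> a = b \<or> {a, b} = {0, 1}"
        using qeq[OF hD[OF t p(1)] hD[OF t p'(1)]] by auto
      show "x = y"
      proof (cases "cmod (h t a z) = 1")
        case True
        \<comment> \<open>An image point on the boundary is fixed by the map and therefore, by
          injectivity, equals its preimage. So no interior point reaches the part that is
          collapsed.\<close>
        have "h t a (h t a z) = h t a z" "h t b (h t b z') = h t b z'"
          using boundary[OF t ab(1) True] boundary[OF t ab(2), of "h t b z'"] True * by auto
        then have "h t a z = z" "h t b z' = z'"
          using inj[OF t ab(1)] inj[OF t ab(2)] ab into[OF t ab(1) ab(3)] into[OF t ab(2) ab(4)]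
          by (auto simp: inj_on_def)
        then show ?thesis using * True qeq[OF p(1) p'(1)] p p' by simp
      next
        case False
        then have ab': "a = b \<or> {a, b} = {0, 1}" using * by auto
        then have "h t a = h t b" using h01 by blast
        then have "z = z'" using * inj[OF t ab(1)] ab by (auto simp: inj_on_def)
        then show ?thesis using ab' qeq[OF p(1) p'(1)] p p' by simp
      qed
    qed
  next
    fix x assume "x \<in> S3"
    then obtain p where p: "p \<in> D" "x = q p" unfolding S3 by auto
    then show "H 0 x = x" using Hq[of 0 p] by (simp add: gq start)
  qed simp
  have "H 1 ` q ` P = g 1 ` P"
    unfolding image_image using Hq[of 1] P by (intro image_cong) (auto simp: D_def)
  then show ?thesis using A unfolding q_def g_def by simp
qed

section \<open>Closures of paths of configurations\<close>

definition config_closure :: "nat \<Rightarrow> (real \<Rightarrow> nat \<Rightarrow> complex) \<Rightarrow> (complex \<times> complex) set" where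
  "config_closure m p = {solid_torus_point (p \<theta> j) (2 * pi * \<theta>) | \<theta> j. \<theta> \<in> {0..1} \<and> j \<in> {1..m}}"

lemma config_closure_image:
  "config_closure m p = (\<lambda>(\<theta>, z). solid_torus_point z (2 * pi * \<theta>)) `
     ((\<lambda>(\<theta>, j). (\<theta>, p \<theta> j)) ` ({0..1} \<times> {1..m}))"
proof (intro equalityI subsetI)
  fix x assume "x \<in> config_closure m p"
  then obtain \<theta> j where "x = solid_torus_point (p \<theta> j) (2 * pi * \<theta>)" "\<theta> \<in> {0..1}" "j \<in> {1..m}"
    unfolding config_closure_def by blast
  then show "x \<in> (\<lambda>(\<theta>, z). solid_torus_point z (2 * pi * \<theta>)) `
     ((\<lambda>(\<theta>, j). (\<theta>, p \<theta> j)) ` ({0..1} \<times> {1..m}))"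
    by (intro image_eqI[of _ _ "(\<theta>, p \<theta> j)"] image_eqI[of _ _ "(\<theta>, j)"]) auto
next
  fix x assume "x \<in> (\<lambda>(\<theta>, z). solid_torus_point z (2 * pi * \<theta>)) `
     ((\<lambda>(\<theta>, j). (\<theta>, p \<theta> j)) ` ({0..1} \<times> {1..m}))"
  then obtain \<theta> j where "x = solid_torus_point (p \<theta> j) (2 * pi * \<theta>)" "\<theta> \<in> {0..1}" "j \<in> {1..m}"
    by (elim imageE SigmaE) simp
  then show "x \<in> config_closure m p"
    unfolding config_closure_def by blast
qed

lemma config_closure_subset:
  assumes "\<And>\<theta> j. \<theta> \<in> {0..1} \<Longrightarrow> j \<in> {1..m} \<Longrightarrow> cmod (p \<theta> j) \<le> 1"
  shows "config_closure m p \<subseteq> S3"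
  unfolding config_closure_def using assms by (auto intro!: solid_torus_point_in_S3)

lemma config_closure_cong:
  assumes "\<And>\<theta> j. \<theta> \<in> {0..1} \<Longrightarrow> j \<in> {1..m} \<Longrightarrow> p \<theta> j = q \<theta> j"
  shows "config_closure m p = config_closure m q"
  unfolding config_closure_def using assms by (intro Collect_cong) metis

text \<open>The discs are perturbed by the sum of the displacements \<open>q - p\<close>, weighted
  with bumps of radius \<delta> around the points of \<open>p\<close>. By separation only one bump
  is nonzero at each of these points, so they move to \<open>q\<close>; the bumps vanish on the unit
  circle; and the Lipschitz constant is at most m \<kappa> / \<delta> < 1.\<close>

lemma config_step:
  fixes p q :: "real \<Rightarrow> nat \<Rightarrow> complex"
  assumes cont: "\<And>j. j \<in> {1..m} \<Longrightarrow> continuous_on {0..1} (\<lambda>\<theta>. p \<theta> j)"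
      "\<And>j. j \<in> {1..m} \<Longrightarrow> continuous_on {0..1} (\<lambda>\<theta>. q \<theta> j)"
    and \<delta>: "0 < \<delta>" and \<kappa>: "0 \<le> \<kappa>" "real m * \<kappa> < \<delta>"
    and sep: "\<And>\<theta> i j. \<lbrakk>\<theta> \<in> {0..1}; i \<in> {1..m}; j \<in> {1..m}; i \<noteq> j\<rbrakk> \<Longrightarrow> \<delta> \<le> cmod (p \<theta> i - p \<theta> j)"
    and disc: "\<And>\<theta> j. \<lbrakk>\<theta> \<in> {0..1}; j \<in> {1..m}\<rbrakk> \<Longrightarrow> cmod (p \<theta> j) \<le> 1 - \<delta>"
    and near: "\<And>\<theta> j. \<lbrakk>\<theta> \<in> {0..1}; j \<in> {1..m}\<rbrakk> \<Longrightarrow> cmod (q \<theta> j - p \<theta> j) \<le> \<kappa>"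
    and perm: "bij_betw \<sigma> {1..m} {1..m}" "\<And>j. j \<in> {1..m} \<Longrightarrow> p 1 j = p 0 (\<sigma> j)"
      "\<And>j. j \<in> {1..m} \<Longrightarrow> q 1 j = q 0 (\<sigma> j)"
  shows "ambient_isotopic (config_closure m p) (config_closure m q)"
proof -
  define U where "U \<theta> z = (\<Sum>j\<in>{1..m}. complex_of_real (bump \<delta> (p \<theta> j) z) * (q \<theta> j - p \<theta> j))" for \<theta> z
  define c where "c = real m * \<kappa> / \<delta>"
  have c: "c < 1" "0 \<le> c" using \<delta> \<kappa> by (simp_all add: c_def)
  have lip: "cmod (U \<theta> z - U \<theta> z') \<le> c * cmod (z - z')" if \<theta>: "\<theta> \<in> {0..1}" for \<theta> z z'
  proof -
    have "cmod (U \<theta> z - U \<theta> z')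
        = cmod (\<Sum>j\<in>{1..m}. complex_of_real (bump \<delta> (p \<theta> j) z - bump \<delta> (p \<theta> j) z') * (q \<theta> j - p \<theta> j))"
      unfolding U_def sum_subtractf[symmetric] by (simp only: left_diff_distrib of_real_diff)
    also have "\<dots> \<le> (\<Sum>j\<in>{1..m}. cmod (z - z') / \<delta> * \<kappa>)"
    proof (rule sum_norm_le)
      fix j assume j: "j \<in> {1..m}"
      have "cmod (complex_of_real (bump \<delta> (p \<theta> j) z - bump \<delta> (p \<theta> j) z') * (q \<theta> j - p \<theta> j))
        = \<bar>bump \<delta> (p \<theta> j) z - bump \<delta> (p \<theta> j) z'\<bar> * cmod (q \<theta> j - p \<theta> j)"
        by (simp only: norm_mult norm_of_real)
      also have "\<dots> \<le> cmod (z - z') / \<delta> * \<kappa>"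
        using bump_lipschitz[OF \<delta>, of "p \<theta> j" z z'] near[OF \<theta> j] \<delta>
        by (intro mult_mono) auto
      finally show "cmod (complex_of_real (bump \<delta> (p \<theta> j) z - bump \<delta> (p \<theta> j) z') * (q \<theta> j - p \<theta> j))
        \<le> cmod (z - z') / \<delta> * \<kappa>" .
    qed
    also have "\<dots> = c * cmod (z - z')"
      using \<delta> by (simp add: c_def field_simps)
    finally show ?thesis .
  qed
  have zero: "U \<theta> z = 0" if "\<theta> \<in> {0..1}" "cmod z = 1" for \<theta> z
    unfolding U_def
  proof (rule sum.neutral, rule ballI)
    fix j assume j: "j \<in> {1..m}"
    have "\<delta> \<le> cmod (z - p \<theta> j)"
      using disc[OF that(1) j] that(2) norm_triangle_ineq2[of z "p \<theta> j"] by linarith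
    then show "complex_of_real (bump \<delta> (p \<theta> j) z) * (q \<theta> j - p \<theta> j) = 0"
      using bump_eq_0[OF \<delta>] by simp
  qed
  have moved: "U \<theta> (p \<theta> j) = q \<theta> j - p \<theta> j" if "\<theta> \<in> {0..1}" "j \<in> {1..m}" for \<theta> j
  proof -
    have "U \<theta> (p \<theta> j) = (\<Sum>i\<in>{1..m}. if i = j then q \<theta> j - p \<theta> j else 0)"
      unfolding U_def
    proof (rule sum.cong[OF refl])
      fix i assume i: "i \<in> {1..m}"
      show "complex_of_real (bump \<delta> (p \<theta> i) (p \<theta> j)) * (q \<theta> i - p \<theta> i) = (if i = j then q \<theta> j - p \<theta> j else 0)"
        using bump_eq_0[OF \<delta> sep[OF that(1) that(2) i]] by auto
    qed
    then show ?thesis using that by simp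
  qed
  \<comment> \<open>The permutation makes the first and the last configuration agree as sets of
    points with displacements, so that the perturbation closes up.\<close>
  have U01: "U 1 z = U 0 z" for z
  proof -
    have "U 1 z = (\<Sum>j\<in>{1..m}. complex_of_real (bump \<delta> (p 0 (\<sigma> j)) z) * (q 0 (\<sigma> j) - p 0 (\<sigma> j)))"
      unfolding U_def using perm by (intro sum.cong) auto
    also have "\<dots> = U 0 z"
      unfolding U_def by (rule sum.reindex_bij_betw[OF perm(1)])
    finally show ?thesis .
  qed
  define h where "h = (\<lambda>t \<theta> z. z + complex_of_real t * U \<theta> z)"
  define P where "P = (\<lambda>(\<theta>, j). (\<theta>, p \<theta> j)) ` ({0..1} \<times> {1..m})"
  have "ambient_isotopic ((\<lambda>(\<theta>, z). solid_torus_point z (2 * pi * \<theta>)) ` P)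
    ((\<lambda>(\<theta>, z). solid_torus_point (h 1 \<theta> z) (2 * pi * \<theta>)) ` P)"
  proof (rule fiberwise_isotopy)
    have contp: "continuous_on ({0..1::real} \<times> {0..1} \<times> cball (0::complex) 1) (\<lambda>x. p (fst (snd x)) j)"
      "continuous_on ({0..1::real} \<times> {0..1} \<times> cball (0::complex) 1) (\<lambda>x. q (fst (snd x)) j)"
      if "j \<in> {1..m}" for j
      by (rule continuous_on_compose2[OF cont(1)[OF that]] continuous_on_compose2[OF cont(2)[OF that]];
          (intro continuous_intros)?; force)+
    show "continuous_on ({0..1} \<times> {0..1} \<times> cball 0 1) (\<lambda>(t, \<theta>, z). h t \<theta> z)"
      unfolding h_def U_def case_prod_beta
      using \<delta> by (intro continuous_intros contp) auto
    show "cmod (h t \<theta> z) \<le> 1" if "t \<in> {0..1}" "\<theta> \<in> {0..1}" "cmod z \<le> 1" for t \<theta> z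
      unfolding h_def using that c zero
      by (intro norm_perturbation_le[OF lip[OF that(2)]]) auto
    show "inj_on (h t \<theta>) (cball 0 1)" if "t \<in> {0..1}" "\<theta> \<in> {0..1}" for t \<theta>
      unfolding h_def using that c
      by (intro inj_on_subset[OF inj_perturbation[OF lip[OF that(2)]]]) auto
    have "cmod (p \<theta> j) \<le> 1" if "\<theta> \<in> {0..1}" "j \<in> {1..m}" for \<theta> j
      using disc[OF that] \<delta> by simp
    then show "P \<subseteq> {0..1} \<times> cball 0 1"
      by (auto simp: P_def)
  qed (use zero U01 in \<open>simp_all add: h_def\<close>)
  moreover have "(\<lambda>(\<theta>, z). solid_torus_point (h 1 \<theta> z) (2 * pi * \<theta>)) ` P = config_closure m q"
  proof -
    have "h 1 \<theta> (p \<theta> j) = q \<theta> j" if "\<theta> \<in> {0..1}" "j \<in> {1..m}" for \<theta> j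
      using moved[OF that] by (simp add: h_def)
    then show ?thesis
      unfolding P_def config_closure_image image_image by (intro image_cong) auto
  qed
  ultimately show ?thesis unfolding config_closure_image P_def by simp
qed

section \<open>Isotopy extension for moving configurations\<close>

lemma finite_common_bound:
  fixes P :: "'a \<Rightarrow> real \<Rightarrow> bool"
  assumes "finite A" "\<And>x. x \<in> A \<Longrightarrow> \<exists>d>0. P x d" "\<And>x d e. x \<in> A \<Longrightarrow> P x d \<Longrightarrow> 0 < e \<Longrightarrow> e \<le> d \<Longrightarrow> P x e"
  shows "\<exists>d>0. \<forall>x\<in>A. P x d"
proof -
  obtain f where f: "\<And>x. x \<in> A \<Longrightarrow> 0 < f x \<and> P x (f x)"
    using assms(2) by metis
  define d where "d = Min (insert 1 (f ` A))"
  have d: "0 < d" using assms(1) f by (simp add: d_def)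
  have "P x d" if "x \<in> A" for x
  proof (rule assms(3)[OF that _ d])
    show "P x (f x)" using f[OF that] by blast
    show "d \<le> f x" unfolding d_def using assms(1) that by (intro Min_le) auto
  qed
  then show ?thesis using d by blast
qed

lemma compact_positive_bound:
  fixes f :: "'a::topological_space \<Rightarrow> real"
  assumes "compact K" "continuous_on K f" "\<And>x. x \<in> K \<Longrightarrow> 0 < f x"
  shows "\<exists>d>0. \<forall>x\<in>K. d \<le> f x"
proof (cases "K = {}")
  case False
  then show ?thesis
    using continuous_attains_inf[OF assms(1) False assms(2)] assms(3) by blast
qed (auto intro: exI[of _ 1])

text \<open>By compactness the points keep a distance \<delta> from one another and from the unit
  circle. By uniform continuity a short step in \<open>t\<close> moves each of them by at most
  \<delta> / (m + 1), so finitely many applications of \<open>config_step\<close> lead from 0 to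
  1.\<close>

lemma config_family_isotopy:
  fixes H :: "real \<Rightarrow> real \<Rightarrow> nat \<Rightarrow> complex"
  assumes cont: "\<And>j. j \<in> {1..m} \<Longrightarrow> continuous_on ({0..1} \<times> {0..1}) (\<lambda>(t, \<theta>). H t \<theta> j)"
    and disc: "\<And>t \<theta> j. \<lbrakk>t \<in> {0..1}; \<theta> \<in> {0..1}; j \<in> {1..m}\<rbrakk> \<Longrightarrow> cmod (H t \<theta> j) < 1"
    and inj: "\<And>t \<theta>. \<lbrakk>t \<in> {0..1}; \<theta> \<in> {0..1}\<rbrakk> \<Longrightarrow> inj_on (H t \<theta>) {1..m}"
    and perm: "bij_betw \<sigma> {1..m} {1..m}"
      "\<And>t j. t \<in> {0..1} \<Longrightarrow> j \<in> {1..m} \<Longrightarrow> H t 1 j = H t 0 (\<sigma> j)"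
  shows "ambient_isotopic (config_closure m (H 0)) (config_closure m (H 1))"
proof -
  let ?K = "{0..1::real} \<times> {0..1::real}"
  have K: "compact ?K" by (intro compact_Times compact_Icc)
  have "\<exists>d>0. \<forall>j\<in>{1..m}. \<forall>x\<in>?K. d \<le> 1 - cmod (H (fst x) (snd x) j)"
  proof (rule finite_common_bound)
    fix j assume j: "j \<in> {1..m}"
    show "\<exists>d>0. \<forall>x\<in>?K. d \<le> 1 - cmod (H (fst x) (snd x) j)"
    proof (rule compact_positive_bound[OF K])
      show "continuous_on ?K (\<lambda>x. 1 - cmod (H (fst x) (snd x) j))"
        using cont[OF j] unfolding case_prod_beta by (intro continuous_intros)
      show "0 < 1 - cmod (H (fst x) (snd x) j)" if "x \<in> ?K" for x
        using disc[OF _ _ j, of "fst x" "snd x"] that by auto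
    qed
  next
    fix j and d e :: real
    assume "\<forall>x\<in>?K. d \<le> 1 - cmod (H (fst x) (snd x) j)" "e \<le> d"
    then show "\<forall>x\<in>?K. e \<le> 1 - cmod (H (fst x) (snd x) j)"
      by (meson order_trans)
  qed simp
  then obtain d1 where d1: "d1 > 0" and
    d1': "\<And>j x. j \<in> {1..m} \<Longrightarrow> x \<in> ?K \<Longrightarrow> d1 \<le> 1 - cmod (H (fst x) (snd x) j)"
    by blast
  have d1'': "cmod (H t \<theta> j) \<le> 1 - d1" if "t \<in> {0..1}" "\<theta> \<in> {0..1}" "j \<in> {1..m}" for t \<theta> j
    using d1'[OF that(3), of "(t, \<theta>)"] that by simp
  have "\<exists>d>0. \<forall>ij\<in>{1..m} \<times> {1..m} - Id. \<forall>x\<in>?K. d \<le> cmod (H (fst x) (snd x) (fst ij) - H (fst x) (snd x) (snd ij))"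
  proof (rule finite_common_bound)
    fix ij assume ij: "ij \<in> {1..m} \<times> {1..m} - Id"
    then have j: "fst ij \<in> {1..m}" "snd ij \<in> {1..m}" "fst ij \<noteq> snd ij" by auto
    have ne: "H t \<theta> (fst ij) \<noteq> H t \<theta> (snd ij)" if "t \<in> {0..1}" "\<theta> \<in> {0..1}" for t \<theta>
      using inj[OF that] j unfolding inj_on_def by blast
    show "\<exists>d>0. \<forall>x\<in>?K. d \<le> cmod (H (fst x) (snd x) (fst ij) - H (fst x) (snd x) (snd ij))"
    proof (rule compact_positive_bound[OF K])
      show "continuous_on ?K (\<lambda>x. cmod (H (fst x) (snd x) (fst ij) - H (fst x) (snd x) (snd ij)))"
        using cont[OF j(1)] cont[OF j(2)] unfolding case_prod_beta by (intro continuous_intros)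
      show "0 < cmod (H (fst x) (snd x) (fst ij) - H (fst x) (snd x) (snd ij))" if "x \<in> ?K" for x
        using ne[of "fst x" "snd x"] that by auto
    qed
  next
    fix ij and d e :: real
    assume "\<forall>x\<in>?K. d \<le> cmod (H (fst x) (snd x) (fst ij) - H (fst x) (snd x) (snd ij))" "e \<le> d"
    then show "\<forall>x\<in>?K. e \<le> cmod (H (fst x) (snd x) (fst ij) - H (fst x) (snd x) (snd ij))"
      by (meson order_trans)
  qed simp
  then obtain d2 where d2: "d2 > 0" and
    d2': "\<And>ij x. ij \<in> {1..m} \<times> {1..m} - Id \<Longrightarrow> x \<in> ?K \<Longrightarrow>
      d2 \<le> cmod (H (fst x) (snd x) (fst ij) - H (fst x) (snd x) (snd ij))"
    by blast
  have d2'': "d2 \<le> cmod (H t \<theta> i - H t \<theta> j)"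
    if "t \<in> {0..1}" "\<theta> \<in> {0..1}" "i \<in> {1..m}" "j \<in> {1..m}" "i \<noteq> j" for t \<theta> i j
    using d2'[of "(i, j)" "(t, \<theta>)"] that by simp
  define \<delta> where "\<delta> = min d1 d2"
  have \<delta>: "\<delta> > 0" "\<delta> \<le> d1" "\<delta> \<le> d2" using d1 d2 by (auto simp: \<delta>_def)
  define \<kappa> where "\<kappa> = \<delta> / (real m + 1)"
  have \<kappa>: "\<kappa> > 0" "real m * \<kappa> < \<delta>" using \<delta> by (auto simp: \<kappa>_def field_simps)
  have "\<exists>d>0. \<forall>j\<in>{1..m}. \<forall>x\<in>?K. \<forall>y\<in>?K. dist y x < d \<longrightarrow> dist (H (fst y) (snd y) j) (H (fst x) (snd x) j) < \<kappa>"
  proof (rule finite_common_bound)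
    fix j assume j: "j \<in> {1..m}"
    have "uniformly_continuous_on ?K (\<lambda>(t, \<theta>). H t \<theta> j)"
      using compact_uniformly_continuous[OF cont[OF j] K] .
    then show "\<exists>d>0. \<forall>x\<in>?K. \<forall>y\<in>?K. dist y x < d \<longrightarrow> dist (H (fst y) (snd y) j) (H (fst x) (snd x) j) < \<kappa>"
      unfolding uniformly_continuous_on_def case_prod_beta using \<kappa>(1) by blast
  next
    fix j and d e :: real
    assume "\<forall>x\<in>?K. \<forall>y\<in>?K. dist y x < d \<longrightarrow> dist (H (fst y) (snd y) j) (H (fst x) (snd x) j) < \<kappa>" "e \<le> d"
    then show "\<forall>x\<in>?K. \<forall>y\<in>?K. dist y x < e \<longrightarrow> dist (H (fst y) (snd y) j) (H (fst x) (snd x) j) < \<kappa>"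
      by (meson less_le_trans)
  qed simp
  then obtain d where d: "d > 0" and d': "\<And>j x y. \<lbrakk>j \<in> {1..m}; x \<in> ?K; y \<in> ?K; dist y x < d\<rbrakk>
      \<Longrightarrow> dist (H (fst y) (snd y) j) (H (fst x) (snd x) j) < \<kappa>"
    by blast
  have d'': "cmod (H t \<theta> j - H t' \<theta> j) \<le> \<kappa>"
    if "t \<in> {0..1}" "t' \<in> {0..1}" "\<theta> \<in> {0..1}" "j \<in> {1..m}" "\<bar>t - t'\<bar> < d" for t t' \<theta> j
    using d'[OF that(4), of "(t', \<theta>)" "(t, \<theta>)"] that
    by (simp add: dist_Pair_Pair dist_norm[of "H _ _ _"] dist_real_def)
  obtain n :: nat where n: "1 / real (Suc n) < d" using nat_approx_posE[OF d] by blast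
  have step: "ambient_isotopic (config_closure m (H t)) (config_closure m (H t'))"
    if t: "t \<in> {0..1}" "t' \<in> {0..1}" "\<bar>t' - t\<bar> < d" for t t'
  proof (rule config_step[of m "H t" "H t'" \<delta> \<kappa> \<sigma>])
    have c: "continuous_on {0..1} (\<lambda>\<theta>. H s \<theta> j)" if "s \<in> {0..1}" "j \<in> {1..m}" for s j
      using continuous_on_compose2[OF cont[OF that(2)], of "{0..1}" "\<lambda>\<theta>. (s, \<theta>)"] that(1)
      by (simp add: continuous_on_Pair continuous_on_const continuous_on_id image_subset_iff)
    show "continuous_on {0..1} (\<lambda>\<theta>. H t \<theta> j)" "continuous_on {0..1} (\<lambda>\<theta>. H t' \<theta> j)"
      if "j \<in> {1..m}" for j
      using c t that by blast+
    show "\<delta> \<le> cmod (H t \<theta> i - H t \<theta> j)" if "\<theta> \<in> {0..1}" "i \<in> {1..m}" "j \<in> {1..m}" "i \<noteq> j" for \<theta> i j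
      using d2''[OF t(1) that] \<delta> by simp
    show "cmod (H t \<theta> j) \<le> 1 - \<delta>" if "\<theta> \<in> {0..1}" "j \<in> {1..m}" for \<theta> j
      using d1''[OF t(1) that] \<delta> by simp
    show "cmod (H t' \<theta> j - H t \<theta> j) \<le> \<kappa>" if "\<theta> \<in> {0..1}" "j \<in> {1..m}" for \<theta> j
      using d''[OF t(2) t(1) that t(3)] .
  qed (use \<delta> \<kappa> t perm in simp_all)
  have "ambient_isotopic (config_closure m (H 0)) (config_closure m (H (real k / real (Suc n))))"
    if "k \<le> Suc n" for k
    using that
  proof (induction k)
    case (Suc k)
    have "ambient_isotopic (config_closure m (H (real k / real (Suc n)))) (config_closure m (H (real (Suc k) / real (Suc n))))"
    proof (rule step)
      have "real (Suc k) / real (Suc n) - real k / real (Suc n) = 1 / real (Suc n)"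
        by (simp add: diff_divide_distrib[symmetric])
      then show "\<bar>real (Suc k) / real (Suc n) - real k / real (Suc n)\<bar> < d"
        using n by simp
    qed (use Suc.prems in \<open>auto simp: field_simps\<close>)
    then show ?case using Suc ambient_isotopic_trans by auto
  qed (simp add: ambient_isotopic_refl)
  from this[of "Suc n"] show ?thesis by simp
qed

section \<open>Pushing an arc across the braid axis\<close>

text \<open>On the half sphere \<open>Re z \<ge> 0\<close> a point is given by
  \<open>y = Im z\<close> and \<open>w\<close>; for fixed \<open>y\<close> the values of
  \<open>w\<close> fill a disc of radius \<open>sqrt (1 - y^2)\<close>. Unlike the fibre discs of
  the solid torus, these discs meet the braid axis \<open>w = 0\<close> in an interior point, so
  pushing along them can change the winding around the axis.\<close>

definition hemisphere_point :: "real \<Rightarrow> complex \<Rightarrow> complex \<times> complex" where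
  "hemisphere_point y w = (complex_of_real (sqrt (1 - y\<^sup>2 - (cmod w)\<^sup>2)) + \<i> * complex_of_real y, w)"

lemma hemisphere_point_in_S3:
  assumes "(cmod w)\<^sup>2 \<le> 1 - y\<^sup>2"
  shows "hemisphere_point y w \<in> S3"
  unfolding hemisphere_point_def S3_eq using assms by (simp add: cmod_power2)

lemma S3_hemisphere_point:
  assumes "x \<in> S3" "0 \<le> Re (fst x)"
  shows "x = hemisphere_point (Im (fst x)) (snd x)"
proof -
  have "(Re (fst x))\<^sup>2 + (Im (fst x))\<^sup>2 + (cmod (snd x))\<^sup>2 = 1"
    using assms(1) S3_eq[of "fst x" "snd x"] by (simp add: cmod_power2)
  then have "1 - (Im (fst x))\<^sup>2 - (cmod (snd x))\<^sup>2 = (Re (fst x))\<^sup>2" by linarith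
  then show ?thesis
    using assms(2) by (simp add: hemisphere_point_def prod_eq_iff complex_eq_iff)
qed

lemma continuous_on_hemisphere_point [continuous_intros]:
  assumes "continuous_on S y" "continuous_on S w"
  shows "continuous_on S (\<lambda>x. hemisphere_point (y x) (w x))"
  unfolding hemisphere_point_def using assms by (intro continuous_intros)

text \<open>The isotopy preserves the imaginary part of the first coordinate and, on each of its level
  sets in the half sphere \<open>Re z \<ge> 0\<close>, moves the point \<open>w0 y\<close> to \<open>w1 y\<close>.\<close>

lemma hemisphere_push:
  fixes w0 w1 :: "real \<Rightarrow> complex"
  assumes h: "0 < h" "h < 1" and R: "0 < R" "\<kappa> < R"
    and cont: "continuous_on {-h..h} w0" "continuous_on {-h..h} w1"
    and ends: "w0 h = w1 h" "w0 (-h) = w1 (-h)"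
    and near: "\<And>y. y \<in> {-h..h} \<Longrightarrow> cmod (w1 y - w0 y) \<le> \<kappa>"
    and inside: "\<And>y. y \<in> {-h..h} \<Longrightarrow> cmod (w0 y) + R \<le> sqrt (1 - h\<^sup>2)"
    and S: "S \<subseteq> S3" "\<And>x. x \<in> S \<Longrightarrow> Re (fst x) \<le> 0 \<or> h \<le> \<bar>Im (fst x)\<bar>"
  shows "ambient_isotopic (S \<union> (\<lambda>y. hemisphere_point y (w0 y)) ` {-h..h})
    (S \<union> (\<lambda>y. hemisphere_point y (w1 y)) ` {-h..h})"
proof -
  \<comment> \<open>Clamping extends the displacement continuously to all levels. Outside the band
    it is the displacement at \<open>h\<close> or \<open>-h\<close>, which \<open>ends\<close> makes
    zero.\<close>
  define cl where "cl y = max (-h) (min h y)" for y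
  have cl: "cl y \<in> {-h..h}" for y using h by (auto simp: cl_def)
  have clid: "cl y = y" if "y \<in> {-h..h}" for y using that by (auto simp: cl_def)
  define U where "U y w = complex_of_real (bump R (w0 (cl y)) w) * (w1 (cl y) - w0 (cl y))" for y w
  have \<kappa>: "0 \<le> \<kappa>" using order_trans[OF norm_ge_zero near[of 0]] h by simp
  have lip: "cmod (U y w - U y w') \<le> (\<kappa> / R) * cmod (w - w')" for y w w'
  proof -
    have "U y w - U y w' = complex_of_real (bump R (w0 (cl y)) w - bump R (w0 (cl y)) w') * (w1 (cl y) - w0 (cl y))"
      by (simp add: U_def algebra_simps)
    then have "cmod (U y w - U y w') = \<bar>bump R (w0 (cl y)) w - bump R (w0 (cl y)) w'\<bar> * cmod (w1 (cl y) - w0 (cl y))"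
      by (simp only: norm_mult norm_of_real)
    also have "\<dots> \<le> (cmod (w - w') / R) * \<kappa>"
      using R(1) by (intro mult_mono bump_lipschitz near cl) auto
    finally show ?thesis by (simp add: mult.commute)
  qed
  have c: "\<kappa> / R < 1" using R by simp
  have far: "U y w = 0" if "h \<le> \<bar>y\<bar>" for y w
  proof -
    have "cl y = h \<or> cl y = - h" using that h by (auto simp: cl_def)
    then show ?thesis using ends by (auto simp: U_def)
  qed
  \<comment> \<open>The boundary of a level disc is where \<open>Re z = 0\<close>. There the push
    must be the identity in order to fit together with the identity on the other half
    sphere.\<close>
  have zero: "U y w = 0" if "cmod w = sqrt (1 - y\<^sup>2)" for y w
  proof (cases "h \<le> \<bar>y\<bar>")
    case False
    then have "y\<^sup>2 \<le> h\<^sup>2" using power2_le_iff_abs_le[of h y] h by simp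
    then have "sqrt (1 - h\<^sup>2) \<le> cmod w" using that by simp
    then have "R \<le> cmod (w - w0 (cl y))"
      using inside[OF cl, of y] norm_triangle_ineq2[of w "w0 (cl y)"] by linarith
    then show ?thesis using bump_eq_0[OF R(1)] by (simp add: U_def)
  qed (rule far)
  define W where "W t x = snd x + complex_of_real t * U (Im (fst x)) (snd x)" for t and x :: "complex \<times> complex"
  have W_le: "(cmod (W t x))\<^sup>2 \<le> 1 - (Im (fst x))\<^sup>2" if t: "t \<in> {0..1}" and x: "x \<in> S3" for t x
  proof -
    have *: "(Re (fst x))\<^sup>2 + (Im (fst x))\<^sup>2 + (cmod (snd x))\<^sup>2 = 1"
      using x S3_eq[of "fst x" "snd x"] by (simp add: cmod_power2)
    then have y: "0 \<le> 1 - (Im (fst x))\<^sup>2" and "(cmod (snd x))\<^sup>2 \<le> 1 - (Im (fst x))\<^sup>2"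
      using zero_le_power2[of "Re (fst x)"] zero_le_power2[of "cmod (snd x)"] by linarith+
    then have "cmod (snd x) \<le> sqrt (1 - (Im (fst x))\<^sup>2)" by (simp add: real_le_rsqrt)
    then have "cmod (W t x) \<le> sqrt (1 - (Im (fst x))\<^sup>2)"
      unfolding W_def using t c zero by (intro norm_perturbation_le[OF lip]) auto
    then show ?thesis using y sqrt_ge_absD[of "cmod (W t x)"] by simp
  qed
  define H where "H t x = (if Re (fst x) \<le> 0 then x else hemisphere_point (Im (fst x)) (W t x))" for t x
  have W0: "W t x = snd x" if "x \<in> S3" "Re (fst x) = 0" for t x
  proof -
    have "(cmod (snd x))\<^sup>2 = 1 - (Im (fst x))\<^sup>2"
      using that S3_eq[of "fst x" "snd x"] by (simp add: cmod_power2)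
    then have "cmod (snd x) = sqrt (1 - (Im (fst x))\<^sup>2)"
      by (metis norm_ge_zero real_sqrt_unique)
    then show ?thesis using zero by (simp add: W_def)
  qed
  have "ambient_isotopic (S \<union> (\<lambda>y. hemisphere_point y (w0 y)) ` {-h..h})
    (H 1 ` (S \<union> (\<lambda>y. hemisphere_point y (w0 y)) ` {-h..h}))"
  proof (rule ambient_isotopicI)
    have ccl: "continuous_on T (\<lambda>x. w0 (cl (f x)))" "continuous_on T (\<lambda>x. w1 (cl (f x)))"
      if "continuous_on T f" for T and f :: "real \<times> complex \<times> complex \<Rightarrow> real"
      by (rule continuous_on_compose2[OF cont(1)] continuous_on_compose2[OF cont(2)],
        use that cl in \<open>auto simp: cl_def intro!: continuous_intros\<close>)+
    have "continuous_on ({0..1} \<times> S3) (\<lambda>x. if Re (fst (snd x)) \<le> 0 then snd x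
        else hemisphere_point (Im (fst (snd x))) (W (fst x) (snd x)))"
    proof (rule continuous_on_cases_le)
      have "continuous_on {x \<in> {0..1} \<times> S3. 0 \<le> Re (fst (snd x))} (\<lambda>x. W (fst x) (snd x))"
        unfolding W_def U_def using R(1) by (intro continuous_intros ccl) auto
      then show "continuous_on {x \<in> {0..1} \<times> S3. 0 \<le> Re (fst (snd x))}
          (\<lambda>x. hemisphere_point (Im (fst (snd x))) (W (fst x) (snd x)))"
        by (intro continuous_intros)
      show "snd x = hemisphere_point (Im (fst (snd x))) (W (fst x) (snd x))"
        if "x \<in> {0..1} \<times> S3" "Re (fst (snd x)) = 0" for x
      proof -
        have x: "snd x \<in> S3" using that(1) by auto
        show ?thesis
          using W0[OF x that(2)] S3_hemisphere_point[OF x] that(2) by simp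
      qed
    qed (intro continuous_intros)+
    then show "continuous_on ({0..1} \<times> S3) (\<lambda>(t, x). H t x)"
      by (simp add: H_def case_prod_beta)
  next
    fix t x assume "t \<in> {0..1::real}" "x \<in> S3"
    then show "H t x \<in> S3"
      unfolding H_def using W_le hemisphere_point_in_S3 by auto
  next
    fix t :: real assume t: "t \<in> {0..1}"
    have hp: "fst (hemisphere_point y w) = complex_of_real (sqrt (1 - y\<^sup>2 - (cmod w)\<^sup>2)) + \<i> * complex_of_real y"
      "snd (hemisphere_point y w) = w" for y w by (simp_all add: hemisphere_point_def)
    show "inj_on (H t) S3"
    proof (rule inj_onI)
      fix x x' assume x: "x \<in> S3" "x' \<in> S3" and eq: "H t x = H t x'"
      have Re: "Re (fst (H t x)) \<ge> 0 \<and> W t x = snd (H t x) \<and> Im (fst x) = Im (fst (H t x))"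
        if "0 \<le> Re (fst x)" "x \<in> S3" for x
        using W_le[OF t that(2)] W0[OF that(2)] that
        by (cases "Re (fst x) = 0") (auto simp: H_def hp)
      show "x = x'"
      proof (cases "Re (fst x) < 0 \<or> Re (fst x') < 0")
        case True
        have "Re (fst (H t x)) < 0" "Re (fst x) < 0"
          if "Re (fst x) < 0 \<or> Re (fst x') < 0" "H t x = H t x'" "x \<in> S3" "x' \<in> S3" for x x'
        proof -
          show "Re (fst (H t x)) < 0"
          proof (cases "Re (fst x) < 0")
            case False
            then have "Re (fst x') < 0" using that(1) by simp
            then have "H t x' = x'" by (simp add: H_def)
            then show ?thesis using that(2) \<open>Re (fst x') < 0\<close> by simp
          qed (simp add: H_def)
          then show "Re (fst x) < 0"
            using Re[OF _ that(3)] by linarith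
        qed
        from this(2)[OF True eq x] this(2)[of x' x] True eq x
        have "Re (fst x) < 0" "Re (fst x') < 0" by auto
        then show ?thesis using eq by (simp add: H_def)
      next
        case False
        then have ge: "0 \<le> Re (fst x)" "0 \<le> Re (fst x')" by auto
        have "W t x = W t x'" and y: "Im (fst x) = Im (fst x')"
          using Re[OF ge(1) x(1)] Re[OF ge(2) x(2)] eq by metis+
        then have e: "snd x + complex_of_real t * U (Im (fst x)) (snd x) =
            snd x' + complex_of_real t * U (Im (fst x)) (snd x')"
          by (simp add: W_def)
        have "inj (\<lambda>w. w + complex_of_real t * U (Im (fst x)) w)"
          using t by (intro inj_perturbation[OF lip c]) auto
        then have "snd x = snd x'" using e by (rule injD)
        then show ?thesis
          using S3_hemisphere_point[OF x(1)] S3_hemisphere_point[OF x(2)] ge y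
          by metis
      qed
    qed
  next
    fix x assume "x \<in> S3"
    then show "H 0 x = x" using S3_hemisphere_point[of x] by (simp add: H_def W_def)
  qed simp
  moreover have "H 1 x = x" if "x \<in> S" for x
  proof (cases "Re (fst x) \<le> 0")
    case False
    then have "W 1 x = snd x" using S(2)[OF that] far by (simp add: W_def)
    then show ?thesis using S3_hemisphere_point[of x] S(1) that False by (auto simp: H_def)
  qed (simp add: H_def)
  moreover have "H 1 (hemisphere_point y (w0 y)) = hemisphere_point y (w1 y)" if y: "y \<in> {-h..h}" for y
  proof -
    \<comment> \<open>The arc lies in \<open>Re z > 0\<close>, where \<open>H\<close> is given by
      its second branch.\<close>
    have "y\<^sup>2 \<le> h\<^sup>2" using y h power2_le_iff_abs_le[of h y] by auto
    moreover have "(cmod (w0 y))\<^sup>2 < (sqrt (1 - h\<^sup>2))\<^sup>2"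
      using inside[OF y] R(1) by (intro power_strict_mono) auto
    moreover have "(sqrt (1 - h\<^sup>2))\<^sup>2 = 1 - h\<^sup>2"
      using h by (simp add: abs_square_le_1)
    ultimately have "0 < 1 - y\<^sup>2 - (cmod (w0 y))\<^sup>2" by linarith
    then show ?thesis
      by (simp add: H_def W_def hemisphere_point_def U_def clid[OF y])
  qed
  ultimately show ?thesis
    by (simp add: image_Un image_image cong: image_cong_simp)
qed

section \<open>Braid words as paths of configurations\<close>

definition letter_swap :: "nat \<times> bool \<Rightarrow> nat \<Rightarrow> nat" where
  "letter_swap l = Transposition.transpose (fst l) (fst l + 1)"

lemma letter_swap_swap [simp]: "letter_swap l (letter_swap l j) = j"
  by (simp add: letter_swap_def)

lemma inj_letter_swap: "inj (letter_swap l)"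
  by (metis injI letter_swap_swap)

text \<open>\<open>letter_point\<close> rescaled so that position \<open>j\<close> becomes the point \<open>j\<close>, independently of the
  number of strands.\<close>

definition letter_path :: "nat \<times> bool \<Rightarrow> real \<Rightarrow> nat \<Rightarrow> complex" where
  "letter_path l s j =
     (let c = of_nat (fst l) + 1 / 2; turn = cis (if snd l then - pi * s else pi * s)
      in if j = fst l \<or> j = fst l + 1 then c + turn * (of_nat j - c) else of_nat j)"

text \<open>Strands are labelled by their starting positions, hence the relabelling of the tail. The
  first letter takes the times up to 1/2, the second those up to 3/4, and so on, with rest at the
  end: convenient for homotopies of joined paths, but different from the equal arcs of the
  closure.\<close>

primrec word_path :: "braid_word \<Rightarrow> real \<Rightarrow> nat \<Rightarrow> complex" where
  "word_path [] = (\<lambda>\<theta> j. of_nat j)"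
| "word_path (l # w) = letter_path l +++ (\<lambda>\<theta> j. word_path w \<theta> (letter_swap l j))"

primrec word_pos :: "braid_word \<Rightarrow> nat \<Rightarrow> nat" where
  "word_pos [] = id"
| "word_pos (l # w) = word_pos w \<circ> letter_swap l"

definition braid_word_on :: "nat \<Rightarrow> braid_word \<Rightarrow> bool" where
  "braid_word_on m w \<longleftrightarrow> (\<forall>(i, e)\<in>set w. 1 \<le> i \<and> i < m)"

lemma braid_word_on_simps [simp]:
  "braid_word_on m []"
  "braid_word_on m (l # w) \<longleftrightarrow> 1 \<le> fst l \<and> fst l < m \<and> braid_word_on m w"
  "braid_word_on m (u @ w) \<longleftrightarrow> braid_word_on m u \<and> braid_word_on m w"
  by (auto simp: braid_word_on_def case_prod_beta)

lemma letter_path_cases: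
  "letter_path l s j = (if j = fst l then of_nat j + (1 - cis (if snd l then - pi * s else pi * s)) / 2
     else if j = fst l + 1 then of_nat j - (1 - cis (if snd l then - pi * s else pi * s)) / 2 else of_nat j)"
  unfolding letter_path_def Let_def by (auto simp: field_simps)

lemma Re_letter_path: "Re (letter_path l s j) =
    (if j = fst l then real j + (1 - cos (pi * s)) / 2
     else if j = fst l + 1 then real j - (1 - cos (pi * s)) / 2 else real j)"
  by (simp add: letter_path_cases)

lemma Im_letter_path: "Im (letter_path l s j) =
    (if j = fst l then (if snd l then 1 else - 1) * sin (pi * s) / 2
     else if j = fst l + 1 then (if snd l then - 1 else 1) * sin (pi * s) / 2 else 0)"
  by (simp add: letter_path_cases)

lemma letter_path_0 [simp]: "letter_path l 0 j = of_nat j"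
  by (simp add: letter_path_cases)

lemma letter_path_1 [simp]: "letter_path l 1 j = of_nat (letter_swap l j)"
  by (auto simp: complex_eq_iff Re_letter_path Im_letter_path letter_swap_def Transposition.transpose_def)

lemma continuous_on_letter_path: "continuous_on S (\<lambda>s. letter_path l s j)"
  by (cases "snd l"; cases "j = fst l"; cases "j = fst l + 1")
    (auto simp: letter_path_cases intro!: continuous_intros)

lemma word_path_0 [simp]: "word_path w 0 j = of_nat j"
  by (cases w) (simp_all add: joinpaths_def)

lemma word_path_1 [simp]: "word_path w 1 j = of_nat (word_pos w j)"
  by (induction w arbitrary: j) (simp_all add: joinpaths_def)

lemma path_coordinatewise:
  fixes p :: "real \<Rightarrow> nat \<Rightarrow> complex"
  shows "path p \<longleftrightarrow> (\<forall>j. continuous_on {0..1} (\<lambda>\<theta>. p \<theta> j))"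
proof
  assume "path p"
  then show "\<forall>j. continuous_on {0..1} (\<lambda>\<theta>. p \<theta> j)"
    using continuous_on_product_then_coordinatewise[of "{0..1}" p] by (simp add: path_def)
next
  assume *: "\<forall>j. continuous_on {0..1} (\<lambda>\<theta>. p \<theta> j)"
  show "path p"
    unfolding path_def by (rule continuous_on_coordinatewise_then_product) (rule *[rule_format])
qed

lemma path_relabel:
  fixes p :: "real \<Rightarrow> nat \<Rightarrow> complex" and \<pi> :: "nat \<Rightarrow> nat"
  assumes "path p"
  shows "path (\<lambda>\<theta> j. p \<theta> (\<pi> j))"
  using assms by (simp add: path_coordinatewise)

lemma path_letter_path: "path (letter_path l)"
  by (simp add: path_coordinatewise continuous_on_letter_path)

lemma path_word_path: "path (word_path w)"
proof (induction w)
  case (Cons l w)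
  have "pathfinish (letter_path l) = pathstart (\<lambda>\<theta> j. word_path w \<theta> (letter_swap l j))"
    by (auto simp: pathfinish_def pathstart_def)
  then show ?case
    using Cons path_letter_path path_relabel by simp
qed (simp add: path_coordinatewise)

lemma continuous_on_word_path: "continuous_on {0..1} (\<lambda>\<theta>. word_path w \<theta> j)"
  using path_word_path path_coordinatewise by blast

lemma pathstart_word_path [simp]: "pathstart (word_path w) = of_nat"
  by (auto simp: pathstart_def)

lemma pathfinish_word_path [simp]: "pathfinish (word_path w) = (\<lambda>j. of_nat (word_pos w j))"
  by (auto simp: pathfinish_def)

lemma inj_word_pos: "inj (word_pos w)"
  by (induction w) (auto intro: inj_compose[unfolded o_def] simp: inj_letter_swap inj_compose)

lemma word_pos_append: "word_pos (u @ v) = word_pos v \<circ> word_pos u"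
  by (induction u) (auto simp: fun_eq_iff)

lemma bij_letter_swap:
  assumes "1 \<le> fst l" "fst l < m"
  shows "bij_betw (letter_swap l) {1..m} {1..m}"
  using assms by (intro bij_betw_byWitness[where f' = "letter_swap l"])
    (auto simp: letter_swap_def Transposition.transpose_def)

lemma bij_word_pos:
  assumes "braid_word_on m w"
  shows "bij_betw (word_pos w) {1..m} {1..m}"
  using assms
proof (induction w)
  case (Cons l w)
  then show ?case
    using bij_betw_trans[OF bij_letter_swap[of l m] Cons.IH] by (simp add: o_def)
qed simp

section \<open>Words whose strands can be put at constant heights\<close>

text \<open>\<open>h j\<close> is the height of the strand that is in position \<open>j\<close> at
  present, hence the relabelling after each letter. The condition says that at every crossing the
  higher strand is the upper one.\<close>

primrec layered :: "(nat \<Rightarrow> real) \<Rightarrow> braid_word \<Rightarrow> bool" where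
  "layered h [] \<longleftrightarrow> True"
| "layered h (l # w) \<longleftrightarrow>
     (if snd l then h (fst l + 1) < h (fst l) else h (fst l) < h (fst l + 1)) \<and>
     layered (h \<circ> letter_swap l) w"

text \<open>Two real parts coincide only halfway through the letter and only for the two strands
  that cross. At that moment the half turn has put one of them in front of the other, and the sign
  of the letter tells which.\<close>

lemma letter_path_over:
  assumes h: "if snd l then h (fst l + 1) < h (fst l) else h (fst l) < (h (fst l + 1) :: real)"
    and s: "s \<in> {0..1}" and ij: "h j < h i" and Re: "Re (letter_path l s i) = Re (letter_path l s j)"
  shows "Im (letter_path l s j) < Im (letter_path l s i)"
proof -
  have ne: "i \<noteq> j" using ij by auto
  define d where "d = (1 - cos (pi * s)) / 2"
  have d: "0 \<le> d" "d \<le> 1" unfolding d_def by simp_all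
  have lt: "i = fst l \<and> j = fst l + 1 \<and> 2 * d = 1"
    if "i < j" "Re (letter_path l s i) = Re (letter_path l s j)" for i j
  proof -
    have "real i + 1 \<le> real j" using that(1) by linarith
    then have "(i = fst l \<or> i = fst l + 1) \<or> (j = fst l \<or> j = fst l + 1)"
      using that(2) by (auto simp: Re_letter_path split: if_splits)
    then have "(i = fst l \<and> j = fst l + 1) \<or> (i = fst l \<and> fst l + 2 \<le> j) \<or>
        (i = fst l + 1 \<and> fst l + 2 \<le> j) \<or> (j = fst l \<and> i < fst l) \<or> (j = fst l + 1 \<and> i < fst l)"
      using that(1) by linarith
    then consider "i = fst l" "j = fst l + 1" | "i = fst l" "fst l + 2 \<le> j" | "i = fst l + 1" "fst l + 2 \<le> j"
      | "j = fst l" "i < fst l" | "j = fst l + 1" "i < fst l"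
      by blast
    then show ?thesis
      using that(2) d \<open>real i + 1 \<le> real j\<close> unfolding Re_letter_path d_def[symmetric]
      by cases auto
  qed
  have ij': "{i, j} = {fst l, fst l + 1} \<and> cos (pi * s) = 0"
  proof (cases "i < j")
    case True
    then show ?thesis using lt[OF True Re] by (auto simp: d_def)
  next
    case False
    then have "j < i" using ne by simp
    then show ?thesis using lt[OF _ Re[symmetric]] by (auto simp: d_def)
  qed
  then have "sin (pi * s) \<noteq> 0"
    using sin_cos_squared_add[of "pi * s"] by auto
  moreover have "0 \<le> sin (pi * s)"
    using s by (intro sin_ge_zero) (auto simp: mult_left_le)
  ultimately have "0 < sin (pi * s)" by simp
  then show ?thesis
    using ij' h ij ne by (auto simp: Im_letter_path doubleton_eq_iff split: if_splits)
qed

lemma layered_over: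
  assumes "layered h w" "\<theta> \<in> {0..1}" "h j < h i" "Re (word_path w \<theta> i) = Re (word_path w \<theta> j)"
  shows "Im (word_path w \<theta> j) < Im (word_path w \<theta> i)"
  using assms
proof (induction w arbitrary: h \<theta> i j)
  case (Cons l w)
  show ?case
  proof (cases "\<theta> \<le> 1/2")
    case True
    then show ?thesis
      using letter_path_over[of l h "2 * \<theta>" j i] Cons.prems by (auto simp: joinpaths_def split: if_splits)
  next
    case False
    then show ?thesis
      using Cons.IH[of "h \<circ> letter_swap l" "2 * \<theta> - 1" "letter_swap l j" "letter_swap l i"] Cons.prems
      by (auto simp: joinpaths_def o_def split: if_splits)
  qed
qed auto

text \<open>Configurations of infinitely many points: the strands beyond the last letter stand
  still, so one notion of homotopy serves every number of strands and a word can be regarded on more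
  strands without change.\<close>

definition Conf :: "(nat \<Rightarrow> complex) set" where
  "Conf = {Z. inj Z}"

lemma letter_path_Conf: "s \<in> {0..1} \<Longrightarrow> letter_path l s \<in> Conf"
proof -
  assume s: "s \<in> {0..1}"
  \<comment> \<open>Any height function that is compatible with the sign of the letter and injective
    lets \<open>letter_path_over\<close> separate all pairs.\<close>
  define h where "h = (\<lambda>j. (if snd l then - real j else real j))"
  have l: "if snd l then h (fst l + 1) < h (fst l) else h (fst l) < h (fst l + 1)"
    by (simp add: h_def)
  have "letter_path l s i \<noteq> letter_path l s j" if "i < j" for i j
    using letter_path_over[OF l s, of i j] letter_path_over[OF l s, of j i] that
    by (cases "snd l") (auto simp: h_def)
  then show ?thesis unfolding Conf_def
    by (auto intro!: linorder_injI)
qed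

lemma Conf_relabel: "Z \<in> Conf \<Longrightarrow> inj \<pi> \<Longrightarrow> (\<lambda>j. Z (\<pi> j)) \<in> Conf"
  unfolding Conf_def using inj_compose[of Z \<pi>] by (simp add: o_def)

lemma word_path_Conf: "\<theta> \<in> {0..1} \<Longrightarrow> word_path w \<theta> \<in> Conf"
proof (induction w arbitrary: \<theta>)
  case Nil
  then show ?case by (simp add: Conf_def inj_of_nat)
next
  case (Cons l w)
  show ?case
  proof (cases "\<theta> \<le> 1/2")
    case True
    then show ?thesis using letter_path_Conf[of "2 * \<theta>" l] Cons.prems by (simp add: joinpaths_def)
  next
    case False
    then show ?thesis
      using Conf_relabel[OF Cons.IH[of "2 * \<theta> - 1"] inj_letter_swap[of l]] Cons.prems
      by (simp add: joinpaths_def)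
  qed
qed

lemma path_image_word_path: "path_image (word_path w) \<subseteq> Conf"
  unfolding path_image_def using word_path_Conf by auto

lemma homotopic_paths_linear_Conf:
  assumes "path p" "path q" "p 0 = q 0" "p 1 = q 1"
    and inj: "\<And>t \<theta>. t \<in> {0..1} \<Longrightarrow> \<theta> \<in> {0..1} \<Longrightarrow>
      inj (\<lambda>j. complex_of_real (1 - t) * p \<theta> j + complex_of_real t * q \<theta> j)"
  shows "homotopic_paths Conf p q"
  unfolding homotopic_paths
proof (intro exI[of _ "\<lambda>x j. complex_of_real (1 - fst x) * p (snd x) j + complex_of_real (fst x) * q (snd x) j"] conjI ballI)
  have "continuous_on ({0..1::real} \<times> {0..1}) (\<lambda>x. p (snd x) j)" 
    "continuous_on ({0..1::real} \<times> {0..1}) (\<lambda>x. q (snd x) j)" for j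
    using assms(1,2) unfolding path_coordinatewise
    by (auto intro!: continuous_on_compose2[of "{0..1}" _ _ snd] continuous_on_snd continuous_on_id)
  then show "continuous_on ({0..1} \<times> {0..1})
     (\<lambda>x j. complex_of_real (1 - fst x) * p (snd x) j + complex_of_real (fst x) * q (snd x) j)"
    by (intro continuous_on_coordinatewise_then_product continuous_intros)
  show "(\<lambda>x j. complex_of_real (1 - fst x) * p (snd x) j + complex_of_real (fst x) * q (snd x) j)
    \<in> {0..1} \<times> {0..1} \<rightarrow> Conf"
    using inj by (auto simp: Conf_def)
qed (use assms in \<open>auto simp: pathstart_def pathfinish_def fun_eq_iff algebra_simps\<close>)

text \<open>Two layered words with the same height function and permutation are homotopic: first move the
  strands to constant heights (times \<open>\<theta> (1 - \<theta>)\<close>, to keep the ends fixed), after which the real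
  parts can be interpolated freely.\<close>

lemma layered_homotopic:
  assumes h: "inj h" and lay: "layered h u" "layered h v" and pos: "word_pos u = word_pos v"
  shows "homotopic_paths Conf (word_path u) (word_path v)"
proof -
  define flat where "flat w = (\<lambda>\<theta> j. complex_of_real (Re (word_path w \<theta> j)) + \<i> * complex_of_real (\<theta> * (1 - \<theta>) * h j))" for w
  have pflat: "path (flat w)" for w
    unfolding path_coordinatewise flat_def
    by (intro allI continuous_intros continuous_on_word_path)
  have RIflat: "Re (flat w \<theta> j) = Re (word_path w \<theta> j)" "Im (flat w \<theta> j) = \<theta> * (1 - \<theta>) * h j" for w \<theta> j
    by (simp_all add: flat_def)
  have raise: "homotopic_paths Conf (word_path w) (flat w)" if w: "layered h w" for w
  proof (rule homotopic_paths_linear_Conf)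
    fix t \<theta> :: real assume t: "t \<in> {0..1}" and \<theta>: "\<theta> \<in> {0..1}"
    show "inj (\<lambda>j. complex_of_real (1 - t) * word_path w \<theta> j + complex_of_real t * flat w \<theta> j)"
    proof (rule injI, rule ccontr)
      fix i j assume eq: "complex_of_real (1 - t) * word_path w \<theta> i + complex_of_real t * flat w \<theta> i =
        complex_of_real (1 - t) * word_path w \<theta> j + complex_of_real t * flat w \<theta> j" and "i \<noteq> j"
      have main: False
        if eq: "complex_of_real (1 - t) * word_path w \<theta> i + complex_of_real t * flat w \<theta> i =
        complex_of_real (1 - t) * word_path w \<theta> j + complex_of_real t * flat w \<theta> j" and ij: "h j < h i" for i j
      proof -
        have "(1 - t) * Re (word_path w \<theta> i) + t * Re (word_path w \<theta> i) =
          (1 - t) * Re (word_path w \<theta> j) + t * Re (word_path w \<theta> j)"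
          using arg_cong[OF eq, of Re] by (simp add: RIflat)
        then have R: "Re (word_path w \<theta> i) = Re (word_path w \<theta> j)" by (simp add: algebra_simps)
        have I: "Im (word_path w \<theta> j) < Im (word_path w \<theta> i)"
          by (rule layered_over[OF w \<theta> ij R])
        have e: "(1 - t) * (Im (word_path w \<theta> i) - Im (word_path w \<theta> j)) + t * (\<theta> * (1 - \<theta>) * (h i - h j)) = 0"
          using arg_cong[OF eq, of Im] by (simp add: RIflat algebra_simps)
        \<comment> \<open>Both summands in \<open>e\<close> are nonnegative and hence zero. The
          first forces \<open>t = 1\<close>, whereupon the second forces \<theta> to be an end of
          the interval, where the real parts are distinct integer positions.\<close>
        have th: "0 \<le> \<theta> * (1 - \<theta>) * (h i - h j)" using \<theta> ij by simp
        have "0 \<le> (1 - t) * (Im (word_path w \<theta> i) - Im (word_path w \<theta> j))" using I t by simp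
        moreover have "0 \<le> t * (\<theta> * (1 - \<theta>) * (h i - h j))" using th t by simp
        ultimately have "(1 - t) * (Im (word_path w \<theta> i) - Im (word_path w \<theta> j)) = 0"
          "t * (\<theta> * (1 - \<theta>) * (h i - h j)) = 0" using e by linarith+
        then have "t = 1" "\<theta> = 0 \<or> \<theta> = 1" using I ij by auto
        then have "of_nat i = (of_nat j :: complex) \<or> of_nat (word_pos w i) = (of_nat (word_pos w j) :: complex)"
          using R by (auto simp: complex_eq_iff)
        then show False using ij inj_word_pos[of w] by (auto dest: injD)
      qed
      have "h i < h j \<or> h j < h i" using h \<open>i \<noteq> j\<close> by (metis injD linorder_less_linear)
      then show False using main[OF eq] main[OF eq[symmetric]] by blast
    qed
  qed (use path_word_path pflat in \<open>auto simp: flat_def fun_eq_iff complex_eq_iff\<close>)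
  have "homotopic_paths Conf (flat u) (flat v)"
  proof (rule homotopic_paths_linear_Conf)
    fix t \<theta> :: real assume t: "t \<in> {0..1}" and \<theta>: "\<theta> \<in> {0..1}"
    show "inj (\<lambda>j. complex_of_real (1 - t) * flat u \<theta> j + complex_of_real t * flat v \<theta> j)"
    proof (rule injI)
      fix i j assume eq: "complex_of_real (1 - t) * flat u \<theta> i + complex_of_real t * flat v \<theta> i =
        complex_of_real (1 - t) * flat u \<theta> j + complex_of_real t * flat v \<theta> j"
      have "\<theta> * (1 - \<theta>) * (h i - h j) = 0"
        using arg_cong[OF eq, of Im] by (simp add: RIflat algebra_simps)
      then consider "\<theta> = 0" | "\<theta> = 1" | "h i = h j" by auto
      then show "i = j"
      proof cases
        case 1
        then show ?thesis using arg_cong[OF eq, of Re] by (simp add: RIflat algebra_simps)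
      next
        case 2
        then have "word_pos v i = word_pos v j"
          using arg_cong[OF eq, of Re] pos by (simp add: RIflat algebra_simps)
        then show ?thesis using inj_word_pos by (metis injD)
      next
        case 3
        then show ?thesis using h by (metis injD)
      qed
    qed
  qed (use pflat pos in \<open>auto simp: flat_def fun_eq_iff complex_eq_iff\<close>)
  then show ?thesis
    using raise[OF lay(1)] raise[OF lay(2)] homotopic_paths_sym homotopic_paths_trans by blast
qed

text \<open>Homotopy with fixed ends instead of the congruence generated by the Artin relations:
  homotopies can be applied to closures, and only those relations that are used have to be
  proved.\<close>

definition braid_eq :: "braid_word \<Rightarrow> braid_word \<Rightarrow> bool" where
  "braid_eq u v \<longleftrightarrow> homotopic_paths Conf (word_path u) (word_path v)"

lemma braid_eq_refl [simp]: "braid_eq w w"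
  by (simp add: braid_eq_def path_word_path path_image_word_path)

lemma braid_eq_sym: "braid_eq u v \<Longrightarrow> braid_eq v u"
  by (simp add: braid_eq_def homotopic_paths_sym)

lemma braid_eq_trans [trans]: "braid_eq u v \<Longrightarrow> braid_eq v w \<Longrightarrow> braid_eq u w"
  unfolding braid_eq_def by (rule homotopic_paths_trans)

lemma braid_eq_layered: "inj h \<Longrightarrow> layered h u \<Longrightarrow> layered h v \<Longrightarrow> word_pos u = word_pos v \<Longrightarrow> braid_eq u v"
  unfolding braid_eq_def by (rule layered_homotopic)

lemma braid_eq_word_pos: "braid_eq u v \<Longrightarrow> word_pos u = word_pos v"
  unfolding braid_eq_def using homotopic_paths_imp_pathfinish by (fastforce simp: fun_eq_iff)

lemma homotopic_paths_relabel:
  assumes "homotopic_paths Conf p q" "inj \<pi>"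
  shows "homotopic_paths Conf (\<lambda>\<theta> j. p \<theta> (\<pi> j)) (\<lambda>\<theta> j. q \<theta> (\<pi> j))"
proof -
  have c: "continuous_on Conf (\<lambda>(Z :: nat \<Rightarrow> complex) j. Z (\<pi> j))"
  proof (rule continuous_on_coordinatewise_then_product)
    show "continuous_on Conf (\<lambda>Z. Z (\<pi> j))" for j
      by (rule continuous_on_subset[OF continuous_on_product_coordinates]) simp
  qed
  have "(\<lambda>Z j. Z (\<pi> j)) \<in> Conf \<rightarrow> Conf" using Conf_relabel assms(2) by auto
  from homotopic_paths_continuous_image[OF assms(1) c this]
  show ?thesis by (simp add: o_def)
qed

lemma word_path_relabel_image: "inj \<pi> \<Longrightarrow> path_image (\<lambda>\<theta> j. word_path w \<theta> (\<pi> j)) \<subseteq> Conf"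
  unfolding path_image_def using Conf_relabel[OF word_path_Conf] by auto

text \<open>Associativity of joining paths, up to homotopy. The strands of \<open>v\<close> start
  where those of \<open>u\<close> end, hence the relabelling by \<open>word_pos u\<close>.\<close>

lemma word_path_append:
  "homotopic_paths Conf (word_path (u @ v)) (word_path u +++ (\<lambda>\<theta> j. word_path v \<theta> (word_pos u j)))"
proof (induction u)
  case Nil
  have "continuous_on {0..1} (\<lambda>t::real. if t \<le> 1/2 then 0 else 2 * t - 1)"
    by (rule continuous_on_cases_le[of _ "\<lambda>t. t" "1/2"]) (auto intro!: continuous_intros)
  then show ?case
  proof (rule homotopic_paths_reparametrize[OF path_word_path path_image_word_path])
    show "(word_path [] +++ (\<lambda>\<theta> j. word_path v \<theta> (word_pos [] j))) t = word_path ([] @ v) (if t \<le> 1/2 then 0 else 2 * t - 1)"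
      for t by (simp add: joinpaths_def fun_eq_iff)
  qed auto
next
  case (Cons l u)
  let ?L = "letter_path l" and ?s = "letter_swap l"
  have L: "path ?L" "path_image ?L \<subseteq> Conf"
    using path_letter_path letter_path_Conf[of _ l] unfolding path_image_def by blast+
  have fin: "pathfinish ?L = (\<lambda>j. of_nat (?s j))" by (simp add: pathfinish_def fun_eq_iff)
  have "homotopic_paths Conf (?L +++ (\<lambda>\<theta> j. word_path (u @ v) \<theta> (?s j)))
     (?L +++ (\<lambda>\<theta> j. (word_path u +++ (\<lambda>\<theta> j. word_path v \<theta> (word_pos u j))) \<theta> (?s j)))"
    by (rule homotopic_paths_join[OF _ homotopic_paths_relabel[OF Cons.IH inj_letter_swap[of l]]])
      (simp_all add: L fin pathstart_def)
  then have "homotopic_paths Conf (word_path ((l # u) @ v))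
     (?L +++ (\<lambda>\<theta> j. (word_path u +++ (\<lambda>\<theta> j. word_path v \<theta> (word_pos u j))) \<theta> (?s j)))"
    by simp
  also have "(\<lambda>\<theta> j. (word_path u +++ (\<lambda>\<theta> j. word_path v \<theta> (word_pos u j))) \<theta> (?s j)) =
     (\<lambda>\<theta> j. word_path u \<theta> (?s j)) +++ (\<lambda>\<theta> j. word_path v \<theta> (word_pos u (?s j)))"
    by (auto simp: joinpaths_def fun_eq_iff)
  also have "homotopic_paths Conf (?L +++ \<dots>)
    ((?L +++ (\<lambda>\<theta> j. word_path u \<theta> (?s j))) +++ (\<lambda>\<theta> j. word_path v \<theta> (word_pos u (?s j))))"
  proof (rule homotopic_paths_assoc)
    have "inj (\<lambda>j. word_pos u (?s j))"
      using inj_compose[OF inj_word_pos[of u] inj_letter_swap[of l]] by (simp add: o_def)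
    then show "path_image (\<lambda>\<theta> j. word_path v \<theta> (word_pos u (?s j))) \<subseteq> Conf"
      by (rule word_path_relabel_image)
    show "path (\<lambda>\<theta> j. word_path v \<theta> (word_pos u (?s j)))"
      by (rule path_relabel[OF path_word_path])
    show "pathfinish ?L = pathstart (\<lambda>\<theta> j. word_path u \<theta> (?s j))"
      by (simp add: fin pathstart_def)
  qed (simp_all add: L path_relabel path_word_path word_path_relabel_image inj_letter_swap
      pathstart_def pathfinish_def)
  finally show ?case by (simp add: o_def)
qed

lemma braid_eq_append:
  assumes "braid_eq u u'" "braid_eq v v'"
  shows "braid_eq (u @ v) (u' @ v')"
proof -
  have "homotopic_paths Conf (word_path u +++ (\<lambda>\<theta> j. word_path v \<theta> (word_pos u j)))
     (word_path u' +++ (\<lambda>\<theta> j. word_path v' \<theta> (word_pos u' j)))"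
  proof -
    have "homotopic_paths Conf (\<lambda>\<theta> j. word_path v \<theta> (word_pos u j)) (\<lambda>\<theta> j. word_path v' \<theta> (word_pos u' j))"
      using homotopic_paths_relabel[OF assms(2)[unfolded braid_eq_def] inj_word_pos[of u]]
      by (simp add: braid_eq_word_pos[OF assms(1)])
    then show ?thesis
      by (rule homotopic_paths_join[OF assms(1)[unfolded braid_eq_def]]) (simp add: pathstart_def)
  qed
  then show ?thesis
    unfolding braid_eq_def
    using word_path_append homotopic_paths_sym homotopic_paths_trans by metis
qed

section \<open>Closures of braid words\<close>

text \<open>The linear interpolation of the two affine maps has a positive scaling factor
  throughout, so points stay distinct; convexity keeps them in the disc.\<close>

lemma affine_config_isotopy:
  fixes p :: "real \<Rightarrow> nat \<Rightarrow> complex" and a a' :: real and b b' :: complex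
  assumes p: "path p" "\<And>\<theta>. \<theta> \<in> {0..1} \<Longrightarrow> inj_on (p \<theta>) {1..m}"
    and perm: "bij_betw \<sigma> {1..m} {1..m}" "\<And>j. j \<in> {1..m} \<Longrightarrow> p 1 j = p 0 (\<sigma> j)"
    and a: "0 < a" "0 < a'"
    and disc: "\<And>\<theta> j. \<theta> \<in> {0..1} \<Longrightarrow> j \<in> {1..m} \<Longrightarrow> cmod (complex_of_real a * p \<theta> j + b) < 1"
      "\<And>\<theta> j. \<theta> \<in> {0..1} \<Longrightarrow> j \<in> {1..m} \<Longrightarrow> cmod (complex_of_real a' * p \<theta> j + b') < 1"
  shows "ambient_isotopic (config_closure m (\<lambda>\<theta> j. complex_of_real a * p \<theta> j + b))
    (config_closure m (\<lambda>\<theta> j. complex_of_real a' * p \<theta> j + b'))"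
proof -
  define H where "H t \<theta> j = complex_of_real (1 - t) * (complex_of_real a * p \<theta> j + b)
    + complex_of_real t * (complex_of_real a' * p \<theta> j + b')" for t \<theta> j
  have H: "H t \<theta> j = complex_of_real ((1 - t) * a + t * a') * p \<theta> j + (complex_of_real (1 - t) * b + complex_of_real t * b')"
    for t \<theta> j by (simp add: H_def algebra_simps)
  have "ambient_isotopic (config_closure m (H 0)) (config_closure m (H 1))"
  proof (rule config_family_isotopy[OF _ _ _ perm(1)])
    fix j assume "j \<in> {1..m}"
    have "continuous_on ({0..1::real} \<times> {0..1}) (\<lambda>x. p (snd x) j)"
      using p(1) unfolding path_coordinatewise
      by (auto intro!: continuous_on_compose2[of "{0..1}" _ _ snd] continuous_on_snd continuous_on_id)
    then show "continuous_on ({0..1} \<times> {0..1}) (\<lambda>(t, \<theta>). H t \<theta> j)"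
      unfolding H_def case_prod_beta by (intro continuous_intros)
  next
    fix t \<theta> j assume *: "t \<in> {0..1::real}" "\<theta> \<in> {0..1::real}" "j \<in> {1..m}"
    have "(1 - t) *\<^sub>R (complex_of_real a * p \<theta> j + b) + t *\<^sub>R (complex_of_real a' * p \<theta> j + b') \<in> ball 0 1"
      by (rule convexD[OF convex_ball]) (use disc[OF *(2,3)] * in auto)
    then show "cmod (H t \<theta> j) < 1"
      by (simp add: H_def scaleR_conv_of_real)
  next
    fix t \<theta> assume *: "t \<in> {0..1::real}" "\<theta> \<in> {0..1::real}"
    have "(1 - t) * a + t * a' > 0"
    proof (cases "t = 0")
      case False
      then have "0 < t * a'" "0 \<le> (1 - t) * a" using * a by auto
      then show ?thesis by linarith
    qed (use a in auto)
    then have nz: "complex_of_real ((1 - t) * a + t * a') \<noteq> 0"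
      unfolding of_real_eq_0_iff by simp
    show "inj_on (H t \<theta>) {1..m}"
    proof (rule inj_onI)
      fix i j assume "i \<in> {1..m}" "j \<in> {1..m}" "H t \<theta> i = H t \<theta> j"
      then show "i = j"
        using nz inj_onD[OF p(2)[OF *(2)], of i j] unfolding H add_right_cancel mult_cancel_left by blast
    qed
  next
    fix t j assume "t \<in> {0..1::real}" "j \<in> {1..m}"
    then show "H t 1 j = H t 0 (\<sigma> j)" by (simp only: H_def perm(2))
  qed
  then show ?thesis by (simp add: H_def cong: config_closure_cong)
qed

text \<open>A homotopy in \<open>Conf\<close> lives in the whole plane and may leave the unit disc.
  By compactness some factor \<open>d\<close> shrinks all of it into the disc, so the closure is
  rescaled by \<open>d\<close>, moved along the shrunken homotopy, and rescaled again.\<close>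

lemma homotopic_config_isotopy:
  fixes a a' :: real and b b' :: complex
  assumes pq: "homotopic_paths Conf p q"
    and perm: "bij_betw \<sigma> {1..m} {1..m}" "\<And>j. j \<in> {1..m} \<Longrightarrow> p 1 j = p 0 (\<sigma> j)"
    and a: "0 < a" "0 < a'"
    and disc: "\<And>\<theta> j. \<theta> \<in> {0..1} \<Longrightarrow> j \<in> {1..m} \<Longrightarrow> cmod (complex_of_real a * p \<theta> j + b) < 1"
      "\<And>\<theta> j. \<theta> \<in> {0..1} \<Longrightarrow> j \<in> {1..m} \<Longrightarrow> cmod (complex_of_real a' * q \<theta> j + b') < 1"
  shows "ambient_isotopic (config_closure m (\<lambda>\<theta> j. complex_of_real a * p \<theta> j + b))
    (config_closure m (\<lambda>\<theta> j. complex_of_real a' * q \<theta> j + b'))"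
proof -
  obtain H where H: "continuous_on ({0..1} \<times> {0..1}) H" "H \<in> ({0..1} \<times> {0..1}) \<rightarrow> Conf"
    "\<And>x. x \<in> {0..1} \<Longrightarrow> H (0, x) = p x" "\<And>x. x \<in> {0..1} \<Longrightarrow> H (1, x) = q x"
    "\<And>t. t \<in> {0..1::real} \<Longrightarrow> H (t, 0) = p 0 \<and> H (t, 1) = p 1"
    using pq unfolding homotopic_paths by (auto simp: pathstart_def pathfinish_def)
  have contH: "continuous_on ({0..1} \<times> {0..1}) (\<lambda>x. H x j)" for j
    by (rule continuous_on_product_then_coordinatewise[OF H(1)])
  have inj: "inj (H (t, \<theta>))" if "t \<in> {0..1}" "\<theta> \<in> {0..1}" for t \<theta>
    using H(2) that by (auto simp: Conf_def Pi_iff)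
  have "\<exists>d>0. \<forall>j\<in>{1..m}. \<forall>x\<in>{0..1}\<times>{0..1}. d * cmod (H x j) < 1"
  proof (rule finite_common_bound)
    fix j assume "j \<in> {1..m}"
    have "compact ((\<lambda>x. H x j) ` ({0..1}\<times>{0..1}))"
      by (rule compact_continuous_image[OF contH]) (intro compact_Times compact_Icc)
    then obtain B where B: "0 < B" "\<And>x. x \<in> {0..1}\<times>{0..1} \<Longrightarrow> cmod (H x j) \<le> B"
      using compact_imp_bounded bounded_pos by (metis image_eqI)
    have "1 / (B + 1) * cmod (H x j) < 1" if "x \<in> {0..1}\<times>{0..1}" for x
      using B(2)[OF that] B(1) by (simp add: field_simps)
    then show "\<exists>d>0. \<forall>x\<in>{0..1}\<times>{0..1}. d * cmod (H x j) < 1"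
      using B(1) by (intro exI[of _ "1 / (B + 1)"]) auto
  next
    fix j and d e :: real assume d: "\<forall>x\<in>{0..1}\<times>{0..1}. d * cmod (H x j) < 1" and "e \<le> d"
    show "\<forall>x\<in>{0..1}\<times>{0..1}. e * cmod (H x j) < 1"
    proof
      fix x :: "real \<times> real" assume "x \<in> {0..1}\<times>{0..1}"
      then have "d * cmod (H x j) < 1" using d by blast
      then show "e * cmod (H x j) < 1"
        using mult_right_mono[OF \<open>e \<le> d\<close>, of "cmod (H x j)"] by simp
    qed
  qed simp
  then obtain d where d: "d > 0" "\<And>j x. j \<in> {1..m} \<Longrightarrow> x \<in> {0..1}\<times>{0..1} \<Longrightarrow> d * cmod (H x j) < 1"
    by blast
  have start: "ambient_isotopic (config_closure m (\<lambda>\<theta> j. complex_of_real a * p \<theta> j + b))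
    (config_closure m (\<lambda>\<theta> j. complex_of_real d * p \<theta> j + 0))"
  proof (rule affine_config_isotopy[where p = p, OF _ _ perm a(1) d(1) disc(1)])
    show "path p" using homotopic_paths_imp_path[OF pq] by blast
    show "inj_on (p \<theta>) {1..m}" if "\<theta> \<in> {0..1}" for \<theta>
      using inj[of 0 \<theta>] H(3)[OF that] that by (auto intro: inj_on_subset)
    show "cmod (complex_of_real d * p \<theta> j + 0) < 1" if "\<theta> \<in> {0..1}" "j \<in> {1..m}" for \<theta> j
      using d(2)[OF that(2), of "(0, \<theta>)"] H(3)[OF that(1)] d(1) that by (simp add: norm_mult)
  qed
  have perm_q: "q 1 j = q 0 (\<sigma> j)" if "j \<in> {1..m}" for j
    using perm(2)[OF that] H(4)[of 0] H(4)[of 1] H(5)[of 1] by simp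
  have stop: "ambient_isotopic (config_closure m (\<lambda>\<theta> j. complex_of_real d * q \<theta> j + 0))
    (config_closure m (\<lambda>\<theta> j. complex_of_real a' * q \<theta> j + b'))"
  proof (rule affine_config_isotopy[where p = q, OF _ _ perm(1) perm_q d(1) a(2) _ disc(2)])
    show "path q" using homotopic_paths_imp_path[OF pq] by blast
    show "inj_on (q \<theta>) {1..m}" if "\<theta> \<in> {0..1}" for \<theta>
      using inj[of 1 \<theta>] H(4)[OF that] that by (auto intro: inj_on_subset)
    show "cmod (complex_of_real d * q \<theta> j + 0) < 1" if "\<theta> \<in> {0..1}" "j \<in> {1..m}" for \<theta> j
      using d(2)[OF that(2), of "(1, \<theta>)"] H(4)[OF that(1)] d(1) that by (simp add: norm_mult)
  qed
  have "ambient_isotopic (config_closure m (\<lambda>\<theta> j. complex_of_real d * H (0, \<theta>) j))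
    (config_closure m (\<lambda>\<theta> j. complex_of_real d * H (1, \<theta>) j))"
  proof (rule config_family_isotopy[OF _ _ _ perm(1), where H = "\<lambda>t \<theta> j. complex_of_real d * H (t, \<theta>) j"])
    show "continuous_on ({0..1} \<times> {0..1}) (\<lambda>(t, \<theta>). complex_of_real d * H (t, \<theta>) j)" for j
      unfolding case_prod_beta by (intro continuous_intros) (simp add: contH)
    show "cmod (complex_of_real d * H (t, \<theta>) j) < 1"
      if "t \<in> {0..1}" "\<theta> \<in> {0..1}" "j \<in> {1..m}" for t \<theta> j
      using d(2)[OF that(3), of "(t, \<theta>)"] d(1) that by (simp add: norm_mult)
    show "inj_on (\<lambda>j. complex_of_real d * H (t, \<theta>) j) {1..m}" if "t \<in> {0..1}" "\<theta> \<in> {0..1}" for t \<theta>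
      using inj[OF that] d(1) by (auto simp: inj_on_def)
    show "complex_of_real d * H (t, 1) j = complex_of_real d * H (t, 0) (\<sigma> j)" if "t \<in> {0..1}" "j \<in> {1..m}" for t j
      using H(5)[OF that(1)] perm(2)[OF that(2)] by simp
  qed
  moreover have "config_closure m (\<lambda>\<theta> j. complex_of_real d * H (0, \<theta>) j) =
      config_closure m (\<lambda>\<theta> j. complex_of_real d * p \<theta> j + 0)"
    by (rule config_closure_cong) (simp only: H(3) add_0_right)
  moreover have "config_closure m (\<lambda>\<theta> j. complex_of_real d * H (1, \<theta>) j) =
      config_closure m (\<lambda>\<theta> j. complex_of_real d * q \<theta> j + 0)"
    by (rule config_closure_cong) (simp only: H(4) add_0_right)
  ultimately have "ambient_isotopic (config_closure m (\<lambda>\<theta> j. complex_of_real d * p \<theta> j + 0))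
    (config_closure m (\<lambda>\<theta> j. complex_of_real d * q \<theta> j + 0))"
    by simp
  then show ?thesis using start stop ambient_isotopic_trans by blast
qed

definition word_config :: "nat \<Rightarrow> braid_word \<Rightarrow> real \<Rightarrow> nat \<Rightarrow> complex" where
  "word_config m w \<theta> j = complex_of_real (2 / (real m + 1)) * word_path w \<theta> j + (- 1)"

lemma base_point_affine: "base_point m j = complex_of_real (2 / (real m + 1)) * of_nat j + (- 1)"
  by (simp add: base_point_def complex_eq_iff field_simps)

lemma letter_point_affine:
  "letter_point m l s j = complex_of_real (2 / (real m + 1)) * letter_path l s j + (- 1)"
proof -
  define \<alpha> where "\<alpha> = complex_of_real (2 / (real m + 1))"
  have b: "base_point m k = \<alpha> * of_nat k + (- 1)" for k
    unfolding \<alpha>_def by (rule base_point_affine)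
  show ?thesis
  proof -
    have c: "(\<alpha> * of_nat (fst l) + (- 1) + (\<alpha> * of_nat (fst l + 1) + (- 1))) / 2 = \<alpha> * (of_nat (fst l) + 1 / 2) + (- 1)"
      by (simp add: field_simps)
    show ?thesis
      unfolding letter_point_def letter_path_def Let_def b \<alpha>_def[symmetric] c
      by (auto simp: algebra_simps)
  qed
qed

lemma letter_path_disc:
  assumes l: "1 \<le> fst l" "fst l < m" and j: "j \<in> {1..m}"
  shows "cmod (complex_of_real (2 / (real m + 1)) * letter_path l s j + (- 1)) < 1"
proof -
  define \<alpha> where "\<alpha> = 2 / (real m + 1)"
  have \<alpha>: "0 < \<alpha>" "\<alpha> * (real m + 1) = 2" by (simp_all add: \<alpha>_def field_simps)
  show ?thesis
  proof (cases "j = fst l \<or> j = fst l + 1")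
    case False
    have "\<alpha> * real j \<le> \<alpha> * real m" "0 < \<alpha> * real j" using j \<alpha> by auto
    moreover have "\<alpha> * real m = 2 - \<alpha>" using \<alpha> by (simp add: algebra_simps)
    ultimately have "\<bar>\<alpha> * real j - 1\<bar> < 1" using \<alpha> by linarith
    moreover have "complex_of_real \<alpha> * letter_path l s j + (- 1) = complex_of_real (\<alpha> * real j - 1)"
      using False by (simp add: letter_path_cases)
    ultimately show ?thesis unfolding \<alpha>_def[symmetric] by (metis norm_of_real)
  next
    case True
    define c where "c = real (fst l) + 1 / 2"
    have eq: "complex_of_real \<alpha> * letter_path l s j + (- 1) = complex_of_real (\<alpha> * c - 1)
      + complex_of_real (\<alpha> * (real j - c)) * cis (if snd l then - pi * s else pi * s)"
      using True by (auto simp: letter_path_def Let_def c_def algebra_simps)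
    have "cmod (complex_of_real \<alpha> * letter_path l s j + (- 1)) \<le> \<bar>\<alpha> * c - 1\<bar> + \<bar>\<alpha> * (real j - c)\<bar>"
      unfolding eq by (rule order_trans[OF norm_triangle_ineq]) (simp only: norm_mult norm_of_real norm_cis mult_1_right order_refl)
    also have "\<bar>\<alpha> * (real j - c)\<bar> = \<alpha> * (1/2)" using True \<alpha> by (auto simp: c_def abs_mult)
    also have "\<bar>\<alpha> * c - 1\<bar> + \<alpha> * (1/2) < 1"
    proof -
      have "\<alpha> * (c + 1/2) \<le> \<alpha> * real m" using l \<alpha> by (intro mult_left_mono) (auto simp: c_def)
      moreover have "\<alpha> * 1 \<le> \<alpha> * (c - 1/2)" using l \<alpha> by (intro mult_left_mono) (auto simp: c_def)
      ultimately show ?thesis using \<alpha> by (auto simp: algebra_simps abs_if)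
    qed
    finally show ?thesis by (simp add: \<alpha>_def)
  qed
qed

lemma word_config_disc:
  assumes "braid_word_on m w" "\<theta> \<in> {0..1}" "j \<in> {1..m}"
  shows "cmod (word_config m w \<theta> j) < 1"
  using assms
proof (induction w arbitrary: \<theta> j)
  case Nil
  then have "word_config m [] \<theta> j = complex_of_real (2 / (real m + 1) * real j - 1)"
    by (simp add: word_config_def)
  moreover have "\<bar>2 / (real m + 1) * real j - 1\<bar> < 1"
    using Nil by (auto simp: field_simps abs_if)
  ultimately show ?case by (metis norm_of_real)
next
  case (Cons l w)
  have sw: "letter_swap l j \<in> {1..m}"
    using bij_betw_apply[OF bij_letter_swap[of l m]] Cons.prems by simp
  show ?case
  proof (cases "\<theta> \<le> 1/2")
    case True
    then show ?thesis
      using letter_path_disc[of l m j "2 * \<theta>"] Cons.prems by (simp add: word_config_def joinpaths_def)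
  next
    case False
    then show ?thesis
      using Cons.IH[OF _ _ sw, of "2 * \<theta> - 1"] Cons.prems by (simp add: word_config_def joinpaths_def)
  qed
qed

section \<open>Reparametrisation to the equal arcs of the closure\<close>

text \<open>One unit of time per letter and rest afterwards, so that the times between
  \<open>length w\<close> and \<open>length w + 1\<close> form the constant last arc of the
  closure.\<close>

primrec timed_path :: "braid_word \<Rightarrow> real \<Rightarrow> nat \<Rightarrow> complex" where
  "timed_path [] = (\<lambda>\<tau> j. of_nat j)"
| "timed_path (l # w) = (\<lambda>\<tau> j. if \<tau> \<le> 1 then letter_path l \<tau> j else timed_path w (\<tau> - 1) (letter_swap l j))"

lemma timed_path_0 [simp]: "timed_path w 0 j = of_nat j"
  by (cases w) simp_all

text \<open>The speed \<open>c\<close> is left free because splitting off the first letter leaves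
  \<open>c - 1\<close> units of time for the others.\<close>

lemma timed_path_homotopic:
  assumes "real (length w) + 1 \<le> c"
  shows "homotopic_paths Conf (word_path w) (\<lambda>\<theta>. timed_path w (c * \<theta>))"
  using assms
proof (induction w arbitrary: c)
  case Nil
  then show ?case using path_word_path[of "[]"] path_image_word_path[of "[]"] by simp
next
  case (Cons l w)
  let ?L = "letter_path l" and ?s = "letter_swap l"
  define q where "q = (\<lambda>\<theta> j. timed_path w ((c - 1) * \<theta>) (?s j))"
  have c: "1 < c" "2 \<le> c" using Cons.prems by auto
  have L: "path ?L" "path_image ?L \<subseteq> Conf"
    using path_letter_path letter_path_Conf[of _ l] unfolding path_image_def by blast+
  have fin: "pathfinish ?L = (\<lambda>j. of_nat (?s j))" by (simp add: pathfinish_def fun_eq_iff)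
  have "homotopic_paths Conf (word_path w) (\<lambda>\<theta>. timed_path w ((c - 1) * \<theta>))"
    using Cons by simp
  from homotopic_paths_relabel[OF this inj_letter_swap[of l]]
  have q: "homotopic_paths Conf (\<lambda>\<theta> j. word_path w \<theta> (?s j)) q"
    by (simp add: q_def)
  have 1: "homotopic_paths Conf (word_path (l # w)) (?L +++ q)"
    using homotopic_paths_join[of Conf ?L ?L, OF _ q] L fin by (simp add: pathstart_def)
  \<comment> \<open>\<open>f\<close> maps the first unit of time to the first half of the join, and
    the remaining \<open>c - 1\<close> units to the second half.\<close>
  define f where "f t = (if c * t \<le> 1 then c * t / 2 else 1/2 + (c * t - 1) / (2 * (c - 1)))" for t
  have "homotopic_paths Conf (?L +++ q) (\<lambda>\<theta>. timed_path (l # w) (c * \<theta>))"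
  proof (rule homotopic_paths_reparametrize[where f = f])
    show "path (?L +++ q)" "path_image (?L +++ q) \<subseteq> Conf"
      using homotopic_paths_imp_path[OF 1] homotopic_paths_imp_subset[OF 1] by blast+
    show "continuous_on {0..1} f"
      unfolding f_def using c
      by (intro continuous_on_cases_le continuous_intros) auto
    show "f \<in> {0..1} \<rightarrow> {0..1}"
    proof
      fix t :: real assume t: "t \<in> {0..1}"
      have "c * t \<le> c" using t c by (simp add: mult_left_le)
      moreover have "0 \<le> c * t" using t c by simp
      ultimately show "f t \<in> {0..1}" using c by (auto simp: f_def field_simps)
    qed
    show "f 0 = 0" by (simp add: f_def)
    show "f 1 = 1" using c by (simp add: f_def field_simps)
    show "timed_path (l # w) (c * t) = (?L +++ q) (f t)" if "t \<in> {0..1}" for t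
    proof (cases "c * t \<le> 1")
      case True
      then show ?thesis by (simp add: f_def joinpaths_def fun_eq_iff)
    next
      case False
      then have "0 < (c * t - 1) / (2 * (c - 1))" using c by simp
      moreover have ft: "f t = 1/2 + (c * t - 1) / (2 * (c - 1))" using False by (simp only: f_def if_False)
      ultimately have "\<not> f t \<le> 1 / 2" by linarith
      moreover have "(c - 1) * (2 * f t - 1) = c * t - 1" using c unfolding ft by (simp add: field_simps)
      ultimately show ?thesis using False by (simp add: joinpaths_def q_def fun_eq_iff)
    qed
  qed
  then show ?case using 1 homotopic_paths_trans by blast
qed

lemma timed_path_letter:
  assumes "k < length w" "0 \<le> s" "s \<le> 1"
  shows "timed_path w (real k + s) j = letter_path (w ! k) s (word_pos (take k w) j)"
  using assms
proof (induction w arbitrary: k j)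
  case (Cons l w)
  show ?case
  proof (cases k)
    case 0
    then show ?thesis using Cons.prems by simp
  next
    case (Suc k')
    show ?thesis
    proof (cases "real k + s \<le> 1")
      case True
      then have "k' = 0" "s = 0" using Suc Cons.prems by auto
      then show ?thesis using Suc by simp
    next
      case False
      then show ?thesis using Cons.IH[of k' "letter_swap l j"] Cons.prems Suc by simp
    qed
  qed
qed simp

lemma timed_path_end:
  assumes "real (length w) \<le> \<tau>"
  shows "timed_path w \<tau> j = of_nat (word_pos w j)"
  using assms
proof (induction w arbitrary: \<tau> j)
  case (Cons l w)
  show ?case
  proof (cases "\<tau> \<le> 1")
    case True
    then have "1 + real (length w) \<le> 1" using Cons.prems unfolding length_Cons of_nat_Suc by linarith
    then have w: "w = []" by (metis add_le_same_cancel1 length_0_conv of_nat_le_0_iff)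
    then have "\<tau> = 1" using Cons.prems True by simp
    then show ?thesis using w by simp
  next
    case False
    then show ?thesis using Cons by simp
  qed
qed simp

text \<open>In contrast to the floor, \<open>s = 1\<close> is allowed, so that the closing time
  \<open>n + 1\<close> still belongs to arc number \<open>n\<close>.\<close>

lemma integer_part_exists:
  fixes \<tau> :: real
  assumes "0 \<le> \<tau>" "\<tau> \<le> real n + 1"
  obtains k s where "k \<le> n" "0 \<le> s" "s \<le> 1" "\<tau> = real k + s"
  using assms
proof (induction n arbitrary: thesis)
  case 0
  then show ?case using 0(1)[of 0 \<tau>] by simp
next
  case (Suc n)
  show ?case
  proof (cases "\<tau> \<le> real n + 1")
    case True
    then show ?thesis using Suc.IH[of thesis] Suc.prems by (meson le_SucI)
  next
    case False
    then show ?thesis using Suc.prems(1)[of "Suc n" "\<tau> - real (Suc n)"] Suc.prems by simp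
  qed
qed

text \<open>The closure numbers the points of an arc by their positions at its beginning, the path
  by their starting positions. The translation \<open>word_pos (take k w)\<close> permutes the
  positions, so both describe the same set.\<close>

lemma braid_closure_timed:
  assumes w: "braid_word_on m w"
  shows "braid_closure m w = config_closure m
    (\<lambda>\<theta> j. complex_of_real (2 / (real m + 1)) * timed_path w ((real (length w) + 1) * \<theta>) j + (- 1))"
    (is "_ = config_closure m ?p")
proof -
  let ?n = "length w"
  define g where "g k s j = (if k < ?n then letter_point m (w ! k) s j else base_point m j)" for k s j
  have on_take: "braid_word_on m (take k w)" for k
    using w append_take_drop_id[of k w] braid_word_on_simps(3) by metis
  have pg: "?p ((real k + s) / (real ?n + 1)) j = g k s (word_pos (take k w) j)"
    if "k \<le> ?n" "0 \<le> s" "s \<le> 1" for k s j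
  proof (cases "k < ?n")
    case True
    then show ?thesis using timed_path_letter[OF True that(2,3)] by (simp add: g_def letter_point_affine)
  next
    case False
    then have "k = ?n" using that by simp
    then show ?thesis using timed_path_end[of w "real k + s"] that by (simp add: g_def base_point_affine)
  qed
  have range: "(real k + s) / (real ?n + 1) \<in> {0..1}" if "k \<le> ?n" "0 \<le> s" "s \<le> 1" for k s
    using that by (auto simp: field_simps)
  have ang: "2 * pi * (real k + s) / real (length w + 1) = 2 * pi * ((real k + s) / (real ?n + 1))" for k s
    by (simp add: add.commute)
  have B: "braid_closure m w = {solid_torus_point (g k s j) (2 * pi * ((real k + s) / (real ?n + 1)))
      | k s j. k \<le> ?n \<and> 0 \<le> s \<and> s \<le> 1 \<and> 1 \<le> j \<and> j \<le> m}"
    unfolding braid_closure_def g_def ang ..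
  show ?thesis
  proof (intro equalityI subsetI)
    fix x assume "x \<in> braid_closure m w"
    then obtain k s j where x: "x = solid_torus_point (g k s j) (2 * pi * ((real k + s) / (real ?n + 1)))"
      and k: "k \<le> ?n" "0 \<le> s" "s \<le> 1" and j: "j \<in> {1..m}" unfolding B by auto
    obtain j' where j': "j' \<in> {1..m}" "word_pos (take k w) j' = j"
      using bij_word_pos[OF on_take[of k]] j unfolding bij_betw_def by (metis imageE)
    show "x \<in> config_closure m ?p"
      unfolding config_closure_def x
      using pg[OF k, of j'] j' range[OF k] by (intro CollectI exI[of _ "(real k + s) / (real ?n + 1)"] exI[of _ j']) simp
  next
    fix x assume "x \<in> config_closure m ?p"
    then obtain \<theta> j where x: "x = solid_torus_point (?p \<theta> j) (2 * pi * \<theta>)" "\<theta> \<in> {0..1}" "j \<in> {1..m}"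
      unfolding config_closure_def by blast
    define \<tau> where "\<tau> = (real ?n + 1) * \<theta>"
    have \<tau>: "0 \<le> \<tau>" "\<tau> \<le> real ?n + 1" using x(2) by (auto simp: \<tau>_def mult_left_le)
    obtain k s where k: "k \<le> ?n" "0 \<le> s" "s \<le> 1" and ks: "\<tau> = real k + s"
      using integer_part_exists[OF \<tau>] .
    have "(real ?n + 1) * \<theta> = real k + s" using ks by (simp add: \<tau>_def)
    then have \<theta>: "\<theta> = (real k + s) / (real ?n + 1)" by (simp add: eq_divide_eq mult.commute)
    have "word_pos (take k w) j \<in> {1..m}"
      using bij_betw_apply[OF bij_word_pos[OF on_take] x(3)] .
    then show "x \<in> braid_closure m w"
      unfolding B x(1) \<theta> pg[OF k] using k by fastforce
  qed
qed

lemma braid_closure_config: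
  assumes w: "braid_word_on m w"
  shows "ambient_isotopic (braid_closure m w) (config_closure m (word_config m w))"
    "ambient_isotopic (config_closure m (word_config m w)) (braid_closure m w)"
proof -
  let ?c = "real (length w) + 1"
  have h: "homotopic_paths Conf (word_path w) (\<lambda>\<theta>. timed_path w (?c * \<theta>))"
    by (rule timed_path_homotopic) simp
  have perm: "bij_betw (word_pos w) {1..m} {1..m}" by (rule bij_word_pos[OF w])
  have disc: "cmod (complex_of_real (2 / (real m + 1)) * timed_path w (?c * \<theta>) j + (- 1)) < 1"
    if \<theta>: "\<theta> \<in> {0..1}" and j: "j \<in> {1..m}" for \<theta> j
  proof -
    have "0 \<le> ?c * \<theta>" "?c * \<theta> \<le> ?c" using \<theta> by (auto simp: mult_left_le)
    then obtain k s where k: "k \<le> length w" "0 \<le> s" "s \<le> 1" and \<tau>: "?c * \<theta> = real k + s"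
      by (rule integer_part_exists)
    have on_take: "braid_word_on m (take k w)"
      using w append_take_drop_id[of k w] braid_word_on_simps(3) by metis
    have j': "word_pos (take k w) j \<in> {1..m}" using bij_betw_apply[OF bij_word_pos[OF on_take] j] .
    show ?thesis
    proof (cases "k < length w")
      case True
      then have "1 \<le> fst (w ! k) \<and> fst (w ! k) < m"
        using w nth_mem[OF True] unfolding braid_word_on_def by (auto simp: case_prod_beta)
      then show ?thesis
        unfolding \<tau> timed_path_letter[OF True k(2,3)] using letter_path_disc[OF _ _ j'] by blast
    next
      case False
      then have "timed_path w (real k + s) j = of_nat (word_pos w j)"
        using timed_path_end[of w "real k + s" j] k by simp
      moreover have "word_pos w j \<in> {1..m}" using bij_betw_apply[OF perm j] .
      ultimately show ?thesis
        unfolding \<tau> using word_config_disc[of m "[]" 0 "word_pos w j"] by (simp add: word_config_def)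
    qed
  qed
  have "ambient_isotopic (config_closure m (word_config m w)) (braid_closure m w)"
    unfolding braid_closure_timed[OF w] word_config_def[abs_def]
    by (rule homotopic_config_isotopy[OF h perm _ _ _ _ disc])
      (use word_config_disc[OF w] in \<open>auto simp: word_config_def\<close>)
  then show "ambient_isotopic (config_closure m (word_config m w)) (braid_closure m w)" .
  then show "ambient_isotopic (braid_closure m w) (config_closure m (word_config m w))"
    by (rule ambient_isotopic_sym) (rule config_closure_subset, rule less_imp_le, rule word_config_disc[OF w])
qed

lemma braid_closure_subset: "braid_word_on m w \<Longrightarrow> braid_closure m w \<subseteq> S3"
proof
  fix x assume w: "braid_word_on m w" and "x \<in> braid_closure m w"
  then obtain k s j where x: "x = solid_torus_point (if k < length w then letter_point m (w ! k) s j else base_point m j)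
     (2 * pi * (real k + s) / real (length w + 1))" and k: "k \<le> length w" "0 \<le> s" "s \<le> 1" "1 \<le> j" "j \<le> m"
    unfolding braid_closure_def by blast
  show "x \<in> S3"
    unfolding x
  proof (rule solid_torus_point_in_S3, cases "k < length w")
    case True
    then have "1 \<le> fst (w ! k) \<and> fst (w ! k) < m"
      using w nth_mem[OF True] unfolding braid_word_on_def by (auto simp: case_prod_beta)
    then show "cmod (if k < length w then letter_point m (w ! k) s j else base_point m j) \<le> 1"
      using letter_path_disc[of "w ! k" m j s] True k by (simp add: letter_point_affine)
  next
    case False
    then show "cmod (if k < length w then letter_point m (w ! k) s j else base_point m j) \<le> 1"
      using word_config_disc[of m "[]" 0 j] k by (simp add: base_point_affine word_config_def)
  qed
qed

lemma braid_eq_closure: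
  assumes "braid_eq u v" "braid_word_on m u" "braid_word_on m v"
  shows "ambient_isotopic (braid_closure m u) (braid_closure m v)"
proof -
  have "ambient_isotopic (config_closure m (word_config m u)) (config_closure m (word_config m v))"
    unfolding word_config_def[abs_def]
    by (rule homotopic_config_isotopy[OF assms(1)[unfolded braid_eq_def] bij_word_pos[OF assms(2)]])
      (use word_config_disc assms in \<open>auto simp: word_config_def\<close>)
  then show ?thesis
    using braid_closure_config[OF assms(2)] braid_closure_config[OF assms(3)] ambient_isotopic_trans by blast
qed

section \<open>Conjugation and reversal of positions\<close>

text \<open>For \<open>a = 0\<close>, \<open>b = 1\<close> this advances the angle of a closed braid
  by half a turn, which exchanges its two halves. For \<open>a = 1\<close>, \<open>b = 0\<close> it
  turns every fibre disc by a half turn, which reverses the positions.\<close>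

lemma ambient_isotopic_rotation:
  "ambient_isotopic A ((\<lambda>x. (cis (pi * a) * fst x, cis (pi * b) * snd x)) ` A)"
proof (rule ambient_isotopicI[where H = "\<lambda>t x. (cis (pi * a * t) * fst x, cis (pi * b * t) * snd x)"])
  show "continuous_on ({0..1} \<times> S3) (\<lambda>(t, x). (cis (pi * a * t) * fst x, cis (pi * b * t) * snd x))"
    unfolding case_prod_beta by (intro continuous_intros)
  show "(cis (pi * a * t) * fst x, cis (pi * b * t) * snd x) \<in> S3" if "x \<in> S3" for t x
    using that S3_eq[of "fst x" "snd x"] by (simp add: S3_eq norm_mult)
  show "inj_on (\<lambda>x. (cis (pi * a * t) * fst x, cis (pi * b * t) * snd x)) S3" for t
    by (auto simp: inj_on_def prod_eq_iff)
qed (simp_all add: mult.assoc)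

text \<open>After half a turn the path \<open>g\<close> comes before the path \<open>f\<close>. The
  permutations are needed because the label of a strand is its position at the start, and the start
  has moved to the middle.\<close>

lemma config_closure_half_turn:
  fixes f g :: "real \<Rightarrow> nat \<Rightarrow> complex"
  assumes \<pi>: "bij_betw \<pi> {1..m} {1..m}" and \<rho>: "bij_betw \<rho> {1..m} {1..m}"
    and glue: "\<And>j. j \<in> {1..m} \<Longrightarrow> g 1 j = f 0 (\<rho> j)"
  shows "(\<lambda>x. (cis (pi * 0) * fst x, cis (pi * 1) * snd x)) ` config_closure m (f +++ (\<lambda>\<theta> j. g \<theta> (\<pi> j)))
    \<subseteq> config_closure m (g +++ (\<lambda>\<theta> j. f \<theta> (\<rho> j)))"
proof clarify
  fix z w assume "(z, w) \<in> config_closure m (f +++ (\<lambda>\<theta> j. g \<theta> (\<pi> j)))"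
  then obtain \<theta> j where x: "(z, w) = solid_torus_point ((f +++ (\<lambda>\<theta> j. g \<theta> (\<pi> j))) \<theta> j) (2 * pi * \<theta>)"
    and \<theta>: "\<theta> \<in> {0..1}" and j: "j \<in> {1..m}" unfolding config_closure_def by blast
  have turn: "cis (2 * pi * (\<theta> + 1/2)) = - cis (2 * pi * \<theta>)" "cis (2 * pi * (\<theta> - 1/2)) = - cis (2 * pi * \<theta>)"
    by (simp_all add: complex_eq_iff distrib_left right_diff_distrib)
  show "(cis (pi * 0) * fst (z, w), cis (pi * 1) * snd (z, w)) \<in> config_closure m (g +++ (\<lambda>\<theta> j. f \<theta> (\<rho> j)))"
  proof (cases "\<theta> \<le> 1/2")
    case True
    obtain j' where j': "j' \<in> {1..m}" "\<rho> j' = j" using \<rho> j unfolding bij_betw_def by (metis imageE)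
    have "(g +++ (\<lambda>\<theta> j. f \<theta> (\<rho> j))) (\<theta> + 1/2) j' = f (2 * \<theta>) j"
      using True \<theta> glue[OF j'(1)] j'(2) by (cases "\<theta> = 0") (auto simp: joinpaths_def)
    then have "(cis (pi * 0) * fst (z, w), cis (pi * 1) * snd (z, w)) =
      solid_torus_point ((g +++ (\<lambda>\<theta> j. f \<theta> (\<rho> j))) (\<theta> + 1/2) j') (2 * pi * (\<theta> + 1/2))"
      using x True \<theta> by (simp add: solid_torus_point_def joinpaths_def turn(1)[simplified])
    then show ?thesis unfolding config_closure_def using True \<theta> j'(1) by fastforce
  next
    case False
    have "(cis (pi * 0) * fst (z, w), cis (pi * 1) * snd (z, w)) =
      solid_torus_point ((g +++ (\<lambda>\<theta> j. f \<theta> (\<rho> j))) (\<theta> - 1/2) (\<pi> j)) (2 * pi * (\<theta> - 1/2))"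
      using x False \<theta> by (simp add: solid_torus_point_def joinpaths_def turn(2)[simplified])
    moreover have "\<pi> j \<in> {1..m}" using bij_betw_apply[OF \<pi> j] .
    ultimately show ?thesis unfolding config_closure_def using False \<theta> by fastforce
  qed
qed

lemma joined_word_config:
  assumes "braid_word_on m u" "braid_word_on m v"
  defines "J \<equiv> word_config m u +++ (\<lambda>\<theta> j. word_config m v \<theta> (word_pos u j))"
  shows "ambient_isotopic (config_closure m (word_config m (u @ v))) (config_closure m J)"
proof -
  have J: "J \<theta> j = complex_of_real (2 / (real m + 1)) *
      (word_path u +++ (\<lambda>\<theta> j. word_path v \<theta> (word_pos u j))) \<theta> j + (- 1)" for \<theta> j
    by (simp add: J_def joinpaths_def word_config_def)
  have disc: "cmod (J \<theta> j) < 1" if "\<theta> \<in> {0..1}" "j \<in> {1..m}" for \<theta> j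
    using that word_config_disc[OF assms(1), of "2 * \<theta>" j]
      word_config_disc[OF assms(2), of "2 * \<theta> - 1" "word_pos u j"] bij_betw_apply[OF bij_word_pos[OF assms(1)] that(2)]
    by (auto simp: J_def joinpaths_def)
  have uv: "braid_word_on m (u @ v)" using assms by simp
  have "ambient_isotopic (config_closure m (word_config m (u @ v))) (config_closure m (\<lambda>\<theta> j. J \<theta> j))"
    unfolding word_config_def[abs_def] J
    by (rule homotopic_config_isotopy[OF word_path_append bij_word_pos[OF uv]])
      (use word_config_disc[OF uv] disc in \<open>auto simp: word_config_def J\<close>)
  then show ?thesis by simp
qed

lemma braid_closure_conjugate:
  assumes u: "braid_word_on m u" and v: "braid_word_on m v"
  shows "ambient_isotopic (braid_closure m (u @ v)) (braid_closure m (v @ u))"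
proof -
  let ?J = "\<lambda>u v. word_config m u +++ (\<lambda>\<theta> j. word_config m v \<theta> (word_pos u j))"
  let ?R = "\<lambda>x::complex \<times> complex. (cis (pi * 0) * fst x, cis (pi * 1) * snd x)"
  have sub: "?R ` config_closure m (?J u v) \<subseteq> config_closure m (?J v u)"
    if "braid_word_on m u" "braid_word_on m v" for u v
    by (rule config_closure_half_turn[OF bij_word_pos[OF that(1)] bij_word_pos[OF that(2)]])
      (simp add: word_config_def)
  \<comment> \<open>The half turn is an involution, so the inclusions for both orders of
    \<open>u\<close> and \<open>v\<close> give equality.\<close>
  have RR: "?R (?R x) = x" for x by (simp add: prod_eq_iff)
  have "?R ` config_closure m (?J u v) = config_closure m (?J v u)"
    using sub[OF u v] sub[OF v u] RR by (metis (no_types, lifting) image_eqI subsetI subset_antisym image_subset_iff)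
  then have J: "ambient_isotopic (config_closure m (?J u v)) (config_closure m (?J v u))"
    using ambient_isotopic_rotation[of "config_closure m (?J u v)" 0 1] by simp
  have uv: "braid_word_on m (u @ v)" "braid_word_on m (v @ u)" using u v by auto
  note braid_closure_config(1)[OF uv(1)]
  also note joined_word_config[OF u v]
  also note J
  also have "ambient_isotopic (config_closure m (?J v u)) (config_closure m (word_config m (v @ u)))"
    using word_config_disc[OF uv(2)]
    by (intro ambient_isotopic_sym[OF joined_word_config[OF v u]] config_closure_subset) (simp add: less_imp_le)
  also note braid_closure_config(2)[OF uv(2)]
  finally show ?thesis .
qed

text \<open>Positions are reversed but signs are kept, as befits a rotation of the disc; in the
  braid group this is conjugation by the half twist.\<close>

definition flip_word :: "nat \<Rightarrow> braid_word \<Rightarrow> braid_word" where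
  "flip_word m w = map (\<lambda>(i, e). (m - i, e)) w"

lemma letter_point_flip:
  assumes "1 \<le> i" "i < m" "1 \<le> j" "j \<le> m"
  shows "letter_point m (m - i, e) s (m + 1 - j) = - letter_point m (i, e) s j"
proof -
  have b: "base_point m (m + 1 - k) = - base_point m k" if "k \<le> m + 1" for k
    using that by (simp add: base_point_def of_nat_diff complex_eq_iff field_simps)
  have bb: "base_point m (m - i) = - base_point m (i + 1)" "base_point m (m - i + 1) = - base_point m i"
    using b[of "i + 1"] b[of i] assms by (simp_all add: Suc_diff_le)
  have bj: "base_point m (m + 1 - j) = - base_point m j" using b[of j] assms by simp
  have c: "m + 1 - j = m - i \<or> m + 1 - j = m - i + 1 \<longleftrightarrow> j = i \<or> j = i + 1"
    using assms by auto
  define d where "d = (base_point m i + base_point m (i + 1)) / 2"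
  have cc: "(- base_point m (i + 1) + - base_point m i) / 2 = - d"
    by (simp add: d_def field_simps)
  show ?thesis
    using assms unfolding letter_point_def Let_def fst_conv snd_conv c bb bj cc d_def[symmetric]
    by (auto simp: algebra_simps)
qed

lemma braid_closure_flip:
  assumes "braid_word_on m w"
  shows "ambient_isotopic (braid_closure m w) (braid_closure m (flip_word m w))"
proof -
  let ?R = "\<lambda>x::complex \<times> complex. (cis (pi * 1) * fst x, cis (pi * 0) * snd x)"
  have sub: "?R ` braid_closure m w \<subseteq> braid_closure m (flip_word m w)" if w: "braid_word_on m w" for w
  proof clarify
    fix z y assume "(z, y) \<in> braid_closure m w"
    then obtain k s j where x: "(z, y) = solid_torus_point
          (if k < length w then letter_point m (w ! k) s j else base_point m j)
          (2 * pi * (real k + s) / real (length w + 1))"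
      and k: "k \<le> length w" "0 \<le> s" "s \<le> 1" "1 \<le> j" "j \<le> m" unfolding braid_closure_def by blast
    have "(if k < length (flip_word m w) then letter_point m (flip_word m w ! k) s (m + 1 - j) else base_point m (m + 1 - j))
        = - (if k < length w then letter_point m (w ! k) s j else base_point m j)"
    proof (cases "k < length w")
      case True
      then have "1 \<le> fst (w ! k) \<and> fst (w ! k) < m"
        using w nth_mem[OF True] unfolding braid_word_on_def by (auto simp: case_prod_beta)
      then show ?thesis
        using True letter_point_flip[of "fst (w ! k)" m j "snd (w ! k)" s] k
        by (simp add: flip_word_def case_prod_beta)
    next
      case False
      then show ?thesis
        using k by (simp add: flip_word_def base_point_def of_nat_diff complex_eq_iff field_simps)
    qed
    then have "?R (z, y) = solid_torus_point
          (if k < length (flip_word m w) then letter_point m (flip_word m w ! k) s (m + 1 - j) else base_point m (m + 1 - j))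
          (2 * pi * (real k + s) / real (length (flip_word m w) + 1))"
      using x by (simp only: solid_torus_point_def prod.inject) (simp add: flip_word_def)
    then show "?R (z, y) \<in> braid_closure m (flip_word m w)"
      unfolding braid_closure_def using k
      by (intro CollectI exI[of _ k] exI[of _ s] exI[of _ "m + 1 - j"]) (auto simp: flip_word_def)
  qed
  have on: "braid_word_on m (flip_word m w)" and ff: "flip_word m (flip_word m w) = w"
    using assms by (induction w) (auto simp: flip_word_def braid_word_on_def)
  have RR: "?R (?R x) = x" for x by (simp add: prod_eq_iff)
  have "?R ` braid_closure m w = braid_closure m (flip_word m w)"
    using sub[OF assms] sub[OF on, unfolded ff] RR
    by (metis (no_types, lifting) image_eqI subsetI subset_antisym image_subset_iff)
  then show ?thesis
    using ambient_isotopic_rotation[of "braid_closure m w" 1 0] by simp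
qed

section \<open>Markov destabilisation\<close>

lemma word_path_fixed:
  assumes "braid_word_on m w" "m < j"
  shows "word_path w \<theta> j = of_nat j" "word_pos w j = j"
proof -
  have *: "word_path w \<theta> j = of_nat j \<and> word_pos w j = j"
    using assms
  proof (induction w arbitrary: \<theta>)
    case (Cons l w)
    have "letter_path l s j = of_nat j" for s using Cons.prems by (simp add: letter_path_cases)
    moreover have "letter_swap l j = j" using Cons.prems by (simp add: letter_swap_def)
    ultimately show ?case using Cons by (simp add: joinpaths_def)
  qed simp
  then show "word_path w \<theta> j = of_nat j" "word_pos w j = j" by blast+
qed

text \<open>Keeps the first \<open>m\<close> strands out of the side of the disc in which the Markov
  loop will be unwound.\<close>

lemma Re_word_path_le:
  assumes "braid_word_on m w" "j \<in> {1..m}" "\<theta> \<in> {0..1}"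
  shows "Re (word_path w \<theta> j) \<le> real m"
  using assms
proof (induction w arbitrary: \<theta> j)
  case (Cons l w)
  show ?case
  proof (cases "\<theta> \<le> 1/2")
    case True
    define d where "d = (1 - cos (pi * (2 * \<theta>))) / 2"
    have "0 \<le> d" "d \<le> 1" unfolding d_def by simp_all
    moreover have "real (fst l) + 1 \<le> real m" using Cons.prems by simp
    ultimately have "Re (letter_path l (2 * \<theta>) j) \<le> real m"
      using Cons.prems unfolding Re_letter_path d_def[symmetric] by auto
    then show ?thesis using True by (simp add: joinpaths_def)
  next
    case False
    have "letter_swap l j \<in> {1..m}"
      using bij_betw_apply[OF bij_letter_swap[of l m]] Cons.prems by simp
    then show ?thesis using Cons.IH[of "letter_swap l j" "2 * \<theta> - 1"] Cons.prems False by (simp add: joinpaths_def)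
  qed
qed simp

text \<open>In the second half the points are numbered anew, by their positions at time 1/2, so that
  both halves can be listed without mentioning the permutation.\<close>

lemma config_closure_halves:
  assumes \<pi>: "bij_betw \<pi> {1..n} {1..n}" and glue: "\<And>j. j \<in> {1..n} \<Longrightarrow> f (1/2) j = g (1/2) (\<pi> j)"
  shows "config_closure n (\<lambda>\<theta> j. if \<theta> \<le> 1/2 then f \<theta> j else g \<theta> (\<pi> j)) =
    {solid_torus_point (f \<theta> j) (2 * pi * \<theta>) | \<theta> j. 0 \<le> \<theta> \<and> \<theta> \<le> 1/2 \<and> j \<in> {1..n}} \<union>
    {solid_torus_point (g \<theta> k) (2 * pi * \<theta>) | \<theta> k. 1/2 \<le> \<theta> \<and> \<theta> \<le> 1 \<and> k \<in> {1..n}}" (is "?L = ?A \<union> ?B")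
proof (intro equalityI subsetI)
  fix x assume "x \<in> ?L"
  then obtain \<theta> j where x: "x = solid_torus_point (if \<theta> \<le> 1/2 then f \<theta> j else g \<theta> (\<pi> j)) (2 * pi * \<theta>)"
    "\<theta> \<in> {0..1}" "j \<in> {1..n}" unfolding config_closure_def by blast
  show "x \<in> ?A \<union> ?B"
  proof (cases "\<theta> \<le> 1/2")
    case True
    then have "x \<in> ?A" using x by auto
    then show ?thesis ..
  next
    case False
    have "\<pi> j \<in> {1..n}" using bij_betw_apply[OF \<pi> x(3)] .
    then have "x \<in> ?B" using x False by (intro CollectI exI[of _ \<theta>] exI[of _ "\<pi> j"]) auto
    then show ?thesis ..
  qed
next
  fix x assume "x \<in> ?A \<union> ?B"
  then show "x \<in> ?L"
  proof
    assume "x \<in> ?A"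
    then obtain \<theta> j where "x = solid_torus_point (f \<theta> j) (2 * pi * \<theta>)" "0 \<le> \<theta>" "\<theta> \<le> 1/2" "j \<in> {1..n}" by blast
    then show "x \<in> ?L" unfolding config_closure_def by (intro CollectI exI[of _ \<theta>] exI[of _ j]) auto
  next
    assume "x \<in> ?B"
    then obtain \<theta> k where x: "x = solid_torus_point (g \<theta> k) (2 * pi * \<theta>)" "1/2 \<le> \<theta>" "\<theta> \<le> 1" "k \<in> {1..n}" by blast
    obtain j where j: "j \<in> {1..n}" "\<pi> j = k" using \<pi> x(4) unfolding bij_betw_def by (metis imageE)
    have "(if \<theta> \<le> 1/2 then f \<theta> j else g \<theta> (\<pi> j)) = g \<theta> k"
    proof (cases "\<theta> = 1/2")
      case True
      show ?thesis unfolding True using glue[OF j(1)] j(2) by simp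
    qed (use j(2) x(2) in auto)
    then show "x \<in> ?L" unfolding config_closure_def using x j by (intro CollectI exI[of _ \<theta>] exI[of _ j]) auto
  qed
qed

lemma path_word_letter: "homotopic_paths Conf (word_path [l]) (letter_path l)"
proof -
  have "homotopic_paths Conf (letter_path l) (word_path [l])"
  proof (rule homotopic_paths_reparametrize[where f = "\<lambda>t. min (2 * t) 1"])
    show "path (letter_path l)" by (rule path_letter_path)
    show "path_image (letter_path l) \<subseteq> Conf" using letter_path_Conf[of _ l] unfolding path_image_def by blast
    show "continuous_on {0..1} (\<lambda>t::real. min (2 * t) 1)" by (intro continuous_intros)
    show "word_path [l] t = letter_path l (min (2 * t) 1)" for t
      by (auto simp: joinpaths_def fun_eq_iff min_def)
  qed auto
  then show ?thesis by (rule homotopic_paths_sym)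
qed

text \<open>The excursion of strand \<open>m\<close> before (\<open>loop_in\<close>) and after (\<open>loop_out\<close>) the Markov loop, as a
  function of \<open>s \<in> {0..1}\<close>. In between the strand runs along the segment \<open>24/25 + \<i> y\<close> with \<open>y\<close>
  decreasing from \<open>1/5\<close> to \<open>-1/5\<close> (up to the sign \<open>\<epsilon>\<close>), so that the loop is parametrised by \<open>y\<close>
  and can be undone by \<open>hemisphere_push\<close>.\<close>

definition loop_x :: "real \<Rightarrow> real" where
  "loop_x s = 24/25 * max 0 (min 1 (6 * s - 1))"

definition loop_y :: "real \<Rightarrow> real" where
  "loop_y s = 1/5 * min (6 * s) (min 1 (9/7 - 6/7 * s))"

definition loop_in :: "real \<Rightarrow> real \<Rightarrow> complex" where
  "loop_in \<epsilon> s = Complex (loop_x s) (\<epsilon> * loop_y s)"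

definition loop_out :: "real \<Rightarrow> real \<Rightarrow> complex" where
  "loop_out \<epsilon> s = Complex (loop_x (1 - s)) (- \<epsilon> * loop_y (1 - s))"

lemma loop_x_bounds: "0 \<le> loop_x s" "loop_x s \<le> 24/25"
  by (auto simp: loop_x_def)

lemma loop_y_bounds: "s \<in> {0..1} \<Longrightarrow> 0 \<le> loop_y s" "loop_y s \<le> 1/5"
  by (auto simp: loop_y_def)

lemma loop_y_pos: "0 < s \<Longrightarrow> s \<le> 1 \<Longrightarrow> 0 < loop_y s"
  by (simp add: loop_y_def)

lemma loop_values:
  "s \<le> 1/6 \<Longrightarrow> loop_x s = 0" "1/3 \<le> s \<Longrightarrow> loop_x s = 24/25"
  "1/6 \<le> s \<Longrightarrow> s \<le> 1/3 \<Longrightarrow> loop_y s = 1/5"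
  "1/3 \<le> s \<Longrightarrow> loop_y s = 1/5 * (9/7 - 6/7 * s)"
  by (auto simp: loop_x_def loop_y_def min_def max_def)

lemma loop_disc:
  assumes "\<bar>x\<bar> \<le> 24/25" "\<bar>y\<bar> \<le> 1/5"
  shows "cmod (Complex x y) < 1"
proof -
  have "x\<^sup>2 \<le> (24/25)\<^sup>2" "y\<^sup>2 \<le> (1/5)\<^sup>2"
    using power_mono[OF assms(1), of 2] power_mono[OF assms(2), of 2] by simp_all
  then have "x\<^sup>2 + y\<^sup>2 < 1" by (simp add: power2_eq_square)
  then show ?thesis by (simp add: cmod_def)
qed

text \<open>The value of \<open>cmod w\<close> on the segment \<open>24/25 + \<i> y\<close>. Since
  7, 24, 25 is a Pythagorean triple, it has the rational bound 7/25, attained at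
  \<open>y = 0\<close>.\<close>

definition loop_radius :: "real \<Rightarrow> real" where
  "loop_radius y = sqrt (1 - (24/25)\<^sup>2 - y\<^sup>2)"

lemma loop_point:
  assumes "\<bar>y\<bar> \<le> 1/5"
  shows "hemisphere_point y (complex_of_real (loop_radius y) * cis (2 * pi * \<psi>)) = solid_torus_point (Complex (24/25) y) (2 * pi * \<psi>)"
proof -
  have "y\<^sup>2 \<le> (1/5)\<^sup>2" using power_mono[OF assms, of 2] by simp
  then have r: "(loop_radius y)\<^sup>2 = 1 - (24/25)\<^sup>2 - y\<^sup>2" "0 \<le> 1 - (24/25)\<^sup>2 - y\<^sup>2"
    by (simp_all add: loop_radius_def power2_eq_square)
  have "sqrt (1 - y\<^sup>2 - (cmod (complex_of_real (loop_radius y) * cis (2 * pi * \<psi>)))\<^sup>2) = 24/25"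
    using r(1) by (simp add: norm_mult power_mult_distrib)
  moreover have "sqrt (1 - (cmod (Complex (24/25) y))\<^sup>2) = loop_radius y"
    by (simp add: loop_radius_def cmod_power2 diff_diff_eq)
  ultimately show ?thesis
    unfolding hemisphere_point_def solid_torus_point_def
    by (simp only: prod.inject) (simp add: complex_eq_iff)
qed

lemma loop_radius_le:
  assumes "\<bar>y\<bar> \<le> 1/5"
  shows "\<bar>loop_radius y\<bar> \<le> 7/25"
proof -
  have "y\<^sup>2 \<le> (1/5)\<^sup>2" using power_mono[OF assms, of 2] by simp
  then have "0 \<le> 1 - (24/25)\<^sup>2 - y\<^sup>2" "1 - (24/25)\<^sup>2 - y\<^sup>2 \<le> (7/25)\<^sup>2"
    using zero_le_power2[of y] by (simp_all add: power2_eq_square)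
  moreover from this(2) have "loop_radius y \<le> 7/25"
    unfolding loop_radius_def by (intro real_le_lsqrt) simp_all
  ultimately show ?thesis by (simp add: loop_radius_def)
qed

text \<open>The push that replaces the loop, which winds \<open>7/6\<close> times around the axis, by an arc that winds
  only \<open>1/6\<close> times.\<close>

lemma unwind_loop:
  assumes \<epsilon>: "\<epsilon> = 1 \<or> \<epsilon> = - 1"
    and S: "S \<subseteq> S3" "\<And>x. x \<in> S \<Longrightarrow> Re (fst x) \<le> 0 \<or> 1/5 \<le> \<bar>Im (fst x)\<bar>"
  shows "ambient_isotopic
    (S \<union> (\<lambda>y. solid_torus_point (Complex (24/25) (\<epsilon> * y)) (2 * pi * (2/3 + 7/12 * (1 - 5 * y)))) ` {-1/5..1/5})
    (S \<union> (\<lambda>y. solid_torus_point (Complex (24/25) (\<epsilon> * y)) (2 * pi * (2/3 + 1/12 * (1 - 5 * y)))) ` {-1/5..1/5})"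
proof -
  define w0 where "w0 y = complex_of_real (loop_radius y) * cis (2 * pi * (2/3 + 7/12 * (1 - 5 * (\<epsilon> * y))))" for y
  define w1 where "w1 y = complex_of_real (loop_radius y) * cis (2 * pi * (2/3 + 1/12 * (1 - 5 * (\<epsilon> * y))))" for y
  have n: "cmod (w0 y) \<le> 7/25" "cmod (w1 y) \<le> 7/25" if "y \<in> {-(1/5)..1/5}" for y
    using loop_radius_le[of y] that by (auto simp: w0_def w1_def norm_mult abs_le_iff)
  have turn: "cis (2 * pi * (\<psi> + 1)) = cis (2 * pi * \<psi>)" for \<psi>
    by (simp add: distrib_left cis_mult[symmetric])
  \<comment> \<open>At the far end the two arcs have the angles 11/6 and 5/6 of a turn, so they end
    at the same point although they wind differently.\<close>
  have turn': "cis (2 * pi * (2/3 + 7/12 * 2)) = cis (2 * pi * (2/3 + 1/12 * 2))"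
    using turn[of "2/3 + 1/12 * 2"] by simp
  have cont: "continuous_on {-(1/5)..1/5} w0" "continuous_on {-(1/5)..1/5} w1"
    unfolding w0_def w1_def loop_radius_def by (intro continuous_intros)+
  have "ambient_isotopic (S \<union> (\<lambda>y. hemisphere_point y (w0 y)) ` {-(1/5)..1/5})
    (S \<union> (\<lambda>y. hemisphere_point y (w1 y)) ` {-(1/5)..1/5})"
  \<comment> \<open>Both arcs stay in \<open>cmod w \<le> 7/25\<close>, so they differ by at most
    14/25 < 3/5. Moreover 7/25 + 3/5 = 22/25 is less than \<open>sqrt (24/25)\<close>, the radius of
    the smallest level disc of the band.\<close>
  proof (rule hemisphere_push[where R = "3/5" and \<kappa> = "14/25", OF _ _ _ _ cont _ _ _ _ S])
    show "w0 (1/5) = w1 (1/5)" "w0 (- (1/5)) = w1 (- (1/5))"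
      using \<epsilon> turn' by (auto simp: w0_def w1_def)
    show "cmod (w1 y - w0 y) \<le> 14/25" if "y \<in> {-(1/5)..1/5}" for y
      using n[OF that] norm_triangle_ineq4[of "w1 y" "w0 y"] by linarith
    have "(22/25)\<^sup>2 \<le> 1 - (1/5 :: real)\<^sup>2" by (simp add: power2_eq_square)
    then have "22/25 \<le> sqrt (1 - (1/5 :: real)\<^sup>2)" by (rule real_le_rsqrt)
    then show "cmod (w0 y) + 3/5 \<le> sqrt (1 - (1/5)\<^sup>2)" if "y \<in> {-(1/5)..1/5}" for y
      using n(1)[OF that] by linarith
  qed auto
  moreover have "(\<lambda>y. hemisphere_point y (complex_of_real (loop_radius y) * cis (2 * pi * \<psi> (\<epsilon> * y)))) ` {-(1/5)..1/5} =
     (\<lambda>y. solid_torus_point (Complex (24/25) (\<epsilon> * y)) (2 * pi * \<psi> y)) ` {-1/5..1/5}" for \<psi>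
  proof -
    \<comment> \<open>\<open>hemisphere_push\<close> has the imaginary part itself as parameter,
      here it is \<epsilon> times the parameter. The sign maps the interval onto itself.\<close>
    have im: "(\<lambda>y. \<epsilon> * y) ` {-(1/5)..1/5} = {-1/5..1/5::real}"
      using \<epsilon> by auto
    have "(\<lambda>y. hemisphere_point y (complex_of_real (loop_radius y) * cis (2 * pi * \<psi> (\<epsilon> * y)))) ` {-(1/5)..1/5} =
      (\<lambda>y. solid_torus_point (Complex (24/25) (\<epsilon> * (\<epsilon> * y))) (2 * pi * \<psi> (\<epsilon> * y))) ` {-(1/5)..1/5}"
      using \<epsilon> by (intro image_cong) (auto simp: loop_point abs_le_iff)
    also have "\<dots> = (\<lambda>y. solid_torus_point (Complex (24/25) (\<epsilon> * y)) (2 * pi * \<psi> y)) ` (\<lambda>y. \<epsilon> * y) ` {-(1/5)..1/5}"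
      by (simp only: image_image)
    finally show ?thesis by (simp only: im)
  qed
  from this[of "\<lambda>y. 2/3 + 7/12 * (1 - 5 * y)"] this[of "\<lambda>y. 2/3 + 1/12 * (1 - 5 * y)"]
  have "(\<lambda>y. hemisphere_point y (w0 y)) ` {-(1/5)..1/5} =
      (\<lambda>y. solid_torus_point (Complex (24/25) (\<epsilon> * y)) (2 * pi * (2/3 + 7/12 * (1 - 5 * y)))) ` {-1/5..1/5}"
    "(\<lambda>y. hemisphere_point y (w1 y)) ` {-(1/5)..1/5} =
      (\<lambda>y. solid_torus_point (Complex (24/25) (\<epsilon> * y)) (2 * pi * (2/3 + 1/12 * (1 - 5 * y)))) ` {-1/5..1/5}"
    unfolding w0_def w1_def by simp_all
  ultimately show ?thesis by simp
qed

lemma config_linear_isotopy: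
  assumes cont: "\<And>j. j \<in> {1..n} \<Longrightarrow> continuous_on {0..1} (\<lambda>\<theta>. P \<theta> j)"
      "\<And>j. j \<in> {1..n} \<Longrightarrow> continuous_on {0..1} (\<lambda>\<theta>. Q \<theta> j)"
    and disc: "\<And>\<theta> j. \<theta> \<in> {0..1} \<Longrightarrow> j \<in> {1..n} \<Longrightarrow> cmod (P \<theta> j) < 1"
      "\<And>\<theta> j. \<theta> \<in> {0..1} \<Longrightarrow> j \<in> {1..n} \<Longrightarrow> cmod (Q \<theta> j) < 1"
    and perm: "bij_betw \<sigma> {1..n} {1..n}" "\<And>j. j \<in> {1..n} \<Longrightarrow> P 1 j = P 0 (\<sigma> j)"
      "\<And>j. j \<in> {1..n} \<Longrightarrow> Q 1 j = Q 0 (\<sigma> j)"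
    and ne: "\<And>t \<theta> i j. \<lbrakk>t \<in> {0..1}; \<theta> \<in> {0..1}; i \<in> {1..n}; j \<in> {1..n}; i \<noteq> j\<rbrakk> \<Longrightarrow>
      complex_of_real (1 - t) * P \<theta> i + complex_of_real t * Q \<theta> i \<noteq>
      complex_of_real (1 - t) * P \<theta> j + complex_of_real t * Q \<theta> j"
  shows "ambient_isotopic (config_closure n P) (config_closure n Q)"
proof -
  define H where "H t \<theta> j = complex_of_real (1 - t) * P \<theta> j + complex_of_real t * Q \<theta> j" for t \<theta> j
  have "ambient_isotopic (config_closure n (H 0)) (config_closure n (H 1))"
  proof (rule config_family_isotopy[OF _ _ _ perm(1)])
    fix j assume j: "j \<in> {1..n}"
    have "continuous_on ({0..1::real} \<times> {0..1}) (\<lambda>x. P (snd x) j)" "continuous_on ({0..1::real} \<times> {0..1}) (\<lambda>x. Q (snd x) j)"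
      using cont[OF j]
      by (auto intro!: continuous_on_compose2[of "{0..1}" _ _ snd] continuous_on_snd continuous_on_id)
    then show "continuous_on ({0..1} \<times> {0..1}) (\<lambda>(t, \<theta>). H t \<theta> j)"
      unfolding H_def case_prod_beta by (intro continuous_intros)
  next
    fix t \<theta> j assume *: "t \<in> {0..1::real}" "\<theta> \<in> {0..1::real}" "j \<in> {1..n}"
    have "(1 - t) *\<^sub>R P \<theta> j + t *\<^sub>R Q \<theta> j \<in> ball 0 1"
      by (rule convexD[OF convex_ball]) (use disc[OF *(2,3)] * in auto)
    then show "cmod (H t \<theta> j) < 1"
      by (simp add: H_def scaleR_conv_of_real)
  next
    fix t \<theta> assume "t \<in> {0..1::real}" "\<theta> \<in> {0..1::real}"
    then show "inj_on (H t \<theta>) {1..n}"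
      unfolding H_def using ne by (intro inj_onI) blast
  next
    fix t j assume "t \<in> {0..1::real}" "j \<in> {1..n}"
    then show "H t 1 j = H t 0 (\<sigma> j)" by (simp only: H_def perm(2,3))
  qed
  moreover have "H 0 = P" "H 1 = Q" by (simp_all add: H_def fun_eq_iff)
  ultimately show ?thesis by simp
qed

lemma continuous_on_glue:
  fixes f g :: "real \<Rightarrow> 'a::topological_space"
  assumes "continuous_on {a..b} f" "continuous_on {b..c} g" "f b = g b"
  shows "continuous_on {a..c} (\<lambda>\<theta>. if \<theta> \<le> b then f \<theta> else g \<theta>)"
proof (rule continuous_on_cases_le)
  show "continuous_on {t \<in> {a..c}. t \<le> b} f" by (rule continuous_on_subset[OF assms(1)]) auto
  show "continuous_on {t \<in> {a..c}. b \<le> t} g" by (rule continuous_on_subset[OF assms(2)]) auto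
  show "f t = g t" if "t = b" for t using assms(3) that by simp
qed (rule continuous_on_id)

lemma continuous_on_loop:
  "continuous_on S (\<lambda>\<theta>. loop_in \<epsilon> (2 * \<theta> - 1))" "continuous_on S (\<lambda>\<theta>. loop_out \<epsilon> (2 * \<theta> - 1))"
  unfolding loop_in_def loop_out_def loop_x_def loop_y_def Complex_eq
  by (intro continuous_intros)+

text \<open>The arc that remains after the loop is unwound.\<close>

definition loop_mid :: "real \<Rightarrow> real \<Rightarrow> complex" where
  "loop_mid \<epsilon> s = (if s \<le> 1/3 then loop_in \<epsilon> s else
     if s \<le> 2/3 then Complex (24/25) (\<epsilon> * (1/5 * (3 - 6 * s))) else loop_out \<epsilon> s)"

lemma continuous_on_loop_mid: "continuous_on {1/2..1} (\<lambda>\<theta>. loop_mid \<epsilon> (2 * \<theta> - 1))"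
proof -
  have "continuous_on {1/2..1} (\<lambda>\<theta>. if \<theta> \<le> 2/3 then loop_in \<epsilon> (2 * \<theta> - 1) else
      if \<theta> \<le> 5/6 then Complex (24/25) (\<epsilon> * (1/5 * (3 - 6 * (2 * \<theta> - 1)))) else loop_out \<epsilon> (2 * \<theta> - 1))"
  proof (intro continuous_on_glue continuous_on_loop)
    show "continuous_on S (\<lambda>\<theta>. Complex (24/25) (\<epsilon> * (1/5 * (3 - 6 * (2 * \<theta> - 1)))))" for S
      unfolding Complex_eq by (intro continuous_intros)
  qed (simp_all add: loop_in_def loop_out_def loop_x_def loop_y_def)
  moreover have "(if \<theta> \<le> 2/3 then loop_in \<epsilon> (2 * \<theta> - 1) else
      if \<theta> \<le> 5/6 then Complex (24/25) (\<epsilon> * (1/5 * (3 - 6 * (2 * \<theta> - 1)))) else loop_out \<epsilon> (2 * \<theta> - 1)) =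
      loop_mid \<epsilon> (2 * \<theta> - 1)" for \<theta>
  proof -
    have "\<theta> \<le> 2/3 \<longleftrightarrow> 2 * \<theta> - 1 \<le> 1/3" "\<theta> \<le> 5/6 \<longleftrightarrow> 2 * \<theta> - 1 \<le> 2/3" by linarith+
    then show ?thesis unfolding loop_mid_def by simp
  qed
  ultimately show ?thesis by simp
qed

lemma loop_in_disc: "\<epsilon> = 1 \<or> \<epsilon> = - 1 \<Longrightarrow> s \<in> {0..1} \<Longrightarrow> cmod (loop_in \<epsilon> s) < 1"
  unfolding loop_in_def using loop_x_bounds[of s] loop_y_bounds[of s] by (intro loop_disc) (auto simp: abs_mult)

lemma loop_out_disc: "\<epsilon> = 1 \<or> \<epsilon> = - 1 \<Longrightarrow> s \<in> {0..1} \<Longrightarrow> cmod (loop_out \<epsilon> s) < 1"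
  unfolding loop_out_def using loop_x_bounds[of "1 - s"] loop_y_bounds[of "1 - s"]
  by (intro loop_disc) (auto simp: abs_mult)

lemma loop_mid_disc: "\<epsilon> = 1 \<or> \<epsilon> = - 1 \<Longrightarrow> s \<in> {0..1} \<Longrightarrow> cmod (loop_mid \<epsilon> s) < 1"
proof -
  assume \<epsilon>: "\<epsilon> = 1 \<or> \<epsilon> = - 1" and s: "s \<in> {0..1}"
  have "cmod (Complex (24/25) (\<epsilon> * (1/5 * (3 - 6 * s)))) < 1" if "1/3 < s" "s \<le> 2/3"
    using \<epsilon> that by (intro loop_disc) (auto simp: abs_mult abs_le_iff)
  then show ?thesis
    unfolding loop_mid_def using loop_in_disc[OF \<epsilon> s] loop_out_disc[OF \<epsilon> s] by auto
qed

lemma Re_loop_mid: "0 \<le> Re (loop_mid \<epsilon> s)"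
  unfolding loop_mid_def loop_in_def loop_out_def using loop_x_bounds by auto

text \<open>The closing strand of a Markov stabilisation bounds a disc that meets the braid axis once;
  it is first moved far away from the other strands and then pushed across the axis.\<close>

theorem markov_destabilize:
  assumes w: "braid_word_on m w" and m: "1 \<le> m"
  shows "ambient_isotopic (braid_closure (m + 1) (w @ [(m, e)])) (braid_closure m w)"
proof -
  define \<epsilon> :: real where "\<epsilon> = (if e then 1 else - 1)"
  have \<epsilon>: "\<epsilon> = 1 \<or> \<epsilon> = - 1" by (simp add: \<epsilon>_def)
  define \<alpha> where "\<alpha> = 2 / (real (m + 1) + 1)"
  have \<alpha>: "0 < \<alpha>" by (simp add: \<alpha>_def)
  let ?l = "(m, e)"
  define \<pi> where "\<pi> = word_pos w"
  define \<sigma> where "\<sigma> = word_pos (w @ [?l])"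
  have w1: "braid_word_on (m + 1) w" using w by (auto simp: braid_word_on_def)
  have wl: "braid_word_on (m + 1) (w @ [?l])" using w1 m by simp
  have \<pi>m: "bij_betw \<pi> {1..m} {1..m}" unfolding \<pi>_def by (rule bij_word_pos[OF w])
  have \<pi>: "bij_betw \<pi> {1..m + 1} {1..m + 1}" unfolding \<pi>_def by (rule bij_word_pos[OF w1])
  have \<pi>top: "\<pi> (m + 1) = m + 1" unfolding \<pi>_def by (rule word_path_fixed(2)[OF w]) simp
  have \<sigma>: "bij_betw \<sigma> {1..m + 1} {1..m + 1}" unfolding \<sigma>_def by (rule bij_word_pos[OF wl])
  have \<sigma>eq: "\<sigma> j = letter_swap ?l (\<pi> j)" for j by (simp add: \<sigma>_def \<pi>_def word_pos_append)
  have \<pi>in: "\<pi> j \<in> {1..m}" if "j \<in> {1..m}" for j using bij_betw_apply[OF \<pi>m that] .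
  have \<pi>in': "\<pi> j \<in> {1..m + 1}" if "j \<in> {1..m + 1}" for j using bij_betw_apply[OF \<pi> that] .
  have \<pi>inj: "\<pi> i \<noteq> \<pi> j" if "i \<noteq> j" for i j using inj_word_pos[of w] that unfolding \<pi>_def by (auto dest: injD)
  \<comment> \<open>\<open>A\<close> puts position \<open>m\<close> at the origin and the earlier
    positions on the negative real axis. It has half the scale of the closure because half the
    difference of two points of the unit disc is again in the unit disc.\<close>
  define A where "A z = complex_of_real (\<alpha> / 2) * z + complex_of_real (- (\<alpha> / 2 * real m))" for z
  have ReA: "Re (A z) = \<alpha> / 2 * (Re z - real m)" for z by (simp add: A_def algebra_simps)
  have A0: "A (of_nat m) = 0" by (simp add: A_def)
  have A_disc: "cmod (A z) < 1" if "cmod (complex_of_real \<alpha> * z + (- 1)) < 1" for z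
  proof -
    have "cmod (complex_of_real \<alpha> * of_nat m + (- 1)) < 1"
      using word_config_disc[of "m + 1" "[]" 0 m] m by (simp add: word_config_def \<alpha>_def)
    then have "cmod ((complex_of_real \<alpha> * z + (- 1)) - (complex_of_real \<alpha> * of_nat m + (- 1))) < 2"
      using that norm_triangle_ineq4[of "complex_of_real \<alpha> * z + (- 1)" "complex_of_real \<alpha> * of_nat m + (- 1)"] by linarith
    moreover have "(complex_of_real \<alpha> * z + (- 1)) - (complex_of_real \<alpha> * of_nat m + (- 1)) = 2 * A z"
      by (simp add: A_def algebra_simps)
    ultimately show ?thesis by (simp add: norm_mult)
  qed
  define P where "P \<theta> j = (if \<theta> \<le> 1/2 then complex_of_real \<alpha> * word_path w (2 * \<theta>) j + (- 1)
     else complex_of_real \<alpha> * letter_path ?l (2 * \<theta> - 1) (\<pi> j) + (- 1))" for \<theta> j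
  \<comment> \<open>During the first half the top strand runs along the segment. Its height is to
    fall linearly from 1/5 to -1/5 over the 7/6 turns between the angles 2/3 and 11/6. This gives
    the slope 12/7 and, at angle 1, the value 3/7, both in units of 1/5.\<close>
  define F where "F \<theta> j = (if j \<le> m then A (word_path w (2 * \<theta>) j)
     else Complex (24/25) (\<epsilon> * (1/5 * (3/7 - 12/7 * \<theta>))))" for \<theta> j
  \<comment> \<open>The last letter is carried out with the roles exchanged as required: the strand
    in position \<open>m\<close> leaves the origin for the segment, and the top strand returns from
    the segment to the origin.\<close>
  define G where "G \<theta> k = (if k < m then A (of_nat k) else if k = m then loop_in \<epsilon> (2 * \<theta> - 1)
     else loop_out \<epsilon> (2 * \<theta> - 1))" for \<theta> k
  define Q where "Q \<theta> j = (if \<theta> \<le> 1/2 then F \<theta> j else G \<theta> (\<pi> j))" for \<theta> j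
  define G' where "G' \<theta> k = (if k < m then A (of_nat k) else loop_mid \<epsilon> (2 * \<theta> - 1))" for \<theta> k
  define Q' where "Q' \<theta> j = (if \<theta> \<le> 1/2 then F \<theta> j else G' \<theta> (\<pi> j))" for \<theta> j
  have disc_w: "cmod (complex_of_real \<alpha> * word_path w \<theta> j + (- 1)) < 1" if "\<theta> \<in> {0..1}" "j \<in> {1..m + 1}" for \<theta> j
    using word_config_disc[OF w1 that] by (simp only: word_config_def \<alpha>_def)
  have disc_l: "cmod (complex_of_real \<alpha> * letter_path ?l s j + (- 1)) < 1" if "j \<in> {1..m + 1}" for s j
    using letter_path_disc[of ?l "m + 1" j s] that m by (simp add: \<alpha>_def)
  have disc_k: "cmod (A (of_nat k)) < 1" if "k \<in> {1..m + 1}" for k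
    using A_disc disc_w[of 0 k] that by simp
  have disc_P: "cmod (P \<theta> j) < 1" if "\<theta> \<in> {0..1}" "j \<in> {1..m + 1}" for \<theta> j
    unfolding P_def using disc_w[OF _ that(2), of "2 * \<theta>"] disc_l[OF \<pi>in'[OF that(2)]] that by auto
  have disc_F: "cmod (F \<theta> j) < 1" if "0 \<le> \<theta>" "\<theta> \<le> 1/2" "j \<in> {1..m + 1}" for \<theta> j
  proof (cases "j \<le> m")
    case True
    then show ?thesis unfolding F_def using A_disc disc_w[OF _ that(3), of "2 * \<theta>"] that by simp
  next
    case False
    have "\<bar>\<epsilon> * (1/5 * (3/7 - 12/7 * \<theta>))\<bar> \<le> 1/5" using \<epsilon> that by (auto simp: abs_le_iff)
    then show ?thesis unfolding F_def using False loop_disc by simp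
  qed
  have disc_G: "cmod (G \<theta> k) < 1" if "1/2 \<le> \<theta>" "\<theta> \<le> 1" "k \<in> {1..m + 1}" for \<theta> k
    unfolding G_def using disc_k[OF that(3)] loop_in_disc[OF \<epsilon>] loop_out_disc[OF \<epsilon>] that by simp
  have disc_Q: "cmod (Q \<theta> j) < 1" if "\<theta> \<in> {0..1}" "j \<in> {1..m + 1}" for \<theta> j
    unfolding Q_def using disc_F[OF _ _ that(2)] disc_G[OF _ _ \<pi>in'[OF that(2)]] that by auto
  have disc_Q': "cmod (Q' \<theta> j) < 1" if "\<theta> \<in> {0..1}" "j \<in> {1..m}" for \<theta> j
    unfolding Q'_def G'_def using disc_F[of \<theta> j] disc_k[of "\<pi> j"] \<pi>in[OF that(2)] loop_mid_disc[OF \<epsilon>] that by auto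
  have F_half: "F (1/2) j = G (1/2) (\<pi> j)" if "j \<in> {1..m + 1}" for j
  proof (cases "j \<le> m")
    case True
    then have "\<pi> j \<in> {1..m}" using \<pi>in that by simp
    then show ?thesis using True A0
      by (auto simp: F_def G_def \<pi>_def[symmetric] loop_in_def loop_x_def loop_y_def complex_eq_iff)
  next
    case False
    then have "j = m + 1" using that by simp
    then show ?thesis using \<pi>top
      by (simp add: F_def G_def loop_out_def loop_x_def loop_y_def)
  qed
  have F_half': "F (1/2) j = G' (1/2) (\<pi> j)" if "j \<in> {1..m}" for j
  proof -
    have "\<pi> j \<in> {1..m}" using \<pi>in that .
    then show ?thesis using that A0
      by (auto simp: F_def G'_def \<pi>_def[symmetric] loop_mid_def loop_in_def loop_x_def loop_y_def complex_eq_iff)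
  qed
  have cont_w: "continuous_on {0..1/2} (\<lambda>\<theta>. word_path w (2 * \<theta>) j)" for j
    by (rule continuous_on_compose2[OF continuous_on_word_path[of w j]]) (auto intro!: continuous_intros)
  have cont_F: "continuous_on {0..1/2} (\<lambda>\<theta>. F \<theta> j)" for j
    unfolding F_def A_def Complex_eq using cont_w[of j]
    by (cases "j \<le> m") (auto intro!: continuous_intros)
  have cont_P: "continuous_on {0..1} (\<lambda>\<theta>. P \<theta> j)" for j
    unfolding P_def
  proof (rule continuous_on_glue)
    show "continuous_on {1/2..1} (\<lambda>\<theta>. complex_of_real \<alpha> * letter_path ?l (2 * \<theta> - 1) (\<pi> j) + (- 1))"
      by (intro continuous_intros continuous_on_compose2[OF continuous_on_letter_path[of UNIV]]) auto
  qed (use cont_w[of j] in \<open>auto simp: \<pi>_def intro!: continuous_intros\<close>)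
  have cont_Q: "continuous_on {0..1} (\<lambda>\<theta>. Q \<theta> j)" if "j \<in> {1..m + 1}" for j
    unfolding Q_def
  proof (rule continuous_on_glue[where f = "\<lambda>\<theta>. F \<theta> j" and g = "\<lambda>\<theta>. G \<theta> (\<pi> j)", OF cont_F _ F_half[OF that]])
    show "continuous_on {1/2..1} (\<lambda>\<theta>. G \<theta> (\<pi> j))"
      unfolding G_def by (cases "\<pi> j < m"; cases "\<pi> j = m") (simp_all add: continuous_on_loop)
  qed
  have cont_Q': "continuous_on {0..1} (\<lambda>\<theta>. Q' \<theta> j)" if "j \<in> {1..m}" for j
    unfolding Q'_def
  proof (rule continuous_on_glue[where f = "\<lambda>\<theta>. F \<theta> j" and g = "\<lambda>\<theta>. G' \<theta> (\<pi> j)", OF cont_F _ F_half'[OF that]])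
    show "continuous_on {1/2..1} (\<lambda>\<theta>. G' \<theta> (\<pi> j))"
      unfolding G'_def by (cases "\<pi> j < m") (simp_all add: continuous_on_loop_mid)
  qed
  have ends_P: "P 1 j = P 0 (\<sigma> j)" if "j \<in> {1..m + 1}" for j
    by (simp add: P_def \<sigma>eq)
  have ends_Q: "Q 1 j = Q 0 (\<sigma> j)" if j: "j \<in> {1..m + 1}" for j
  proof -
    consider "\<pi> j < m" | "\<pi> j = m" | "\<pi> j = m + 1" using \<pi>in'[OF j] by fastforce
    then show ?thesis
      by cases (auto simp: Q_def \<sigma>eq letter_swap_def Transposition.transpose_def F_def G_def A0
          loop_in_def loop_out_def loop_x_def loop_y_def complex_eq_iff)
  qed
  have ends_Q': "Q' 1 j = Q' 0 (\<pi> j)" if "j \<in> {1..m}" for j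
    using \<pi>in[OF that]
    by (cases "\<pi> j = m") (auto simp: Q'_def F_def G'_def A0 loop_mid_def loop_out_def loop_x_def loop_y_def complex_eq_iff)
  have A_ne: "complex_of_real (1 - t) * (complex_of_real \<alpha> * z + (- 1)) + complex_of_real t * A z \<noteq>
      complex_of_real (1 - t) * (complex_of_real \<alpha> * z' + (- 1)) + complex_of_real t * A z'"
    if "z \<noteq> z'" "t \<in> {0..1}" for t z z'
  proof -
    have "complex_of_real (1 - t) * (complex_of_real \<alpha> * z + (- 1)) + complex_of_real t * A z -
      (complex_of_real (1 - t) * (complex_of_real \<alpha> * z' + (- 1)) + complex_of_real t * A z') =
      complex_of_real ((1 - t) * \<alpha> + t * (\<alpha> / 2)) * (z - z')"
      by (simp add: A_def field_simps)
    moreover have "(1 - t) * \<alpha> + t * (\<alpha> / 2) = \<alpha> * (1 - t / 2)" by (simp add: algebra_simps)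
    moreover have "\<alpha> * (1 - t / 2) \<noteq> 0" using \<alpha> that by simp
    ultimately show ?thesis using that(1) by (metis mult_eq_0_iff of_real_eq_0_iff right_minus_eq)
  qed
  have Re_ne: "complex_of_real (1 - t) * a + complex_of_real t * b \<noteq> complex_of_real (1 - t) * a' + complex_of_real t * b'"
    if "t \<in> {0..1}" "Re a < Re a'" "Re b < Re b'" for t a b a' b'
  proof -
    have "(1 - t) * (Re a' - Re a) + t * (Re b' - Re b) > 0"
    proof (cases "t = 0")
      case False
      then have "t * (Re b' - Re b) > 0" "(1 - t) * (Re a' - Re a) \<ge> 0" using that by auto
      then show ?thesis by linarith
    qed (use that in auto)
    then have "Re (complex_of_real (1 - t) * a + complex_of_real t * b) \<noteq> Re (complex_of_real (1 - t) * a' + complex_of_real t * b')"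
      by (simp add: algebra_simps)
    then show ?thesis by metis
  qed
  \<comment> \<open>The straight motion from \<open>P\<close> to \<open>Q\<close> has no collisions.
    During \<open>w\<close> the first \<open>m\<close> strands are merely rescaled and the top
    strand keeps the largest real part. During the last letter real parts separate all pairs except
    the two strands that cross, and these are separated by their imaginary parts.\<close>
  have ne: "complex_of_real (1 - t) * P \<theta> i + complex_of_real t * Q \<theta> i \<noteq>
      complex_of_real (1 - t) * P \<theta> j + complex_of_real t * Q \<theta> j"
    if t: "t \<in> {0..1}" and \<theta>: "\<theta> \<in> {0..1}" and ij: "i \<in> {1..m + 1}" "j \<in> {1..m + 1}" "i \<noteq> j" for t \<theta> i j
  proof (cases "\<theta> \<le> 1/2")
    case True
    have wne: "word_path w (2 * \<theta>) i \<noteq> word_path w (2 * \<theta>) j"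
      using word_path_Conf[of "2 * \<theta>" w] True \<theta> ij(3) by (auto simp: Conf_def dest: injD)
    have top: "complex_of_real (1 - t) * P \<theta> i + complex_of_real t * Q \<theta> i \<noteq>
      complex_of_real (1 - t) * P \<theta> (m + 1) + complex_of_real t * Q \<theta> (m + 1)" if "i \<in> {1..m}" for i
    proof (rule Re_ne[OF t])
      have R: "Re (word_path w (2 * \<theta>) i) \<le> real m"
        using Re_word_path_le[OF w that, of "2 * \<theta>"] True \<theta> by simp
      then have "\<alpha> * Re (word_path w (2 * \<theta>) i) < \<alpha> * real (m + 1)"
        using \<alpha> by (intro mult_strict_left_mono) auto
      then show "Re (P \<theta> i) < Re (P \<theta> (m + 1))"
        using True by (simp add: P_def word_path_fixed[OF w])
      have "\<alpha> / 2 * (Re (word_path w (2 * \<theta>) i) - real m) \<le> 0"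
        using \<alpha> R by (intro mult_nonneg_nonpos) auto
      then show "Re (Q \<theta> i) < Re (Q \<theta> (m + 1))"
        using True that by (simp add: Q_def F_def ReA)
    qed
    consider "i \<in> {1..m}" "j \<in> {1..m}" | "i \<in> {1..m}" "j = m + 1" | "i = m + 1" "j \<in> {1..m}"
      using ij by fastforce
    then show ?thesis
    proof cases
      case 1
      then show ?thesis using A_ne[OF wne t] True by (simp add: P_def Q_def F_def)
    next
      case 2
      then show ?thesis using top[OF 2(1)] by simp
    next
      case 3
      then show ?thesis using top[OF 3(2)] by metis
    qed
  next
    case False
    define s where "s = 2 * \<theta> - 1"
    have s: "s \<in> {0..1}" using False \<theta> by (auto simp: s_def)
    have Pk: "P \<theta> i = complex_of_real \<alpha> * letter_path ?l s (\<pi> i) + (- 1)" for i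
      using False by (simp add: P_def s_def)
    have Qk: "Q \<theta> i = (if \<pi> i < m then A (of_nat (\<pi> i)) else if \<pi> i = m then loop_in \<epsilon> s else loop_out \<epsilon> s)" for i
      using False by (simp add: Q_def G_def s_def)
    have main: "complex_of_real (1 - t) * P \<theta> i + complex_of_real t * Q \<theta> i \<noteq>
      complex_of_real (1 - t) * P \<theta> j + complex_of_real t * Q \<theta> j"
      if ij: "i \<in> {1..m + 1}" "j \<in> {1..m + 1}" "\<pi> i < \<pi> j" for i j
    proof (cases "\<pi> i < m")
      case True
      have Rj: "real (min (\<pi> j) m) \<le> Re (letter_path ?l s (\<pi> j))"
      proof -
        have "cos (pi * s) \<le> 1" "-1 \<le> cos (pi * s)" by auto
        then have "0 \<le> (1 - cos (pi * s)) / 2" "(1 - cos (pi * s)) / 2 \<le> 1" by auto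
        then show ?thesis unfolding Re_letter_path by (auto simp: min_def)
      qed
      have Ri: "Re (letter_path ?l s (\<pi> i)) = real (\<pi> i)" using True by (simp add: Re_letter_path)
      have "real (\<pi> i) < real (min (\<pi> j) m)" using True ij(3) by simp
      then have "\<alpha> * Re (letter_path ?l s (\<pi> i)) < \<alpha> * Re (letter_path ?l s (\<pi> j))"
        using \<alpha> Rj Ri by (intro mult_strict_left_mono) auto
      then have 1: "Re (P \<theta> i) < Re (P \<theta> j)" by (simp add: Pk)
      have neg: "\<alpha> / 2 * (real (\<pi> i) - real m) < 0" using \<alpha> True by (intro mult_pos_neg) auto
      have 2: "Re (Q \<theta> i) < Re (Q \<theta> j)"
      proof (cases "\<pi> j < m")
        case True
        have "\<alpha> / 2 * (real (\<pi> i) - real m) < \<alpha> / 2 * (real (\<pi> j) - real m)"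
          using \<alpha> ij(3) by (intro mult_strict_left_mono) auto
        then show ?thesis using True ij(3) by (simp add: Qk ReA)
      next
        case False
        then have "0 \<le> Re (Q \<theta> j)" using loop_x_bounds by (simp add: Qk loop_in_def loop_out_def)
        then show ?thesis using neg True by (simp add: Qk ReA)
      qed
      show ?thesis by (rule Re_ne[OF t 1 2])
    next
      case False
      then have pij: "\<pi> i = m" "\<pi> j = m + 1" using ij \<pi>in'[OF ij(2)] by auto
      show ?thesis
      \<comment> \<open>The imaginary parts in \<open>P\<close> coincide at the ends of the letter,
        so they separate the two strands only together with a positive share of \<open>Q\<close>.
        For \<open>t = 0\<close> the half turn is injective by itself.\<close>
      proof (cases "t = 0")
        case True
        have "letter_path ?l s (\<pi> i) \<noteq> letter_path ?l s (\<pi> j)"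
          using letter_path_Conf[OF s, of ?l] pij by (auto simp: Conf_def dest: injD)
        then show ?thesis using True \<alpha> by (simp add: Pk)
      next
        case False
        have "0 \<le> sin (pi * s)" using s by (intro sin_ge_zero) (auto simp: mult_left_le)
        then have p: "0 \<le> (1 - t) * (\<alpha> * sin (pi * s))" using t \<alpha> by simp
        have "0 < loop_y s + loop_y (1 - s)"
        proof (cases "s = 0")
          case False
          then have "0 < loop_y s" "0 \<le> loop_y (1 - s)"
            using s loop_y_pos[of s] loop_y_bounds(1)[of "1 - s"] by auto
          then show ?thesis by simp
        next
          case True
          then show ?thesis using loop_y_pos[of 1] loop_y_bounds(1)[of 0] by simp
        qed
        then have q: "0 < t * (loop_y s + loop_y (1 - s))" using False t by simp
        have "\<epsilon> * (Im (complex_of_real (1 - t) * P \<theta> i + complex_of_real t * Q \<theta> i) -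
          Im (complex_of_real (1 - t) * P \<theta> j + complex_of_real t * Q \<theta> j)) =
          (1 - t) * (\<alpha> * sin (pi * s)) + t * (loop_y s + loop_y (1 - s))"
          using pij by (auto simp: Pk Qk Im_letter_path loop_in_def loop_out_def \<epsilon>_def algebra_simps)
        then have "\<epsilon> * (Im (complex_of_real (1 - t) * P \<theta> i + complex_of_real t * Q \<theta> i) -
          Im (complex_of_real (1 - t) * P \<theta> j + complex_of_real t * Q \<theta> j)) \<noteq> 0"
          using p q by linarith
        then show ?thesis by (metis cancel_comm_monoid_add_class.diff_cancel mult_zero_right)
      qed
    qed
    have "\<pi> i < \<pi> j \<or> \<pi> j < \<pi> i" using \<pi>inj[OF ij(3)] by linarith
    then show ?thesis using main[OF ij(1,2)] main[OF ij(2,1)] by metis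
  qed
  have step1: "ambient_isotopic (braid_closure (m + 1) (w @ [?l])) (config_closure (m + 1) P)"
  proof -
    let ?p = "word_path w +++ (\<lambda>\<theta> j. letter_path ?l \<theta> (\<pi> j))"
    have P: "P = (\<lambda>\<theta> j. complex_of_real \<alpha> * ?p \<theta> j + (- 1))"
      by (auto simp: P_def joinpaths_def fun_eq_iff)
    have "homotopic_paths Conf (word_path (w @ [?l])) (word_path w +++ (\<lambda>\<theta> j. word_path [?l] \<theta> (\<pi> j)))"
      unfolding \<pi>_def by (rule word_path_append)
    also have "homotopic_paths Conf \<dots> ?p"
      unfolding \<pi>_def
      by (rule homotopic_paths_join[OF _ homotopic_paths_relabel[OF path_word_letter inj_word_pos]])
        (simp_all add: path_word_path path_image_word_path pathstart_def joinpaths_def)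
    finally have h: "homotopic_paths Conf (word_path (w @ [?l])) ?p" .
    have "ambient_isotopic (config_closure (m + 1) (word_config (m + 1) (w @ [?l]))) (config_closure (m + 1) P)"
      unfolding word_config_def[abs_def] P
      by (rule homotopic_config_isotopy[OF h \<sigma>])
        (use word_config_disc[OF wl] disc_P[unfolded P] in \<open>auto simp: word_config_def \<alpha>_def \<sigma>_def\<close>)
    then show ?thesis using braid_closure_config(1)[OF wl] ambient_isotopic_trans by blast
  qed
  have step2: "ambient_isotopic (config_closure (m + 1) P) (config_closure (m + 1) Q)"
    by (rule config_linear_isotopy[where P = P and Q = Q and \<sigma> = \<sigma>, OF cont_P cont_Q disc_P disc_Q \<sigma> ends_P ends_Q ne])
  \<comment> \<open>The height on the segment at the angle \<psi>, measured in turns from 2/3 to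
    11/6. Up to 1 this part of the loop belongs to the outgoing strand, for the next half turn to
    the top strand, and from 3/2 on to the returning strand.\<close>
  define yy where "yy \<psi> = 1/5 * (1 - 12/7 * (\<psi> - 2/3))" for \<psi> :: real
  define S1 where "S1 = {solid_torus_point (F \<theta> j) (2 * pi * \<theta>) | \<theta> j. 0 \<le> \<theta> \<and> \<theta> \<le> 1/2 \<and> j \<in> {1..m}}"
  define S2 where "S2 = {solid_torus_point (A (of_nat k)) (2 * pi * \<theta>) | \<theta> k. 1/2 \<le> \<theta> \<and> \<theta> \<le> 1 \<and> k \<in> {1..<m}}"
  define S3' where "S3' = {solid_torus_point (loop_in \<epsilon> (2 * \<theta> - 1)) (2 * pi * \<theta>) | \<theta>. 1/2 \<le> \<theta> \<and> \<theta> \<le> 2/3}"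
  define S4 where "S4 = {solid_torus_point (loop_out \<epsilon> (2 * \<theta> - 1)) (2 * pi * \<theta>) | \<theta>. 5/6 \<le> \<theta> \<and> \<theta> \<le> 1}"
  \<comment> \<open>The common part of \<open>Q\<close> and \<open>Q'\<close>, which the push must
    leave alone while it replaces \<open>M0\<close> by \<open>M1\<close>.\<close>
  define S where "S = S1 \<union> S2 \<union> S3' \<union> S4"
  define M0 where "M0 = {solid_torus_point (Complex (24/25) (\<epsilon> * yy \<psi>)) (2 * pi * \<psi>) | \<psi>. 2/3 \<le> \<psi> \<and> \<psi> \<le> 11/6}"
  define M1 where "M1 = {solid_torus_point (Complex (24/25) (\<epsilon> * (1/5 * (3 - 6 * (2 * \<psi> - 1))))) (2 * pi * \<psi>) | \<psi>. 2/3 \<le> \<psi> \<and> \<psi> \<le> 5/6}"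
  have M0: "(\<lambda>y. solid_torus_point (Complex (24/25) (\<epsilon> * y)) (2 * pi * (2/3 + 7/12 * (1 - 5 * y)))) ` {-1/5..1/5} = M0"
  proof (intro equalityI subsetI)
    fix x assume "x \<in> M0"
    then obtain \<psi> where x: "x = solid_torus_point (Complex (24/25) (\<epsilon> * yy \<psi>)) (2 * pi * \<psi>)" "2/3 \<le> \<psi>" "\<psi> \<le> 11/6"
      unfolding M0_def by blast
    have "2/3 + 7/12 * (1 - 5 * yy \<psi>) = \<psi>" by (simp add: yy_def field_simps)
    then show "x \<in> (\<lambda>y. solid_torus_point (Complex (24/25) (\<epsilon> * y)) (2 * pi * (2/3 + 7/12 * (1 - 5 * y)))) ` {-1/5..1/5}"
      using x by (intro image_eqI[of _ _ "yy \<psi>"]) (auto simp: yy_def)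
  next
    fix x assume "x \<in> (\<lambda>y. solid_torus_point (Complex (24/25) (\<epsilon> * y)) (2 * pi * (2/3 + 7/12 * (1 - 5 * y)))) ` {-1/5..1/5}"
    then obtain y where x: "x = solid_torus_point (Complex (24/25) (\<epsilon> * y)) (2 * pi * (2/3 + 7/12 * (1 - 5 * y)))" "y \<in> {-1/5..1/5}"
      by blast
    have "yy (2/3 + 7/12 * (1 - 5 * y)) = y" by (simp add: yy_def field_simps)
    then show "x \<in> M0"
      unfolding M0_def using x by (intro CollectI exI[of _ "2/3 + 7/12 * (1 - 5 * y)"]) auto
  qed
  have M1: "(\<lambda>y. solid_torus_point (Complex (24/25) (\<epsilon> * y)) (2 * pi * (2/3 + 1/12 * (1 - 5 * y)))) ` {-1/5..1/5} = M1"
  proof (intro equalityI subsetI)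
    fix x assume "x \<in> M1"
    then obtain \<psi> where x: "x = solid_torus_point (Complex (24/25) (\<epsilon> * (1/5 * (3 - 6 * (2 * \<psi> - 1))))) (2 * pi * \<psi>)" "2/3 \<le> \<psi>" "\<psi> \<le> 5/6"
      unfolding M1_def by blast
    have "2/3 + 1/12 * (1 - 5 * (1/5 * (3 - 6 * (2 * \<psi> - 1)))) = \<psi>" by (simp add: field_simps)
    then show "x \<in> (\<lambda>y. solid_torus_point (Complex (24/25) (\<epsilon> * y)) (2 * pi * (2/3 + 1/12 * (1 - 5 * y)))) ` {-1/5..1/5}"
      using x by (intro image_eqI[of _ _ "1/5 * (3 - 6 * (2 * \<psi> - 1))"]) auto
  next
    fix x assume "x \<in> (\<lambda>y. solid_torus_point (Complex (24/25) (\<epsilon> * y)) (2 * pi * (2/3 + 1/12 * (1 - 5 * y)))) ` {-1/5..1/5}"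
    then obtain y where x: "x = solid_torus_point (Complex (24/25) (\<epsilon> * y)) (2 * pi * (2/3 + 1/12 * (1 - 5 * y)))" "y \<in> {-1/5..1/5}"
      by blast
    have "1/5 * (3 - 6 * (2 * (2/3 + 1/12 * (1 - 5 * y)) - 1)) = y" by (simp add: field_simps)
    then show "x \<in> M1"
      unfolding M1_def using x by (intro CollectI exI[of _ "2/3 + 1/12 * (1 - 5 * y)"]) auto
  qed
  have period: "solid_torus_point z (2 * pi * (\<theta> + 1)) = solid_torus_point z (2 * pi * \<theta>)" for z \<theta>
    by (simp add: solid_torus_point_def distrib_left cis_mult[symmetric])
  have F_top: "F \<theta> (Suc m) = Complex (24/25) (\<epsilon> * yy (\<theta> + 1))" for \<theta>
    by (simp add: F_def yy_def field_simps)
  have in_mid: "loop_in \<epsilon> (2 * \<theta> - 1) = Complex (24/25) (\<epsilon> * yy \<theta>)" if "2/3 \<le> \<theta>" for \<theta>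
  proof -
    have s: "1/3 \<le> 2 * \<theta> - 1" using that by simp
    have "loop_y (2 * \<theta> - 1) = yy \<theta>" unfolding loop_values(4)[OF s] yy_def by (simp add: field_simps)
    then show ?thesis by (simp only: loop_in_def loop_values(2)[OF s])
  qed
  have out_mid: "loop_out \<epsilon> (2 * \<theta> - 1) = Complex (24/25) (\<epsilon> * yy (\<theta> + 1))" if "\<theta> \<le> 5/6" for \<theta>
  proof -
    have s: "1/3 \<le> 1 - (2 * \<theta> - 1)" using that by simp
    have "loop_y (1 - (2 * \<theta> - 1)) = - yy (\<theta> + 1)" unfolding loop_values(4)[OF s] yy_def by (simp add: field_simps)
    then show ?thesis by (simp only: loop_out_def loop_values(2)[OF s] minus_mult_minus)
  qed
  have k_cases: "k \<in> {1..<m} \<or> k = m \<or> k = m + 1" if "k \<in> {1..m + 1}" for k using that by auto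
  have Q_halves: "config_closure (m + 1) Q = {solid_torus_point (F \<theta> j) (2 * pi * \<theta>) |\<theta> j. 0 \<le> \<theta> \<and> \<theta> \<le> 1/2 \<and> j \<in> {1..m + 1}} \<union>
       {solid_torus_point (G \<theta> k) (2 * pi * \<theta>) |\<theta> k. 1/2 \<le> \<theta> \<and> \<theta> \<le> 1 \<and> k \<in> {1..m + 1}}"
    unfolding Q_def[abs_def] by (rule config_closure_halves[where f = F and g = G, OF \<pi> F_half])
  have Q_set: "config_closure (m + 1) Q = S \<union> M0"
    unfolding Q_halves
  proof (intro equalityI subsetI)
    fix x assume "x \<in> {solid_torus_point (F \<theta> j) (2 * pi * \<theta>) |\<theta> j. 0 \<le> \<theta> \<and> \<theta> \<le> 1/2 \<and> j \<in> {1..m + 1}} \<union>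
       {solid_torus_point (G \<theta> k) (2 * pi * \<theta>) |\<theta> k. 1/2 \<le> \<theta> \<and> \<theta> \<le> 1 \<and> k \<in> {1..m + 1}}"
    then consider (F) \<theta> j where "x = solid_torus_point (F \<theta> j) (2 * pi * \<theta>)" "0 \<le> \<theta>" "\<theta> \<le> 1/2" "j \<in> {1..m + 1}"
      | (G) \<theta> k where "x = solid_torus_point (G \<theta> k) (2 * pi * \<theta>)" "1/2 \<le> \<theta>" "\<theta> \<le> 1" "k \<in> {1..m + 1}"
      by blast
    then show "x \<in> S \<union> M0"
    proof cases
      case F
      show ?thesis
      proof (cases "j \<le> m")
        case True
        then have "x \<in> S1" unfolding S1_def using F by auto
        then show ?thesis by (simp add: S_def)
      next
        case False
        then have "j = m + 1" using F by simp
        then have "x \<in> M0"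
          unfolding M0_def using F(1-3) by (intro CollectI exI[of _ "\<theta> + 1"]) (simp add: F_top period)
        then show ?thesis ..
      qed
    next
      case G
      from k_cases[OF G(4)] consider "k \<in> {1..<m}" | "k = m" | "k = m + 1" by blast
      then show ?thesis
      proof cases
        case 1
        then have "x \<in> S2" unfolding S2_def using G by (auto simp: G_def)
        then show ?thesis by (simp add: S_def)
      next
        case 2
        then have x: "x = solid_torus_point (loop_in \<epsilon> (2 * \<theta> - 1)) (2 * pi * \<theta>)" using G by (simp add: G_def)
        show ?thesis
        proof (cases "\<theta> \<le> 2/3")
          case True
          then have "x \<in> S3'" unfolding S3'_def using G x by blast
          then show ?thesis by (simp add: S_def)
        next
          case False
          then have "x \<in> M0" unfolding M0_def using G(2,3) x in_mid[of \<theta>] by (intro CollectI exI[of _ \<theta>]) simp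
          then show ?thesis ..
        qed
      next
        case 3
        then have x: "x = solid_torus_point (loop_out \<epsilon> (2 * \<theta> - 1)) (2 * pi * \<theta>)" using G by (simp add: G_def)
        show ?thesis
        proof (cases "5/6 \<le> \<theta>")
          case True
          then have "x \<in> S4" unfolding S4_def using G x by blast
          then show ?thesis by (simp add: S_def)
        next
          case False
          then have "x \<in> M0" unfolding M0_def using G(2,3) x out_mid[of \<theta>]
            by (intro CollectI exI[of _ "\<theta> + 1"]) (simp add: period)
          then show ?thesis ..
        qed
      qed
    qed
  next
    fix x assume "x \<in> S \<union> M0"
    then consider "x \<in> S1" | "x \<in> S2" | "x \<in> S3'" | "x \<in> S4" | "x \<in> M0" unfolding S_def by blast
    then show "x \<in> {solid_torus_point (F \<theta> j) (2 * pi * \<theta>) |\<theta> j. 0 \<le> \<theta> \<and> \<theta> \<le> 1/2 \<and> j \<in> {1..m + 1}} \<union>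
       {solid_torus_point (G \<theta> k) (2 * pi * \<theta>) |\<theta> k. 1/2 \<le> \<theta> \<and> \<theta> \<le> 1 \<and> k \<in> {1..m + 1}}" (is "_ \<in> ?F \<union> ?G")
    proof cases
      case 1
      then have "x \<in> ?F" unfolding S1_def by force
      then show ?thesis ..
    next
      case 2
      then obtain \<theta> k where "x = solid_torus_point (A (of_nat k)) (2 * pi * \<theta>)" "1/2 \<le> \<theta>" "\<theta> \<le> 1" "k \<in> {1..<m}"
        unfolding S2_def by blast
      then have "x \<in> ?G" by (intro CollectI exI[of _ \<theta>] exI[of _ k]) (auto simp: G_def)
      then show ?thesis ..
    next
      case 3
      then obtain \<theta> where "x = solid_torus_point (loop_in \<epsilon> (2 * \<theta> - 1)) (2 * pi * \<theta>)" "1/2 \<le> \<theta>" "\<theta> \<le> 2/3"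
        unfolding S3'_def by blast
      then have "x \<in> ?G" using m by (intro CollectI exI[of _ \<theta>] exI[of _ m]) (auto simp: G_def)
      then show ?thesis ..
    next
      case 4
      then obtain \<theta> where "x = solid_torus_point (loop_out \<epsilon> (2 * \<theta> - 1)) (2 * pi * \<theta>)" "5/6 \<le> \<theta>" "\<theta> \<le> 1"
        unfolding S4_def by blast
      then have "x \<in> ?G" by (intro CollectI exI[of _ \<theta>] exI[of _ "m + 1"]) (auto simp: G_def)
      then show ?thesis ..
    next
      case 5
      then obtain \<psi> where x: "x = solid_torus_point (Complex (24/25) (\<epsilon> * yy \<psi>)) (2 * pi * \<psi>)" "2/3 \<le> \<psi>" "\<psi> \<le> 11/6"
        unfolding M0_def by blast
      consider "\<psi> \<le> 1" | "1 \<le> \<psi>" "\<psi> \<le> 3/2" | "3/2 \<le> \<psi>" by linarith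
      then show ?thesis
      proof cases
        case 1
        then have "x \<in> ?G" using x m in_mid[of \<psi>] by (intro CollectI exI[of _ \<psi>] exI[of _ m]) (auto simp: G_def)
        then show ?thesis ..
      next
        case 2
        then have "x \<in> ?F" using x period[of _ "\<psi> - 1"] F_top[of "\<psi> - 1"]
          by (intro CollectI exI[of _ "\<psi> - 1"] exI[of _ "m + 1"]) auto
        then show ?thesis ..
      next
        case 3
        then have "x \<in> ?G" using x period[of _ "\<psi> - 1"] out_mid[of "\<psi> - 1"]
          by (intro CollectI exI[of _ "\<psi> - 1"] exI[of _ "m + 1"]) (auto simp: G_def)
        then show ?thesis ..
      qed
    qed
  qed
  have mid_in: "loop_mid \<epsilon> (2 * \<theta> - 1) = loop_in \<epsilon> (2 * \<theta> - 1)" if "\<theta> \<le> 2/3" for \<theta>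
    using that by (simp add: loop_mid_def)
  have mid_mid: "loop_mid \<epsilon> (2 * \<theta> - 1) = Complex (24/25) (\<epsilon> * (1/5 * (3 - 6 * (2 * \<theta> - 1))))" if "2/3 \<le> \<theta>" "\<theta> \<le> 5/6" for \<theta>
  proof (cases "\<theta> = 2/3")
    case True
    show ?thesis unfolding True by (simp add: loop_mid_def loop_in_def loop_x_def loop_y_def)
  qed (use that in \<open>simp add: loop_mid_def\<close>)
  have mid_out: "loop_mid \<epsilon> (2 * \<theta> - 1) = loop_out \<epsilon> (2 * \<theta> - 1)" if "5/6 \<le> \<theta>" for \<theta>
  proof (cases "\<theta> = 5/6")
    case True
    show ?thesis unfolding True by (simp add: loop_mid_def loop_out_def loop_x_def loop_y_def)
  qed (use that in \<open>simp add: loop_mid_def\<close>)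
  have Q'_halves: "config_closure m Q' = {solid_torus_point (F \<theta> j) (2 * pi * \<theta>) |\<theta> j. 0 \<le> \<theta> \<and> \<theta> \<le> 1/2 \<and> j \<in> {1..m}} \<union>
       {solid_torus_point (G' \<theta> k) (2 * pi * \<theta>) |\<theta> k. 1/2 \<le> \<theta> \<and> \<theta> \<le> 1 \<and> k \<in> {1..m}}"
    unfolding Q'_def[abs_def] by (rule config_closure_halves[where f = F and g = G', OF \<pi>m F_half'])
  have Q'_set: "config_closure m Q' = S \<union> M1"
    unfolding Q'_halves
  proof (intro equalityI subsetI)
    fix x assume "x \<in> {solid_torus_point (F \<theta> j) (2 * pi * \<theta>) |\<theta> j. 0 \<le> \<theta> \<and> \<theta> \<le> 1/2 \<and> j \<in> {1..m}} \<union>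
       {solid_torus_point (G' \<theta> k) (2 * pi * \<theta>) |\<theta> k. 1/2 \<le> \<theta> \<and> \<theta> \<le> 1 \<and> k \<in> {1..m}}"
    then consider (F) "x \<in> S1"
      | (G) \<theta> k where "x = solid_torus_point (G' \<theta> k) (2 * pi * \<theta>)" "1/2 \<le> \<theta>" "\<theta> \<le> 1" "k \<in> {1..m}"
      unfolding S1_def by blast
    then show "x \<in> S \<union> M1"
    proof cases
      case G
      show ?thesis
      proof (cases "k < m")
        case True
        then have "x \<in> S2" unfolding S2_def using G by (auto simp: G'_def)
        then show ?thesis by (simp add: S_def)
      next
        case False
        then have x: "x = solid_torus_point (loop_mid \<epsilon> (2 * \<theta> - 1)) (2 * pi * \<theta>)" using G by (simp add: G'_def)
        consider "\<theta> \<le> 2/3" | "2/3 \<le> \<theta>" "\<theta> \<le> 5/6" | "5/6 \<le> \<theta>" by linarith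
        then show ?thesis
        proof cases
          case 1
          then have "x \<in> S3'" unfolding S3'_def using G(2,3) x mid_in[of \<theta>] by (intro CollectI exI[of _ \<theta>]) simp
          then show ?thesis by (simp add: S_def)
        next
          case 2
          then have "x \<in> M1" unfolding M1_def using x mid_mid[of \<theta>] by (intro CollectI exI[of _ \<theta>]) simp
          then show ?thesis ..
        next
          case 3
          then have "x \<in> S4" unfolding S4_def using G(2,3) x mid_out[of \<theta>] by (intro CollectI exI[of _ \<theta>]) simp
          then show ?thesis by (simp add: S_def)
        qed
      qed
    qed (simp add: S_def)
  next
    fix x assume "x \<in> S \<union> M1"
    then consider "x \<in> S1" | "x \<in> S2" | "x \<in> S3'" | "x \<in> S4" | "x \<in> M1" unfolding S_def by blast
    then show "x \<in> {solid_torus_point (F \<theta> j) (2 * pi * \<theta>) |\<theta> j. 0 \<le> \<theta> \<and> \<theta> \<le> 1/2 \<and> j \<in> {1..m}} \<union>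
       {solid_torus_point (G' \<theta> k) (2 * pi * \<theta>) |\<theta> k. 1/2 \<le> \<theta> \<and> \<theta> \<le> 1 \<and> k \<in> {1..m}}" (is "_ \<in> ?F \<union> ?G")
    proof cases
      case 1
      then show ?thesis unfolding S1_def ..
    next
      case 2
      then obtain \<theta> k where "x = solid_torus_point (A (of_nat k)) (2 * pi * \<theta>)" "1/2 \<le> \<theta>" "\<theta> \<le> 1" "k \<in> {1..<m}"
        unfolding S2_def by blast
      then have "x \<in> ?G" by (intro CollectI exI[of _ \<theta>] exI[of _ k]) (auto simp: G'_def)
      then show ?thesis ..
    next
      case 3
      then obtain \<theta> where "x = solid_torus_point (loop_in \<epsilon> (2 * \<theta> - 1)) (2 * pi * \<theta>)" "1/2 \<le> \<theta>" "\<theta> \<le> 2/3"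
        unfolding S3'_def by blast
      then have "x \<in> ?G" using m mid_in[of \<theta>] by (intro CollectI exI[of _ \<theta>] exI[of _ m]) (auto simp: G'_def)
      then show ?thesis ..
    next
      case 4
      then obtain \<theta> where "x = solid_torus_point (loop_out \<epsilon> (2 * \<theta> - 1)) (2 * pi * \<theta>)" "5/6 \<le> \<theta>" "\<theta> \<le> 1"
        unfolding S4_def by blast
      then have "x \<in> ?G" using m mid_out[of \<theta>] by (intro CollectI exI[of _ \<theta>] exI[of _ m]) (auto simp: G'_def)
      then show ?thesis ..
    next
      case 5
      then obtain \<psi> where "x = solid_torus_point (Complex (24/25) (\<epsilon> * (1/5 * (3 - 6 * (2 * \<psi> - 1))))) (2 * pi * \<psi>)" "2/3 \<le> \<psi>" "\<psi> \<le> 5/6"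
        unfolding M1_def by blast
      then have "x \<in> ?G" using m mid_mid[of \<psi>] by (intro CollectI exI[of _ \<psi>] exI[of _ m]) (auto simp: G'_def)
      then show ?thesis ..
    qed
  qed
  have S_S3: "S \<subseteq> S3"
  proof -
    have "S \<subseteq> config_closure m Q'" by (simp add: Q'_set)
    also have "\<dots> \<subseteq> S3" by (rule config_closure_subset, rule less_imp_le, rule disc_Q')
    finally show ?thesis .
  qed
  \<comment> \<open>The first \<open>m\<close> strands stay in \<open>Re z \<le> 0\<close>, and the
    ends of the loop leave \<open>Re z = 0\<close> only after reaching height 1/5. This is why
    \<open>loop_x\<close> waits until \<open>loop_y\<close> has risen.\<close>
  have S_side: "Re (fst x) \<le> 0 \<or> 1/5 \<le> \<bar>Im (fst x)\<bar>" if "x \<in> S" for x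
  proof -
    have stp: "fst (solid_torus_point z \<phi>) = z" for z \<phi> by (simp add: solid_torus_point_def)
    have A_neg: "Re (A z) \<le> 0" if "Re z \<le> real m" for z
      unfolding ReA using \<alpha> that by (intro mult_nonneg_nonpos) auto
    have loop: "loop_x s = 0 \<or> loop_y s = 1/5" if "s \<le> 1/3" for s
      using loop_values(1)[of s] loop_values(3)[of s] that by linarith
    from that consider "x \<in> S1" | "x \<in> S2" | "x \<in> S3'" | "x \<in> S4" unfolding S_def by blast
    then show ?thesis
    proof cases
      case 1
      then obtain \<theta> j where x: "x = solid_torus_point (F \<theta> j) (2 * pi * \<theta>)" "0 \<le> \<theta>" "\<theta> \<le> 1/2" "j \<in> {1..m}"
        unfolding S1_def by blast
      have "Re (word_path w (2 * \<theta>) j) \<le> real m" using Re_word_path_le[OF w x(4), of "2 * \<theta>"] x by simp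
      then show ?thesis using x A_neg by (simp add: stp F_def)
    next
      case 2
      then obtain \<theta> k where "x = solid_torus_point (A (of_nat k)) (2 * pi * \<theta>)" "k \<in> {1..<m}"
        unfolding S2_def by blast
      then show ?thesis using A_neg by (simp add: stp)
    next
      case 3
      then obtain \<theta> where x: "x = solid_torus_point (loop_in \<epsilon> (2 * \<theta> - 1)) (2 * pi * \<theta>)" "\<theta> \<le> 2/3"
        unfolding S3'_def by blast
      then show ?thesis using loop[of "2 * \<theta> - 1"] \<epsilon> by (auto simp: stp loop_in_def)
    next
      case 4
      then obtain \<theta> where x: "x = solid_torus_point (loop_out \<epsilon> (2 * \<theta> - 1)) (2 * pi * \<theta>)" "5/6 \<le> \<theta>"
        unfolding S4_def by blast
      then show ?thesis using loop[of "1 - (2 * \<theta> - 1)"] \<epsilon> by (auto simp: stp loop_out_def)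
    qed
  qed
  have step3: "ambient_isotopic (config_closure (m + 1) Q) (config_closure m Q')"
    using unwind_loop[OF \<epsilon> S_S3 S_side] by (simp only: M0 M1 Q_set Q'_set)
  \<comment> \<open>\<open>q\<close> is \<open>w\<close> followed by rest. The arc that remains of
    the loop can be retracted linearly to the origin: it stays in \<open>Re z \<ge> 0\<close>, while
    the other strands have negative real parts.\<close>
  define q where "q = word_path w +++ (\<lambda>\<theta> j. word_path [] \<theta> (\<pi> j))"
  have Aq: "A (q \<theta> j) = (if \<theta> \<le> 1/2 then A (word_path w (2 * \<theta>) j) else A (of_nat (\<pi> j)))" for \<theta> j
    by (simp add: q_def joinpaths_def)
  have disc_Aq: "cmod (A (q \<theta> j)) < 1" if "\<theta> \<in> {0..1}" "j \<in> {1..m}" for \<theta> j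
    unfolding Aq using A_disc[OF disc_w[of "2 * \<theta>" j]] disc_k[of "\<pi> j"] \<pi>in[OF that(2)] that by auto
  have step4: "ambient_isotopic (config_closure m Q') (config_closure m (\<lambda>\<theta> j. A (q \<theta> j)))"
  proof (rule config_linear_isotopy[where P = Q' and Q = "\<lambda>\<theta> j. A (q \<theta> j)" and \<sigma> = \<pi>, OF cont_Q' _ disc_Q' disc_Aq \<pi>m ends_Q'])
    show "continuous_on {0..1} (\<lambda>\<theta>. A (q \<theta> j))" for j
      unfolding Aq
    proof (rule continuous_on_glue)
      show "continuous_on {0..1/2} (\<lambda>\<theta>. A (word_path w (2 * \<theta>) j))"
        unfolding A_def using cont_w[of j] by (intro continuous_intros)
    qed (simp_all add: \<pi>_def)
    show "A (q 1 j) = A (q 0 (\<pi> j))" for j by (simp add: q_def joinpaths_def)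
    fix t \<theta> :: real and i j assume t: "t \<in> {0..1}" and \<theta>: "\<theta> \<in> {0..1}" and ij: "i \<in> {1..m}" "j \<in> {1..m}" "i \<noteq> j"
    show "complex_of_real (1 - t) * Q' \<theta> i + complex_of_real t * A (q \<theta> i) \<noteq>
      complex_of_real (1 - t) * Q' \<theta> j + complex_of_real t * A (q \<theta> j)"
    proof (cases "\<theta> \<le> 1/2")
      case True
      have wne: "word_path w (2 * \<theta>) i \<noteq> word_path w (2 * \<theta>) j"
        using word_path_Conf[of "2 * \<theta>" w] True \<theta> ij(3) by (auto simp: Conf_def dest: injD)
      have "A (word_path w (2 * \<theta>) i) \<noteq> A (word_path w (2 * \<theta>) j)"
        using wne \<alpha> by (simp add: A_def)
      then show ?thesis using True ij
        by (simp add: Aq Q'_def F_def left_diff_distrib)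
    next
      case False
      have Q'k: "Q' \<theta> i = (if \<pi> i < m then A (of_nat (\<pi> i)) else loop_mid \<epsilon> (2 * \<theta> - 1))" for i
        using False by (simp add: Q'_def G'_def)
      have main: "complex_of_real (1 - t) * Q' \<theta> i + complex_of_real t * A (q \<theta> i) \<noteq>
        complex_of_real (1 - t) * Q' \<theta> j + complex_of_real t * A (q \<theta> j)"
        if ij: "i \<in> {1..m}" "j \<in> {1..m}" "\<pi> i < \<pi> j" for i j
      proof (rule Re_ne[OF t])
        have lt: "\<pi> i < m" using ij \<pi>in[OF ij(2)] by simp
        have lt': "\<alpha> / 2 * (real (\<pi> i) - real m) < \<alpha> / 2 * (real (\<pi> j) - real m)"
          using \<alpha> ij(3) by (intro mult_strict_left_mono) auto
        then show "Re (A (q \<theta> i)) < Re (A (q \<theta> j))" using False by (simp add: Aq ReA)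
        have "\<alpha> / 2 * (real (\<pi> i) - real m) < 0" using \<alpha> lt by (intro mult_pos_neg) auto
        then have neg: "Re (Q' \<theta> i) < 0" using lt by (simp add: Q'k ReA)
        show "Re (Q' \<theta> i) < Re (Q' \<theta> j)"
        proof (cases "\<pi> j < m")
          case True
          then show ?thesis using lt lt' by (simp add: Q'k ReA)
        next
          case False
          then have "0 \<le> Re (Q' \<theta> j)" using Re_loop_mid by (simp add: Q'k)
          then show ?thesis using neg by linarith
        qed
      qed
      have "\<pi> i < \<pi> j \<or> \<pi> j < \<pi> i" using \<pi>inj[OF ij(3)] by linarith
      then show ?thesis using main[OF ij(1,2)] main[OF ij(2,1)] by metis
    qed
  qed
  have step5: "ambient_isotopic (config_closure m (\<lambda>\<theta> j. A (q \<theta> j))) (config_closure m (word_config m w))"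
  proof -
    have h: "homotopic_paths Conf q (word_path w)"
      using word_path_append[of w "[]"] unfolding \<pi>_def q_def by (simp add: homotopic_paths_sym)
    show ?thesis
      unfolding word_config_def[abs_def] A_def
      by (rule homotopic_config_isotopy[OF h \<pi>m])
        (use disc_Aq[unfolded A_def] word_config_disc[OF w] \<alpha> in \<open>auto simp: q_def word_config_def joinpaths_def\<close>)
  qed
  show ?thesis
    using step1 step2 step3 step4 step5 braid_closure_config(2)[OF w] ambient_isotopic_trans by blast
qed

section \<open>Relations in the braid group\<close>

lemma braid_eq_cong: "braid_eq v v' \<Longrightarrow> braid_eq (u @ v @ w) (u @ v' @ w)"
  by (intro braid_eq_append) simp_all

lemma braid_eq_left: "braid_eq v v' \<Longrightarrow> braid_eq (u @ v) (u @ v')"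
  by (intro braid_eq_append) simp_all

lemma braid_eq_right: "braid_eq v v' \<Longrightarrow> braid_eq (v @ w) (v' @ w)"
  by (intro braid_eq_append) simp_all

text \<open>For this and the next relations a height function is found for which both sides are
  layered. Here the same strand is the upper one in both letters.\<close>

lemma braid_eq_cancel: "braid_eq [(i, e), (i, \<not> e)] []"
  by (rule braid_eq_layered[where h = "\<lambda>j. if e then - real j else real j"])
    (auto simp: fun_eq_iff letter_swap_def Transposition.transpose_def inj_def)

lemma braid_eq_far:
  assumes "i + 1 < j \<or> j + 1 < i"
  shows "braid_eq [(i, e), (j, f)] [(j, f), (i, e)]"
proof -
  \<comment> \<open>Along the two positions of a letter, heights have to decrease if it is positive
    and to increase if it is negative; \<tau> swaps exactly the pairs that belong to positive
    letters.\<close>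
  define \<tau> where "\<tau> = (if e then Transposition.transpose i (i + 1) else id) \<circ> (if f then Transposition.transpose j (j + 1) else id)"
  have "inj \<tau>" unfolding \<tau>_def by (auto intro!: inj_compose)
  show ?thesis
  proof (rule braid_eq_layered[where h = "\<lambda>k. real (\<tau> k)"])
    show "inj (\<lambda>k. real (\<tau> k))" using \<open>inj \<tau>\<close> by (auto simp: inj_def)
  qed (use assms in \<open>auto simp: fun_eq_iff letter_swap_def Transposition.transpose_def \<tau>_def\<close>)
qed

text \<open>The braid relation with one crossing of arbitrary sign. Strand \<open>i\<close> is above
  the other two, and \<open>e\<close> decides which of those is the higher one.\<close>

lemma braid_eq_slide_up:
  "braid_eq [(i, True), (i + 1, True), (i, e)] [(i + 1, e), (i, True), (i + 1, True)]"
  by (rule braid_eq_layered[where h = "\<lambda>k. - real (if e then k else Transposition.transpose (i + 1) (i + 2) k)"])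
    (auto simp: fun_eq_iff letter_swap_def Transposition.transpose_def inj_def)

text \<open>The companion relation, in which strand \<open>i + 2\<close> is below the other
  two.\<close>

lemma braid_eq_slide_down:
  "braid_eq [(i, e), (i + 1, True), (i, True)] [(i + 1, True), (i, True), (i + 1, e)]"
  by (rule braid_eq_layered[where h = "\<lambda>k. - real (if e then k else Transposition.transpose i (i + 1) k)"])
    (auto simp: fun_eq_iff letter_swap_def Transposition.transpose_def inj_def)

lemma braid_eq_far_letter:
  assumes "\<And>l. l \<in> set w \<Longrightarrow> i + 1 < fst l \<or> fst l + 1 < i"
  shows "braid_eq ((i, e) # w) (w @ [(i, e)])"
  using assms
proof (induction w)
  case (Cons l w)
  have "braid_eq ([(i, e), l] @ w) ([l, (i, e)] @ w)"
    using braid_eq_far[of i "fst l" e "snd l"] Cons.prems[of l] by (intro braid_eq_right) auto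
  also have "[l, (i, e)] @ w = [l] @ ((i, e) # w)" by simp
  also have "braid_eq \<dots> ([l] @ (w @ [(i, e)]))"
    using Cons by (intro braid_eq_left) auto
  finally show ?case by simp
qed simp

lemma word_inverse_simps [simp]:
  "word_inverse [] = []" "word_inverse (l # w) = word_inverse w @ [(fst l, \<not> snd l)]"
  "word_inverse (u @ v) = word_inverse v @ word_inverse u"
  by (simp_all add: word_inverse_def case_prod_beta)

lemma braid_word_on_inverse [simp]: "braid_word_on m (word_inverse w) \<longleftrightarrow> braid_word_on m w"
  by (induction w) auto

lemma braid_eq_inverse_right: "braid_eq (w @ word_inverse w) []"
proof (induction w)
  case (Cons l w)
  have "braid_eq ([l] @ (w @ word_inverse w) @ [(fst l, \<not> snd l)]) ([l] @ [] @ [(fst l, \<not> snd l)])"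
    by (rule braid_eq_cong[OF Cons.IH])
  also have "braid_eq \<dots> []" using braid_eq_cancel[of "fst l" "snd l"] by simp
  finally show ?case by simp
qed simp

lemma word_inverse_inverse [simp]: "word_inverse (word_inverse w) = w"
  by (induction w) auto

lemma braid_eq_inverse_left: "braid_eq (word_inverse w @ w) []"
  using braid_eq_inverse_right[of "word_inverse w"] by simp

lemma braid_eq_inverse:
  assumes "braid_eq u v"
  shows "braid_eq (word_inverse u) (word_inverse v)"
proof -
  have "braid_eq (word_inverse u @ [] @ []) (word_inverse u @ (v @ word_inverse v) @ [])"
    by (rule braid_eq_cong[OF braid_eq_sym[OF braid_eq_inverse_right]])
  also have "\<dots> = word_inverse u @ v @ word_inverse v" by simp
  also have "braid_eq \<dots> (word_inverse u @ u @ word_inverse v)"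
    by (rule braid_eq_cong[OF braid_eq_sym[OF assms]])
  also have "\<dots> = (word_inverse u @ u) @ word_inverse v" by simp
  also have "braid_eq \<dots> ([] @ word_inverse v)"
    by (rule braid_eq_right[OF braid_eq_inverse_left])
  finally show ?thesis by simp
qed

section \<open>Powers of words\<close>

abbreviation word_pow :: "braid_word \<Rightarrow> nat \<Rightarrow> braid_word" where
  "word_pow w n \<equiv> concat (replicate n w)"

lemma word_pow_add: "word_pow w (m + n) = word_pow w m @ word_pow w n"
  by (simp add: replicate_add)

lemma word_pow_Suc_right: "word_pow w (Suc n) = word_pow w n @ w"
  using word_pow_add[of n 1 w] by simp

lemma word_inverse_word_pow: "word_inverse (word_pow w n) = word_pow (word_inverse w) n"
proof (induction n)
  case (Suc n)
  then show ?case using word_pow_Suc_right[of n "word_inverse w"] by simp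
qed simp

lemma braid_eq_word_pow: "braid_eq u v \<Longrightarrow> braid_eq (word_pow u n) (word_pow v n)"
  by (induction n) (auto intro: braid_eq_append)

lemma word_power_of_nat: "word_power w (int n) = word_pow w n"
  by (simp add: word_power_def)

lemma word_power_minus_of_nat: "word_power w (- int n) = word_pow (word_inverse w) n"
  by (simp add: word_power_def)

lemma word_pow_cancel:
  assumes "n \<le> m"
  shows "braid_eq (word_pow (word_inverse w) n @ word_pow w m) (word_pow w (m - n))"
proof -
  have "word_pow w m = word_pow w n @ word_pow w (m - n)"
    using assms word_pow_add[of n "m - n" w] by simp
  then have "word_pow (word_inverse w) n @ word_pow w m =
      (word_inverse (word_pow w n) @ word_pow w n) @ word_pow w (m - n)"
    by (simp add: word_inverse_word_pow)
  also have "braid_eq \<dots> ([] @ word_pow w (m - n))"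
    by (rule braid_eq_right[OF braid_eq_inverse_left])
  finally show ?thesis by simp
qed

lemma word_power_add:
  "braid_eq (word_power w (- int n) @ word_power w (int m)) (word_power w (int m - int n))"
proof (cases "n \<le> m")
  case True
  then have "int m - int n = int (m - n)" by simp
  then show ?thesis
    using word_pow_cancel[OF True, of w] by (simp only: word_power_of_nat word_power_minus_of_nat)
next
  case False
  then have mn: "m \<le> n" and e: "int m - int n = - int (n - m)" by simp_all
  have "word_pow (word_inverse w) n @ word_pow w m =
      word_pow (word_inverse w) (n - m) @ (word_inverse (word_pow w m) @ word_pow w m)"
    using mn word_pow_add[of "n - m" m "word_inverse w"] by (simp add: word_inverse_word_pow)
  also have "braid_eq \<dots> (word_pow (word_inverse w) (n - m) @ [])"
    by (rule braid_eq_left[OF braid_eq_inverse_left])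
  finally show ?thesis unfolding e by (simp only: word_power_of_nat word_power_minus_of_nat append_Nil2)
qed

section \<open>Words moved to later positions\<close>

definition shift_word :: "nat \<Rightarrow> braid_word \<Rightarrow> braid_word" where
  "shift_word a w = map (\<lambda>(i, e). (i + a, e)) w"

lemma shift_word_simps [simp]:
  "shift_word a [] = []" "shift_word a (l # w) = (fst l + a, snd l) # shift_word a w"
  "shift_word a (u @ v) = shift_word a u @ shift_word a v"
  by (simp_all add: shift_word_def case_prod_beta)

lemma shift_word_shift [simp]: "shift_word a (shift_word b w) = shift_word (a + b) w"
  by (induction w) auto

lemma shift_word_0 [simp]: "shift_word 0 w = w"
  by (induction w) auto

lemma shift_word_concat: "shift_word a (concat ws) = concat (map (shift_word a) ws)"
  by (induction ws) auto

lemma shift_word_inverse: "shift_word a (word_inverse w) = word_inverse (shift_word a w)"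
  by (induction w) auto

lemma shift_word_pow: "shift_word a (word_pow w n) = word_pow (shift_word a w) n"
  by (simp add: shift_word_concat)

lemma shift_word_power: "shift_word a (word_power w n) = word_power (shift_word a w) n"
  by (simp add: word_power_def shift_word_concat shift_word_inverse)

lemma shift_sigma_run: "shift_word a (sigma_run b n) = sigma_run (a + b) n"
  by (auto simp: sigma_run_def shift_word_def intro!: nth_equalityI)

lemma braid_word_on_shift: "braid_word_on m w \<Longrightarrow> braid_word_on (a + m) (shift_word a w)"
  by (induction w) auto

lemma braid_word_on_mono: "braid_word_on m w \<Longrightarrow> m \<le> n \<Longrightarrow> braid_word_on n w"
  by (induction w) auto

lemma braid_word_on_pow: "braid_word_on m w \<Longrightarrow> braid_word_on m (word_pow w n)"
  by (induction n) auto

lemma braid_word_on_power: "braid_word_on m w \<Longrightarrow> braid_word_on m (word_power w n)"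
  by (simp add: word_power_def braid_word_on_pow)

lemma braid_word_on_concat: "braid_word_on m (concat ws) \<longleftrightarrow> (\<forall>w\<in>set ws. braid_word_on m w)"
  by (induction ws) auto

section \<open>Runs of consecutive generators\<close>

lemma sigma_run_set: "l \<in> set (sigma_run a n) \<longleftrightarrow> snd l \<and> a + 1 \<le> fst l \<and> fst l < a + n"
  by (cases l) (auto simp: sigma_run_def)

lemma braid_word_on_sigma_run: "a + n \<le> m \<Longrightarrow> braid_word_on m (sigma_run a n)"
  by (auto simp: braid_word_on_def sigma_run_def)

lemma braid_word_on_half_twist: "a + n \<le> m \<Longrightarrow> braid_word_on m (half_twist a n)"
  by (auto simp: half_twist_def braid_word_on_concat intro!: braid_word_on_sigma_run)

lemma sigma_run_0_1 [simp]: "sigma_run a 0 = []" "sigma_run a (Suc 0) = []"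
  by (simp_all add: sigma_run_def)

lemma sigma_run_snoc: "1 \<le> n \<Longrightarrow> sigma_run a (Suc n) = sigma_run a n @ [(a + n, True)]"
  by (simp add: sigma_run_def)

lemma sigma_run_Cons: "1 \<le> n \<Longrightarrow> sigma_run a (Suc n) = (a + 1, True) # sigma_run (a + 1) n"
  by (simp add: sigma_run_def upt_conv_Cons)

lemma sigma_run_split:
  assumes "1 \<le> j" "j < n"
  shows "sigma_run a n = sigma_run a j @ (a + j, True) # sigma_run (a + j) (n - j)"
proof -
  have "[a + 1..<a + n] = [a + 1..<a + j] @ [a + j..<a + n]"
    using assms upt_add_eq_append[of "a + 1" "a + j" "n - j"] by simp
  also have "[a + j..<a + n] = (a + j) # [a + j + 1..<a + n]"
    using assms by (simp add: upt_conv_Cons)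
  finally show ?thesis using assms by (simp add: sigma_run_def)
qed

text \<open>The run carries its first strand over all the others to the last position. A crossing
  between two of the others can be slid along it, and their positions drop by one on the
  way.\<close>

lemma sigma_run_slide:
  assumes "1 \<le> j" "j + 1 < n"
  shows "braid_eq (sigma_run a n @ [(a + j, e)]) ((a + j + 1, e) # sigma_run a n)"
proof -
  define u where "u = sigma_run a j"
  define v where "v = sigma_run (a + j + 1) (n - j - 1)"
  have run: "sigma_run a n = u @ [(a + j, True), (a + j + 1, True)] @ v"
    using sigma_run_split[OF assms(1), of n a] sigma_run_Cons[of "n - j - 1" "a + j"] assms
    by (simp add: u_def v_def Suc_diff_Suc)
  have "sigma_run a n @ [(a + j, e)] = (u @ [(a + j, True), (a + j + 1, True)]) @ (v @ [(a + j, e)])"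
    by (simp add: run)
  also have "braid_eq \<dots> ((u @ [(a + j, True), (a + j + 1, True)]) @ ((a + j, e) # v))"
    by (rule braid_eq_left[OF braid_eq_sym[OF braid_eq_far_letter]]) (auto simp: v_def sigma_run_set)
  also have "\<dots> = u @ [(a + j, True), (a + j + 1, True), (a + j, e)] @ v" by simp
  also have "braid_eq \<dots> (u @ [(a + j + 1, e), (a + j, True), (a + j + 1, True)] @ v)"
    by (rule braid_eq_cong[OF braid_eq_slide_up])
  also have "\<dots> = (u @ [(a + j + 1, e)]) @ ([(a + j, True), (a + j + 1, True)] @ v)" by simp
  also have "braid_eq \<dots> (((a + j + 1, e) # u) @ ([(a + j, True), (a + j + 1, True)] @ v))"
    by (rule braid_eq_right[OF braid_eq_sym[OF braid_eq_far_letter]]) (auto simp: u_def sigma_run_set)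
  finally show ?thesis by (simp add: run)
qed

lemma sigma_run_slide_word:
  assumes "\<And>l. l \<in> set u \<Longrightarrow> 1 \<le> fst l \<and> fst l + 1 < n"
  shows "braid_eq (sigma_run a n @ shift_word a u) (shift_word (a + 1) u @ sigma_run a n)"
  using assms
proof (induction u)
  case (Cons l u)
  have "sigma_run a n @ shift_word a (l # u) = (sigma_run a n @ [(a + fst l, snd l)]) @ shift_word a u"
    by (simp add: add.commute)
  also have "braid_eq \<dots> (((a + fst l + 1, snd l) # sigma_run a n) @ shift_word a u)"
    using Cons.prems[of l] by (intro braid_eq_right sigma_run_slide) auto
  also have "\<dots> = [(a + fst l + 1, snd l)] @ (sigma_run a n @ shift_word a u)" by simp
  also have "braid_eq \<dots> ([(a + fst l + 1, snd l)] @ (shift_word (a + 1) u @ sigma_run a n))"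
    using Cons by (intro braid_eq_left) auto
  finally show ?case by (simp add: add.commute add.left_commute)
qed simp

text \<open>The reversed run carries its last strand under all the others to the first position, so
  the positions of the others rise by one.\<close>

lemma sigma_run_rev_slide:
  assumes "1 \<le> j" "j + 1 < n"
  shows "braid_eq ((a + j, e) # rev (sigma_run a n)) (rev (sigma_run a n) @ [(a + j + 1, e)])"
proof -
  define u where "u = rev (sigma_run a j)"
  define v where "v = rev (sigma_run (a + j + 1) (n - j - 1))"
  have run: "rev (sigma_run a n) = v @ [(a + j + 1, True), (a + j, True)] @ u"
    using sigma_run_split[OF assms(1), of n a] sigma_run_Cons[of "n - j - 1" "a + j"] assms
    by (simp add: u_def v_def Suc_diff_Suc)
  have "(a + j, e) # rev (sigma_run a n) = ((a + j, e) # v) @ ([(a + j + 1, True), (a + j, True)] @ u)"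
    by (simp add: run)
  also have "braid_eq \<dots> ((v @ [(a + j, e)]) @ ([(a + j + 1, True), (a + j, True)] @ u))"
    by (rule braid_eq_right[OF braid_eq_far_letter]) (auto simp: v_def sigma_run_set)
  also have "\<dots> = v @ [(a + j, e), (a + j + 1, True), (a + j, True)] @ u" by simp
  also have "braid_eq \<dots> (v @ [(a + j + 1, True), (a + j, True), (a + j + 1, e)] @ u)"
    by (rule braid_eq_cong[OF braid_eq_slide_down])
  also have "\<dots> = (v @ [(a + j + 1, True), (a + j, True)]) @ ((a + j + 1, e) # u)" by simp
  also have "braid_eq \<dots> ((v @ [(a + j + 1, True), (a + j, True)]) @ (u @ [(a + j + 1, e)]))"
    by (rule braid_eq_left[OF braid_eq_far_letter]) (auto simp: u_def sigma_run_set)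
  finally show ?thesis by (simp add: run)
qed

section \<open>Half twists and the full twist\<close>

lemma half_twist_0 [simp]: "half_twist a 0 = []"
  by (simp add: half_twist_def)

lemma half_twist_Suc: "half_twist a (Suc n) = sigma_run a (Suc n) @ half_twist a n"
  unfolding half_twist_def by (subst upt_conv_Cons) (simp_all add: map_Suc_upt[symmetric] o_def del: upt_Suc)

lemma half_twist_set: "l \<in> set (half_twist a n) \<Longrightarrow> a + 1 \<le> fst l \<and> fst l < a + n"
  by (fastforce simp: half_twist_def sigma_run_set)

text \<open>The definition splits off a run on the left. In the square of the half twist one factor
  has to be split on the right instead, so that the reversed run and the run meet in the
  middle.\<close>

lemma half_twist_Suc_right: "braid_eq (half_twist a (Suc n)) (half_twist a n @ rev (sigma_run a (Suc n)))"
proof (induction n)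
  case (Suc n)
  have "half_twist a (Suc (Suc n)) = sigma_run a (Suc (Suc n)) @ half_twist a (Suc n)"
    by (rule half_twist_Suc)
  also have "braid_eq \<dots> (sigma_run a (Suc (Suc n)) @ (half_twist a n @ rev (sigma_run a (Suc n))))"
    by (rule braid_eq_left[OF Suc.IH])
  also have "\<dots> = sigma_run a (Suc n) @ ((a + Suc n, True) # half_twist a n) @ rev (sigma_run a (Suc n))"
    by (simp add: sigma_run_snoc)
  also have "braid_eq \<dots> (sigma_run a (Suc n) @ (half_twist a n @ [(a + Suc n, True)]) @ rev (sigma_run a (Suc n)))"
    by (rule braid_eq_cong[OF braid_eq_far_letter]) (auto dest: half_twist_set)
  also have "\<dots> = half_twist a (Suc n) @ rev (sigma_run a (Suc (Suc n)))"
    by (simp add: half_twist_Suc sigma_run_snoc)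
  finally show ?case .
qed (simp add: half_twist_Suc)

text \<open>The first \<open>j\<close> letters of the reversed run on \<open>n + 1\<close> strands:
  the correction term that makes \<open>sigma_run_pow\<close> provable by induction on
  \<open>j\<close>.\<close>

definition descent :: "nat \<Rightarrow> nat \<Rightarrow> nat \<Rightarrow> braid_word" where
  "descent a n j = map (\<lambda>i. (a + n - i, True)) [0..<j]"

lemma descent_full: "descent a n n = rev (sigma_run a (Suc n))"
  by (auto simp: descent_def sigma_run_def rev_map[symmetric] rev_nth intro!: nth_equalityI simp del: upt_Suc)

text \<open>Sliding the letters of the descent through the run lowers their indices by one; the last
  letter of the run, which has the largest index, then heads a descent that is longer by
  one.\<close>

lemma descent_slide:
  assumes "j < n"
  shows "braid_eq (descent a n j @ sigma_run a (Suc n)) (sigma_run a n @ descent a n (Suc j))"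
proof -
  have n: "1 \<le> n" using assms by simp
  have "braid_eq (descent a n i @ sigma_run a (Suc n)) (sigma_run a (Suc n) @ map (\<lambda>i. (a + n - Suc i, True)) [0..<i])"
    if "i \<le> j" for i
    using that
  proof (induction i)
    case (Suc i)
    have "descent a n (Suc i) @ sigma_run a (Suc n) = descent a n i @ ((a + (n - Suc i) + 1, True) # sigma_run a (Suc n))"
      using Suc.prems assms by (simp add: descent_def)
    also have "braid_eq \<dots> (descent a n i @ (sigma_run a (Suc n) @ [(a + (n - Suc i), True)]))"
      using Suc.prems assms by (intro braid_eq_left braid_eq_sym[OF sigma_run_slide]) auto
    also have "\<dots> = (descent a n i @ sigma_run a (Suc n)) @ [(a + (n - Suc i), True)]" by simp
    also have "braid_eq \<dots> ((sigma_run a (Suc n) @ map (\<lambda>i. (a + n - Suc i, True)) [0..<i]) @ [(a + (n - Suc i), True)])"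
      using Suc by (intro braid_eq_right) auto
    also have "\<dots> = sigma_run a (Suc n) @ map (\<lambda>i. (a + n - Suc i, True)) [0..<Suc i]"
      using Suc.prems assms by simp
    finally show ?case .
  qed (simp add: descent_def)
  from this[of j] have "braid_eq (descent a n j @ sigma_run a (Suc n)) (sigma_run a (Suc n) @ map (\<lambda>i. (a + n - Suc i, True)) [0..<j])"
    by simp
  also have "sigma_run a (Suc n) @ map (\<lambda>i. (a + n - Suc i, True)) [0..<j] = sigma_run a n @ descent a n (Suc j)"
    unfolding descent_def using n
    by (subst upt_conv_Cons) (simp_all add: sigma_run_snoc map_Suc_upt[symmetric] o_def del: upt_Suc)
  finally show ?thesis .
qed

text \<open>For \<open>j = n\<close> the descent is the whole reversed run, which is the case that
  the full twist needs.\<close>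

lemma sigma_run_pow:
  assumes "j \<le> n"
  shows "braid_eq (word_pow (sigma_run a (Suc n)) j) (word_pow (sigma_run a n) j @ descent a n j)"
  using assms
proof (induction j)
  case (Suc j)
  have "word_pow (sigma_run a (Suc n)) (Suc j) = word_pow (sigma_run a (Suc n)) j @ sigma_run a (Suc n)"
    by (rule word_pow_Suc_right)
  also have "braid_eq \<dots> ((word_pow (sigma_run a n) j @ descent a n j) @ sigma_run a (Suc n))"
    using Suc by (intro braid_eq_right) auto
  also have "\<dots> = word_pow (sigma_run a n) j @ (descent a n j @ sigma_run a (Suc n))" by simp
  also have "braid_eq \<dots> (word_pow (sigma_run a n) j @ (sigma_run a n @ descent a n (Suc j)))"
    using Suc.prems by (intro braid_eq_left descent_slide) auto
  also have "\<dots> = word_pow (sigma_run a n) (Suc j) @ descent a n (Suc j)"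
    by (simp only: word_pow_Suc_right append_assoc)
  finally show ?case .
qed (simp add: descent_def)

text \<open>The product takes the last strand under all the others to the front and back over all of
  them. This is a full loop around the other strands, so it commutes with any braid of
  those.\<close>

lemma rev_run_run_commute:
  assumes "\<And>l. l \<in> set u \<Longrightarrow> a + 1 \<le> fst l \<and> fst l + 1 < a + n"
  shows "braid_eq (u @ (rev (sigma_run a n) @ sigma_run a n)) ((rev (sigma_run a n) @ sigma_run a n) @ u)"
  using assms
proof (induction u)
  case (Cons l u)
  let ?D = "rev (sigma_run a n)" and ?R = "sigma_run a n"
  define j where "j = fst l - a"
  have j: "1 \<le> j" "j + 1 < n" "l = (a + j, snd l)" using Cons.prems[of l] by (auto simp: j_def prod_eq_iff)
  have "(l # u) @ (?D @ ?R) = [l] @ (u @ (?D @ ?R))" by simp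
  also have "braid_eq \<dots> ([l] @ ((?D @ ?R) @ u))"
    using Cons by (intro braid_eq_left) auto
  also have "\<dots> = ((a + j, snd l) # ?D) @ (?R @ u)" using j(3) by simp
  also have "braid_eq \<dots> ((?D @ [(a + j + 1, snd l)]) @ (?R @ u))"
    by (rule braid_eq_right[OF sigma_run_rev_slide[OF j(1,2)]])
  also have "\<dots> = ?D @ ((a + j + 1, snd l) # ?R) @ u" by simp
  also have "braid_eq \<dots> (?D @ (?R @ [(a + j, snd l)]) @ u)"
    by (rule braid_eq_cong[OF braid_eq_sym[OF sigma_run_slide[OF j(1,2)]]])
  finally show ?case using j(3) by simp
qed simp

text \<open>Let \<open>D\<close> be the reversed run and \<open>R\<close> the run on
  \<open>n + 1\<close> strands, and \<open>H\<close> the half twist on \<open>n\<close>. Then the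
  square in question is \<open>H D R H\<close>, which equals \<open>H H D R\<close> since
  \<open>D R\<close> commutes with \<open>H\<close>. By induction and \<open>sigma_run_pow\<close>,
  \<open>H H D\<close> is the \<open>n\<close>-th power of \<open>R\<close>.\<close>

lemma full_twist:
  "braid_eq (half_twist a n @ half_twist a n) (word_pow (sigma_run a n) n)"
proof (induction n)
  case (Suc n)
  let ?D = "rev (sigma_run a (Suc n))" and ?R = "sigma_run a (Suc n)" and ?H = "half_twist a n"
  have "braid_eq (half_twist a (Suc n) @ half_twist a (Suc n)) ((?H @ ?D) @ (?R @ ?H))"
    using half_twist_Suc_right half_twist_Suc by (intro braid_eq_append) auto
  also have "\<dots> = ?H @ ((?D @ ?R) @ ?H)" by simp
  also have "braid_eq \<dots> (?H @ (?H @ (?D @ ?R)))"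
    by (intro braid_eq_left braid_eq_sym[OF rev_run_run_commute]) (auto dest: half_twist_set)
  also have "\<dots> = (?H @ ?H) @ (?D @ ?R)" by simp
  also have "braid_eq \<dots> (word_pow (sigma_run a n) n @ (?D @ ?R))"
    by (rule braid_eq_right[OF Suc.IH])
  also have "\<dots> = (word_pow (sigma_run a n) n @ descent a n n) @ ?R"
    by (simp add: descent_full)
  also have "braid_eq \<dots> (word_pow ?R n @ ?R)"
    by (rule braid_eq_right[OF braid_eq_sym[OF sigma_run_pow]]) simp
  finally show ?case by (simp only: word_pow_Suc_right)
qed simp

lemma word_power_full_twist:
  assumes "v \<le> 0"
  shows "braid_eq (word_power (half_twist a n) (2 * v)) (word_power (sigma_run a n) (v * int n))"
proof -
  define k where "k = nat (- v)"
  have v: "v = - int k" using assms by (simp add: k_def)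
  have "word_pow (half_twist a n) (2 * k) = word_pow (half_twist a n @ half_twist a n) k" for k
    by (induction k) auto
  then have "braid_eq (word_pow (half_twist a n) (2 * k)) (word_pow (word_pow (sigma_run a n) n) k)"
    using braid_eq_word_pow[OF full_twist] by simp
  also have "word_pow (word_pow (sigma_run a n) n) k = word_pow (sigma_run a n) (k * n)"
    by (induction k) (simp_all add: word_pow_add)
  finally have "braid_eq (word_inverse (word_pow (half_twist a n) (2 * k))) (word_inverse (word_pow (sigma_run a n) (k * n)))"
    by (rule braid_eq_inverse)
  then have "braid_eq (word_power (half_twist a n) (- int (2 * k))) (word_power (sigma_run a n) (- int (k * n)))"
    by (simp only: word_inverse_word_pow word_power_minus_of_nat)
  then show ?thesis by (simp add: v)
qed

section \<open>Reduction of Lorenz braids\<close>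

text \<open>Well-formedness of the words is included because it puts the closures inside the sphere,
  which symmetry of ambient isotopy depends on.\<close>

definition link_eq :: "nat \<Rightarrow> braid_word \<Rightarrow> nat \<Rightarrow> braid_word \<Rightarrow> bool" where
  "link_eq m u n v \<longleftrightarrow> braid_word_on m u \<and> braid_word_on n v \<and>
     ambient_isotopic (braid_closure m u) (braid_closure n v)"

lemma link_eq_refl: "braid_word_on m u \<Longrightarrow> link_eq m u m u"
  by (simp add: link_eq_def ambient_isotopic_refl)

lemma link_eq_sym: "link_eq m u n v \<Longrightarrow> link_eq n v m u"
  using ambient_isotopic_sym braid_closure_subset unfolding link_eq_def by blast

lemma link_eq_trans [trans]: "link_eq m u n v \<Longrightarrow> link_eq n v k w \<Longrightarrow> link_eq m u k w"
  using ambient_isotopic_trans unfolding link_eq_def by blast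

lemma link_eq_braid_eq: "braid_eq u v \<Longrightarrow> braid_word_on m u \<Longrightarrow> braid_word_on m v \<Longrightarrow> link_eq m u m v"
  by (simp add: link_eq_def braid_eq_closure)

lemma link_eq_conjugate: "braid_word_on m (u @ v) \<Longrightarrow> link_eq m (u @ v) m (v @ u)"
  by (simp add: link_eq_def braid_closure_conjugate)

lemma link_eq_destabilize:
  assumes "braid_word_on m w" "1 \<le> m"
  shows "link_eq (m + 1) (w @ [(m, e)]) m w"
  using assms markov_destabilize[OF assms] braid_word_on_mono[of m w "m + 1"] by (simp add: link_eq_def)

lemma flip_word_simps [simp]:
  "flip_word m [] = []" "flip_word m (l # w) = (m - fst l, snd l) # flip_word m w"
  "flip_word m (u @ v) = flip_word m u @ flip_word m v"
  by (simp_all add: flip_word_def case_prod_beta)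

lemma braid_word_on_flip: "braid_word_on m w \<Longrightarrow> braid_word_on m (flip_word m w)"
  by (induction w) auto

lemma flip_flip: "braid_word_on m w \<Longrightarrow> flip_word m (flip_word m w) = w"
  by (induction w) auto

lemma flip_shift: "braid_word_on m w \<Longrightarrow> flip_word (m + 1) (shift_word 1 w) = flip_word m w"
  by (induction w) auto

lemma link_eq_flip: "braid_word_on m w \<Longrightarrow> link_eq m w m (flip_word m w)"
  by (simp add: link_eq_def braid_closure_flip braid_word_on_flip)

text \<open>Reversing the positions turns the first strand into the last one, and the signs of the
  crossings survive.\<close>

lemma link_eq_destabilize_left:
  assumes "braid_word_on m w" "1 \<le> m"
  shows "link_eq (m + 1) (shift_word 1 w @ [(1, e)]) m w"
proof -
  have "link_eq (m + 1) (shift_word 1 w @ [(1, e)]) (m + 1) (flip_word (m + 1) (shift_word 1 w @ [(1, e)]))"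
    using braid_word_on_shift[OF assms(1), of 1] assms(2) by (intro link_eq_flip) simp
  also have "flip_word (m + 1) (shift_word 1 w @ [(1, e)]) = flip_word m w @ [(m, e)]"
    by (simp add: flip_shift[OF assms(1), simplified])
  also have "link_eq (m + 1) \<dots> m (flip_word m w)"
    by (intro link_eq_destabilize braid_word_on_flip assms)
  also have "link_eq m \<dots> m w"
    using link_eq_flip[OF braid_word_on_flip[OF assms(1)]] flip_flip[OF assms(1)] by simp
  finally show ?thesis .
qed

text \<open>Conjugation by the run over all strands moves a trivial last strand to the front.\<close>

lemma link_eq_shift:
  assumes "braid_word_on m w"
  shows "link_eq (a + m) (shift_word a w) (a + m) w"
  using assms
proof (induction a arbitrary: m)
  case 0
  then show ?case by (simp add: link_eq_refl)
next
  case (Suc a)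
  define M where "M = a + m"
  define X where "X = shift_word a w"
  let ?R = "sigma_run 0 (M + 1)"
  have X: "braid_word_on M X" unfolding X_def M_def by (rule braid_word_on_shift[OF Suc.prems])
  have on: "braid_word_on (M + 1) X" "braid_word_on (M + 1) (shift_word 1 X)" "braid_word_on (M + 1) ?R"
    using X braid_word_on_mono[OF X, of "M + 1"] braid_word_on_shift[OF X, of 1] braid_word_on_sigma_run[of 0 "M + 1" "M + 1"]
    by simp_all
  have "1 \<le> fst l \<and> fst l + 1 < M + 1" if "l \<in> set X" for l
    using X that by (auto simp: braid_word_on_def)
  from sigma_run_slide_word[OF this, where a = 0] have slide: "braid_eq (?R @ X) (shift_word 1 X @ ?R)"
    by simp
  have "braid_eq (shift_word 1 X) (shift_word 1 X @ (?R @ word_inverse ?R))"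
    using braid_eq_left[OF braid_eq_sym[OF braid_eq_inverse_right], of "shift_word 1 X" ?R] by simp
  also have "\<dots> = (shift_word 1 X @ ?R) @ word_inverse ?R" by simp
  also have "braid_eq \<dots> ((?R @ X) @ word_inverse ?R)"
    by (rule braid_eq_right[OF braid_eq_sym[OF slide]])
  finally have "link_eq (M + 1) (shift_word 1 X) (M + 1) ((?R @ X) @ word_inverse ?R)"
    using on by (intro link_eq_braid_eq) auto
  also have "link_eq (M + 1) ((?R @ X) @ word_inverse ?R) (M + 1) (word_inverse ?R @ (?R @ X))"
    using on by (intro link_eq_conjugate) auto
  also have "link_eq (M + 1) (word_inverse ?R @ (?R @ X)) (M + 1) X"
    using braid_eq_right[OF braid_eq_inverse_left, of ?R X] on by (intro link_eq_braid_eq) auto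
  finally have "link_eq (Suc a + m) (shift_word (Suc a) w) (a + (m + 1)) (shift_word a w)"
    by (simp add: X_def M_def)
  also have "link_eq (a + (m + 1)) (shift_word a w) (a + (m + 1)) w"
    using Suc.prems by (intro Suc.IH braid_word_on_mono[OF Suc.prems]) simp
  finally show ?case by simp
qed

lemma link_eq_shift_back:
  assumes "braid_word_on m w" "a + m = M"
  shows "link_eq M w M (shift_word a w)"
  using link_eq_sym[OF link_eq_shift[OF assms(1), of a]] assms(2) by simp

text \<open>The Lorenz braid in which the \<open>i\<close>-th left strand crosses over \<open>ds ! (i - 1)\<close> right strands.\<close>

fun lorenz_braid :: "nat \<Rightarrow> nat list \<Rightarrow> braid_word" where
  "lorenz_braid a [] = []"
| "lorenz_braid a (d # ds) = lorenz_braid (a + 1) ds @ sigma_run a (d + 1)"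

lemma shift_lorenz_braid: "shift_word b (lorenz_braid a ds) = lorenz_braid (b + a) ds"
  by (induction ds arbitrary: a) (auto simp: shift_sigma_run simp del: sigma_run_0_1)

lemma braid_word_on_lorenz_braid:
  assumes "\<And>d. d \<in> set ds \<Longrightarrow> d \<le> n"
  shows "braid_word_on (a + length ds + n) (lorenz_braid a ds)"
  using assms
proof (induction ds arbitrary: a)
  case (Cons d ds)
  have "d \<le> n" using Cons.prems by simp
  moreover have "braid_word_on (a + 1 + length ds + n) (lorenz_braid (a + 1) ds)"
    by (rule Cons.IH) (use Cons.prems in auto)
  ultimately show ?case by (auto intro!: braid_word_on_sigma_run)
qed simp

text \<open>Every left strand passes over at least the first \<open>d\<close> right strands, so a
  braid of these \<open>d\<close> strands slides up past all left strands.\<close>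

lemma lorenz_braid_slide:
  assumes "\<And>l. l \<in> set u \<Longrightarrow> 1 \<le> fst l \<and> fst l < d" "\<And>d'. d' \<in> set ds \<Longrightarrow> d \<le> d'"
  shows "braid_eq (lorenz_braid a ds @ shift_word a u) (shift_word (a + length ds) u @ lorenz_braid a ds)"
  using assms(2)
proof (induction ds arbitrary: a)
  case (Cons d' ds)
  have "lorenz_braid a (d' # ds) @ shift_word a u = lorenz_braid (a + 1) ds @ (sigma_run a (d' + 1) @ shift_word a u)" by simp
  also have "braid_eq \<dots> (lorenz_braid (a + 1) ds @ (shift_word (a + 1) u @ sigma_run a (d' + 1)))"
    using assms(1) Cons.prems[of d'] by (intro braid_eq_left sigma_run_slide_word) force
  also have "\<dots> = (lorenz_braid (a + 1) ds @ shift_word (a + 1) u) @ sigma_run a (d' + 1)" by simp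
  also have "braid_eq \<dots> ((shift_word (a + 1 + length ds) u @ lorenz_braid (a + 1) ds) @ sigma_run a (d' + 1))"
    using Cons.prems by (intro braid_eq_right Cons.IH) auto
  finally show ?case by simp
qed simp

text \<open>The run of the first left strand is \<sigma>\<open>\<^sub>1\<close> followed by a run
  with shifted indices. After conjugation of that run to the top, \<sigma>\<open>\<^sub>1\<close> is
  the only letter that involves the first strand and can be destabilised. The leftover run is
  conjugated back to the bottom and slid up past the other left strands, where it joins
  \<open>W\<close>. The slide relies on sortedness, the presence of \<sigma>\<open>\<^sub>1\<close>
  on \<open>1 \<le> d\<close>.\<close>

lemma lorenz_reduce_positive:
  assumes "sorted ds" "\<And>d. d \<in> set ds \<Longrightarrow> 1 \<le> d \<and> d \<le> n" "1 \<le> n" "braid_word_on n W"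
  shows "link_eq (length ds + n) (shift_word (length ds) W @ lorenz_braid 0 ds) n (W @ concat (map (sigma_run 0) ds))"
  using assms
proof (induction ds arbitrary: W)
  case Nil
  then show ?case by (simp add: link_eq_refl)
next
  case (Cons d ds)
  let ?p = "length ds"
  let ?X = "shift_word ?p W @ lorenz_braid 0 ds"
  have d: "1 \<le> d" "d \<le> n" using Cons.prems(2)[of d] by auto
  have W: "braid_word_on (?p + n) (shift_word ?p W)" by (rule braid_word_on_shift[OF Cons.prems(4)])
  have L: "braid_word_on (?p + n) (lorenz_braid 0 ds)"
    using braid_word_on_lorenz_braid[of ds n 0] Cons.prems(2) by auto
  have R: "braid_word_on n (sigma_run 0 d)" using braid_word_on_sigma_run[of 0 d n] d by simp
  have R': "braid_word_on (?p + n) (sigma_run 0 d)" using braid_word_on_mono[OF R] by simp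
  have R'': "braid_word_on (?p + n) (shift_word ?p (sigma_run 0 d))" by (rule braid_word_on_shift[OF R])
  have run: "sigma_run 0 (d + 1) = [(1, True)] @ shift_word 1 (sigma_run 0 d)"
    using sigma_run_Cons[of d 0] d by (simp add: shift_sigma_run)
  have split: "shift_word (length (d # ds)) W @ lorenz_braid 0 (d # ds) = (shift_word 1 ?X @ [(1, True)]) @ shift_word 1 (sigma_run 0 d)"
    unfolding lorenz_braid.simps run by (simp add: shift_lorenz_braid)
  have on: "braid_word_on (length (d # ds) + n) ((shift_word 1 ?X @ [(1, True)]) @ shift_word 1 (sigma_run 0 d))"
    using braid_word_on_shift[OF W, of 1] braid_word_on_shift[OF L, of 1] braid_word_on_shift[OF R', of 1] Cons.prems(3)
    by simp
  have "link_eq (length (d # ds) + n) (shift_word (length (d # ds)) W @ lorenz_braid 0 (d # ds))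
    (length (d # ds) + n) (shift_word 1 (sigma_run 0 d) @ (shift_word 1 ?X @ [(1, True)]))"
    unfolding split by (rule link_eq_conjugate[OF on])
  also have "shift_word 1 (sigma_run 0 d) @ (shift_word 1 ?X @ [(1, True)]) = shift_word 1 (sigma_run 0 d @ ?X) @ [(1, True)]"
    by simp
  also have "length (d # ds) + n = (?p + n) + 1" by simp
  also have "link_eq ((?p + n) + 1) (shift_word 1 (sigma_run 0 d @ ?X) @ [(1, True)]) (?p + n) (sigma_run 0 d @ ?X)"
    using W L R' Cons.prems(3) by (intro link_eq_destabilize_left) auto
  also have "link_eq (?p + n) (sigma_run 0 d @ ?X) (?p + n) (?X @ sigma_run 0 d)"
    using W L R' by (intro link_eq_conjugate) auto
  also have "link_eq (?p + n) (?X @ sigma_run 0 d) (?p + n) (shift_word ?p (W @ sigma_run 0 d) @ lorenz_braid 0 ds)"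
  proof (rule link_eq_braid_eq)
    have "braid_eq (lorenz_braid 0 ds @ shift_word 0 (sigma_run 0 d)) (shift_word (0 + ?p) (sigma_run 0 d) @ lorenz_braid 0 ds)"
      using Cons.prems(1) by (intro lorenz_braid_slide[where d = d]) (auto simp: sigma_run_set)
    then show "braid_eq (?X @ sigma_run 0 d) (shift_word ?p (W @ sigma_run 0 d) @ lorenz_braid 0 ds)"
      using braid_eq_left[of _ _ "shift_word ?p W"] by fastforce
  qed (use W L R' R'' in auto)
  also have "link_eq (?p + n) (shift_word ?p (W @ sigma_run 0 d) @ lorenz_braid 0 ds) n ((W @ sigma_run 0 d) @ concat (map (sigma_run 0) ds))"
    using Cons.prems R by (intro Cons.IH) auto
  finally show ?case by simp
qed

text \<open>The first \<open>z\<close> left strands cross nothing. They are moved behind the right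
  strands, counted as right strands during the reduction, and finally moved to the front again,
  where they are the free strands of a generalised T-link.\<close>

lemma lorenz_reduce:
  fixes v :: int
  assumes "sorted ds" "\<And>d. d \<in> set ds \<Longrightarrow> 1 \<le> d \<and> d \<le> n" "1 \<le> z + n" "v \<le> 0"
  defines "p \<equiv> z + length ds"
  shows "link_eq (p + n) (word_power (half_twist p n) (2 * v) @ lorenz_braid 0 (replicate z 0 @ ds))
    (z + n) (shift_word z (concat (map (sigma_run 0) ds) @ word_power (sigma_run 0 n) (v * int n)))"
proof -
  let ?W = "word_power (sigma_run 0 n) (v * int n)"
  let ?q = "length ds" and ?C = "concat (map (sigma_run 0) ds)"
  let ?X = "shift_word ?q ?W @ lorenz_braid 0 ds"
  have W: "braid_word_on n ?W" by (intro braid_word_on_power braid_word_on_sigma_run) simp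
  have W': "braid_word_on (n + z) ?W" by (rule braid_word_on_mono[OF W]) simp
  have C: "braid_word_on n ?C" using assms(2) by (auto simp: braid_word_on_concat intro!: braid_word_on_sigma_run)
  have L: "braid_word_on (?q + n) (lorenz_braid 0 ds)"
    using braid_word_on_lorenz_braid[of ds n 0] assms(2) by auto
  have X: "braid_word_on (?q + n) ?X" using braid_word_on_shift[OF W, of ?q] L by simp
  have lorenz_braid_z: "lorenz_braid 0 (replicate z 0 @ ds) = shift_word z (lorenz_braid 0 ds)"
  proof -
    have "lorenz_braid a (replicate z 0 @ ds) = lorenz_braid (a + z) ds" for a
      by (induction z arbitrary: a) simp_all
    then show ?thesis by (simp add: shift_lorenz_braid)
  qed
  have H: "braid_eq (word_power (half_twist p n) (2 * v)) (shift_word p ?W)"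
    using word_power_full_twist[OF assms(4), of p n] by (simp add: shift_word_power shift_sigma_run)
  have "link_eq (p + n) (word_power (half_twist p n) (2 * v) @ lorenz_braid 0 (replicate z 0 @ ds)) (p + n) (shift_word z ?X)"
  proof (rule link_eq_braid_eq)
    show "braid_eq (word_power (half_twist p n) (2 * v) @ lorenz_braid 0 (replicate z 0 @ ds)) (shift_word z ?X)"
      using braid_eq_right[OF H] by (simp add: lorenz_braid_z p_def)
    have "braid_word_on (p + n) (lorenz_braid 0 (replicate z 0 @ ds))"
      using braid_word_on_lorenz_braid[of "replicate z 0 @ ds" n 0] assms(2) by (auto simp: p_def)
    then show "braid_word_on (p + n) (word_power (half_twist p n) (2 * v) @ lorenz_braid 0 (replicate z 0 @ ds))"
      by (simp add: braid_word_on_power braid_word_on_half_twist)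
    show "braid_word_on (p + n) (shift_word z ?X)"
      using braid_word_on_shift[OF X, of z] by (simp add: p_def add.assoc)
  qed
  also have "p + n = z + (?q + n)" by (simp add: p_def)
  also have "link_eq (z + (?q + n)) (shift_word z ?X) (z + (?q + n)) ?X"
    by (rule link_eq_shift[OF X])
  also have "z + (?q + n) = ?q + (n + z)" by simp
  also have "link_eq (?q + (n + z)) ?X (n + z) (?W @ ?C)"
  proof (rule lorenz_reduce_positive[OF assms(1) _ _ W'])
    show "1 \<le> d \<and> d \<le> n + z" if "d \<in> set ds" for d using assms(2)[OF that] by simp
  qed (use assms(3) in simp)
  also have "link_eq (n + z) (?W @ ?C) (n + z) (?C @ ?W)"
    using W' braid_word_on_mono[OF C, of "n + z"] by (intro link_eq_conjugate) simp
  also have "link_eq (n + z) (?C @ ?W) (n + z) (shift_word z (?C @ ?W))"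
    using C W by (intro link_eq_shift_back[of n]) auto
  finally show ?thesis by (simp add: p_def ac_simps)
qed

section \<open>Words of generalised T-links\<close>

definition T_runs :: "(nat \<times> nat) list \<Rightarrow> braid_word" where
  "T_runs rs = concat (map (\<lambda>(r, s). word_pow (sigma_run 0 r) s) rs)"

lemma T_runs_simps [simp]:
  "T_runs [] = []" "T_runs (x # rs) = word_pow (sigma_run 0 (fst x)) (snd x) @ T_runs rs"
  "T_runs (rs @ rs') = T_runs rs @ T_runs rs'"
  by (simp_all add: T_runs_def case_prod_beta)

text \<open>The run on all \<open>n\<close> strands is kept out of the list, as its exponent alone
  may be negative or zero.\<close>

definition T_exponents :: "(nat \<times> nat) list \<Rightarrow> nat \<Rightarrow> bool" where
  "T_exponents rs n \<longleftrightarrow> sorted_wrt (<) (map fst rs) \<and> (\<forall>x\<in>set rs. 2 \<le> fst x \<and> fst x < n \<and> 0 < snd x)"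

lemma braid_word_on_T_runs: "T_exponents rs n \<Longrightarrow> braid_word_on n (T_runs rs)"
  by (auto simp: T_runs_def T_exponents_def braid_word_on_concat intro!: braid_word_on_sigma_run dest!: bspec)

text \<open>The alternative for \<open>v = 0\<close> is the unlink: admissible last exponents are at
  least 2 in that case.\<close>

definition is_T_link :: "int \<Rightarrow> nat \<Rightarrow> braid_word \<Rightarrow> bool" where
  "is_T_link v m w \<longleftrightarrow>
     (\<exists>k r s d. gen_T_parameters k r s \<and> v * int (r (k + 1)) \<le> s (k + 1) \<and>
        link_eq m w (d + r (k + 1)) (gen_T_word k r s d)) \<or>
     (v = 0 \<and> (\<exists>n\<ge>1. link_eq m w n []))"

lemma is_T_link_eq: "link_eq m w n u \<Longrightarrow> is_T_link v n u \<Longrightarrow> is_T_link v m w"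
  unfolding is_T_link_def using link_eq_trans by blast

lemma gen_T_word_runs:
  assumes "length rs = k" "\<And>i. i \<in> {1..k} \<Longrightarrow> r i = fst (rs ! (i - 1)) \<and> s i = int (snd (rs ! (i - 1)))"
  shows "gen_T_word k r s d = shift_word d (T_runs rs @ word_power (sigma_run 0 (r (k + 1))) (s (k + 1)))"
proof -
  have "map (\<lambda>i. word_power (sigma_run d (r i)) (s i)) [1..<k + 1] =
      map (\<lambda>(r, s). word_pow (sigma_run d r) s) rs"
  proof (rule nth_equalityI)
    fix i assume "i < length (map (\<lambda>i. word_power (sigma_run d (r i)) (s i)) [1..<k + 1])"
    then have i: "i < k" by (simp del: upt_Suc)
    then show "map (\<lambda>i. word_power (sigma_run d (r i)) (s i)) [1..<k + 1] ! i =
      map (\<lambda>(r, s). word_pow (sigma_run d r) s) rs ! i"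
      using assms(2)[of "Suc i"] assms(1)
      by (simp add: case_prod_beta word_power_of_nat del: upt_Suc)
  qed (use assms(1) in simp)
  moreover have "[1..<k + 2] = [1..<k + 1] @ [k + 1]" by simp
  moreover have "map (\<lambda>(r, s). word_pow (sigma_run d r) s) rs =
      map (shift_word d) (map (\<lambda>(r, s). word_pow (sigma_run 0 r) s) rs)"
    by (simp add: case_prod_beta shift_word_pow shift_sigma_run)
  ultimately show ?thesis
    unfolding gen_T_word_def T_runs_def
    by (simp add: shift_word_concat shift_word_power shift_sigma_run del: upt_Suc map_map)
qed

lemma is_T_link_standard:
  assumes rs: "T_exponents rs n" and n: "2 \<le> n" and e: "e \<notin> {-1, 0, 1}" "v * int n \<le> e"
  shows "is_T_link v (a + n) (shift_word a (T_runs rs @ word_power (sigma_run 0 n) e))"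
proof -
  let ?k = "length rs"
  define r where "r i = (if i \<le> ?k then fst (rs ! (i - 1)) else n)" for i
  define s where "s i = (if i \<le> ?k then int (snd (rs ! (i - 1))) else e)" for i
  have nth: "2 \<le> fst (rs ! i) \<and> fst (rs ! i) < n \<and> 0 < snd (rs ! i)" if "i < ?k" for i
    using rs nth_mem[OF that] by (auto simp: T_exponents_def)
  have mono: "fst (rs ! i) < fst (rs ! Suc i)" if "Suc i < ?k" for i
    using rs that unfolding T_exponents_def by (auto simp: sorted_wrt_iff_nth_less)
  have "gen_T_parameters ?k r s"
    unfolding gen_T_parameters_def
  proof (intro conjI ballI)
    show "2 \<le> r 1" using nth[of 0] n by (cases rs) (auto simp: r_def)
    show "s (?k + 1) \<notin> {-1, 0, 1}" using e by (simp add: s_def)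
    fix i assume i: "i \<in> {1..?k}"
    then show "0 < s i" using nth[of "i - 1"] by (auto simp: s_def)
    show "r i < r (i + 1)"
    proof (cases "i = ?k")
      case True
      then show ?thesis using nth[of "i - 1"] i by (auto simp: r_def)
    next
      case False
      then show ?thesis using mono[of "i - 1"] i by (auto simp: r_def)
    qed
  qed
  moreover have "gen_T_word ?k r s a = shift_word a (T_runs rs @ word_power (sigma_run 0 n) e)"
    by (subst gen_T_word_runs[of rs]) (auto simp: r_def s_def)
  moreover have "braid_word_on (a + n) (shift_word a (T_runs rs @ word_power (sigma_run 0 n) e))"
    using braid_word_on_T_runs[OF rs] braid_word_on_power[OF braid_word_on_sigma_run[of 0 n n]]
    by (intro braid_word_on_shift) simp
  moreover have "r (?k + 1) = n" "s (?k + 1) = e" by (simp_all add: r_def s_def)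
  ultimately show ?thesis
    unfolding is_T_link_def using e(2) link_eq_refl by metis
qed

text \<open>A run with exponent 1 or -1 contains its last generator only once, so one strand after
  the other can be destabilised until the strands of \<open>X\<close> are reached.\<close>

lemma destabilize_run:
  assumes "r \<le> n" "1 \<le> r" "braid_word_on r X" "e = 1 \<or> e = - 1"
  shows "link_eq (a + n) (shift_word a (X @ word_power (sigma_run 0 n) e))
    (a + r) (shift_word a (X @ word_power (sigma_run 0 r) e))"
  using assms(1)
proof (induction n rule: dec_induct)
  case base
  have "braid_word_on r (X @ word_power (sigma_run 0 r) e)"
    using assms braid_word_on_power[OF braid_word_on_sigma_run[of 0 r r]] by simp
  then show ?case by (intro link_eq_refl braid_word_on_shift)
next
  case (step n)
  have n: "1 \<le> n" using step assms(2) by simp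
  have X: "braid_word_on n X" by (rule braid_word_on_mono[OF assms(3)]) (use step in simp)
  have R: "braid_word_on n (sigma_run 0 n)" by (rule braid_word_on_sigma_run) simp
  have XR: "braid_word_on (a + n) (shift_word a X)" "braid_word_on (a + n) (shift_word a (sigma_run 0 n))"
    "braid_word_on (a + n) (shift_word a (word_inverse (sigma_run 0 n)))"
    using X R by (intro braid_word_on_shift, simp)+
  have XR': "braid_word_on (a + n + 1) (shift_word a X)" "braid_word_on (a + n + 1) (shift_word a (word_inverse (sigma_run 0 n)))"
    using XR braid_word_on_mono[of "a + n" _ "a + n + 1"] by auto
  have "link_eq (a + n + 1) (shift_word a (X @ word_power (sigma_run 0 (Suc n)) e))
    (a + n) (shift_word a (X @ word_power (sigma_run 0 n) e))"
  proof (cases "e = 1")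
    case True
    have "shift_word a (X @ word_power (sigma_run 0 (Suc n)) e) = shift_word a (X @ sigma_run 0 n) @ [(a + n, True)]"
      using n by (simp add: True word_power_def sigma_run_snoc add.commute)
    moreover have "link_eq (a + n + 1) (shift_word a (X @ sigma_run 0 n) @ [(a + n, True)]) (a + n) (shift_word a (X @ sigma_run 0 n))"
      using XR n by (intro link_eq_destabilize) auto
    ultimately show ?thesis by (simp add: True word_power_def)
  next
    case False
    then have e: "e = - 1" using assms(4) by simp
    let ?I = "shift_word a (word_inverse (sigma_run 0 n))"
    have "shift_word a (X @ word_power (sigma_run 0 (Suc n)) e) = (shift_word a X @ [(a + n, False)]) @ ?I"
      using n by (simp add: e word_power_def sigma_run_snoc add.commute)
    moreover have "link_eq (a + n + 1) ((shift_word a X @ [(a + n, False)]) @ ?I) (a + n + 1) (?I @ (shift_word a X @ [(a + n, False)]))"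
      using XR' n by (intro link_eq_conjugate) simp
    moreover have "link_eq (a + n + 1) ((?I @ shift_word a X) @ [(a + n, False)]) (a + n) (?I @ shift_word a X)"
      using XR n by (intro link_eq_destabilize) auto
    moreover have "link_eq (a + n) (?I @ shift_word a X) (a + n) (shift_word a X @ ?I)"
      using XR by (intro link_eq_conjugate) auto
    ultimately show ?thesis
      using link_eq_trans by (simp add: e word_power_def)
  qed
  then show ?case using step.IH link_eq_trans by simp
qed

text \<open>For \<open>v < 0\<close> the unlink with \<open>c\<close> components is \<open>T((2,2),(3,-2),c-1)\<close>.\<close>

lemma is_T_link_unlink:
  assumes "1 \<le> c" "v \<le> 0" 
  shows "is_T_link v c []"
proof (cases "v = 0")
  case True
  then show ?thesis unfolding is_T_link_def using assms(1) link_eq_refl[of c "[]"] by auto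
next
  case False
  define a where "a = c - 1"
  have c: "c = a + 1" using assms by (simp add: a_def)
  let ?p = "\<lambda>i. (a + i, True)" and ?n = "\<lambda>i. (a + i, False)"
  \<comment> \<open>For \<open>v \<le> -1\<close> the bound \<open>3 v \<le> -2\<close> on the last
    exponent holds; for \<open>v = 0\<close> it would fail.\<close>
  have T: "is_T_link v (a + 3) (shift_word a (T_runs [(2, 2)] @ word_power (sigma_run 0 3) (- 2)))"
    using False assms by (intro is_T_link_standard) (auto simp: T_exponents_def)
  have r2: "sigma_run 0 2 = [(1, True)]" by (simp add: sigma_run_def)
  have r3: "sigma_run 0 3 = [(1, True), (2, True)]" by (simp add: sigma_run_def upt_rec)
  have w: "shift_word a (T_runs [(2, 2)] @ word_power (sigma_run 0 3) (- 2)) =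
      [?p 1, ?p 1, ?n 2, ?n 1, ?n 2] @ [?n 1]"
  proof -
    have "word_power u (- 2) = word_inverse u @ word_inverse u" "word_pow u 2 = u @ u" for u
      by (simp_all add: word_power_def numeral_2_eq_2)
    then show ?thesis by (simp add: r2[unfolded numeral_2_eq_2] r3 add.commute numeral_2_eq_2)
  qed
  have "link_eq (a + 3) ([?p 1, ?p 1, ?n 2, ?n 1, ?n 2] @ [?n 1]) (a + 3) ([?n 1] @ [?p 1, ?p 1, ?n 2, ?n 1, ?n 2])"
    by (rule link_eq_conjugate) simp
  also have "link_eq (a + 3) ([?n 1] @ [?p 1, ?p 1, ?n 2, ?n 1, ?n 2]) (a + 3) [?n 2, ?n 1]"
  proof (rule link_eq_braid_eq)
    \<comment> \<open>One cancellation, the braid relation for the inverse generators and a second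
      cancellation leave a run on three strands with exponent -1, which destabilises to a single
      strand.\<close>
    have "braid_eq ([] @ [?n 1, ?p 1] @ [?p 1, ?n 2, ?n 1, ?n 2]) ([] @ [] @ [?p 1, ?n 2, ?n 1, ?n 2])"
      using braid_eq_cancel[of "a + 1" False] by (intro braid_eq_cong) simp
    also have "[] @ [] @ [?p 1, ?n 2, ?n 1, ?n 2] = [?p 1] @ [?n 2, ?n 1, ?n 2] @ []" by simp
    also have "braid_eq \<dots> ([?p 1] @ [?n 1, ?n 2, ?n 1] @ [])"
      by (intro braid_eq_cong braid_eq_layered[where h = real])
        (auto simp: fun_eq_iff letter_swap_def Transposition.transpose_def inj_def)
    also have "\<dots> = [] @ [?p 1, ?n 1] @ [?n 2, ?n 1]" by simp
    also have "braid_eq \<dots> ([] @ [] @ [?n 2, ?n 1])"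
      using braid_eq_cancel[of "a + 1" True] by (intro braid_eq_cong) simp
    finally show "braid_eq ([?n 1] @ [?p 1, ?p 1, ?n 2, ?n 1, ?n 2]) [?n 2, ?n 1]" by simp
  qed simp_all
  also have "[?n 2, ?n 1] = shift_word a ([] @ word_power (sigma_run 0 3) (- 1))"
    by (simp add: r3 word_power_def add.commute)
  also have "link_eq (a + 3) \<dots> (a + 1) (shift_word a ([] @ word_power (sigma_run 0 1) (- 1)))"
    by (rule destabilize_run) auto
  finally have "link_eq (a + 3) (shift_word a (T_runs [(2, 2)] @ word_power (sigma_run 0 3) (- 2))) c []"
    unfolding w by (simp add: c word_power_def)
  then show ?thesis using is_T_link_eq[OF link_eq_sym] T by blast
qed

lemma word_power_0 [simp]: "word_power w 0 = []"
  by (simp add: word_power_def)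

lemma word_power_Nil [simp]: "word_power [] n = []"
  by (simp add: word_power_def)

lemma word_power_add_right:
  "braid_eq (word_power w (int m) @ word_power w (- int n)) (word_power w (int m - int n))"
proof -
  have p: "word_power (word_inverse w) (- k) = word_power w k" for k
    by (auto simp: word_power_def)
  have "braid_eq (word_power (word_inverse w) (- int m) @ word_power (word_inverse w) (int n)) (word_power (word_inverse w) (int n - int m))"
    by (rule word_power_add)
  then show ?thesis using p[of "int m"] p[of "- int n"] p[of "int m - int n"] by simp
qed

text \<open>Exponents \<open>0\<close> and \<open>\<plusminus>1\<close> of the last run are not allowed in a generalised T-link; such a run is
  removed or destabilised to the length of the previous one.\<close>

lemma is_T_link_runs:
  assumes "T_exponents rs n" "1 \<le> n" "v * int n \<le> e" "v \<le> 0"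
  shows "is_T_link v (a + n) (shift_word a (T_runs rs @ word_power (sigma_run 0 n) e))"
  using assms
proof (induction rs arbitrary: n e a rule: rev_induct)
  case Nil
  consider "n = 1" | "e = 0" | "e = 1 \<or> e = - 1" | "2 \<le> n" "e \<notin> {-1, 0, 1}" using Nil.prems(2) by fastforce
  then show ?case
  proof cases
    case 1
    then show ?thesis using is_T_link_unlink[of "a + 1" v] Nil.prems by simp
  next
    case 2
    then show ?thesis using is_T_link_unlink[of "a + n" v] Nil.prems by simp
  next
    case 3
    have "link_eq (a + n) (shift_word a ([] @ word_power (sigma_run 0 n) e)) (a + 1) (shift_word a ([] @ word_power (sigma_run 0 1) e))"
      using 3 Nil.prems by (intro destabilize_run) auto
    then show ?thesis using is_T_link_unlink[of "a + 1" v] is_T_link_eq Nil.prems by simp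
  next
    case 4
    then show ?thesis using is_T_link_standard Nil.prems by blast
  qed
next
  case (snoc x rs)
  obtain r s where x: "x = (r, s)" by fastforce
  have T: "T_exponents rs r" and r: "2 \<le> r" "r < n" "0 < s"
    using snoc.prems(1) by (auto simp: T_exponents_def x sorted_wrt_append)
  \<comment> \<open>Only nonnegative exponents are passed down, namely \<open>s\<close>,
    \<open>s + 1\<close> or \<open>s - 1\<close> with \<open>s > 0\<close>; these satisfy the bound
    because \<open>v r \<le> 0\<close>.\<close>
  have IH: "is_T_link v (b + r) (shift_word b (T_runs rs @ word_power (sigma_run 0 r) f))" if "0 \<le> f" for b f
  proof (rule snoc.IH[OF T])
    have "v * int r \<le> 0" using snoc.prems(4) by (simp add: mult_nonpos_nonneg)
    then show "v * int r \<le> f" using that by simp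
  qed (use r snoc.prems in auto)
  have runs: "T_runs (rs @ [x]) = T_runs rs @ word_power (sigma_run 0 r) (int s)"
    by (simp add: x word_power_of_nat)
  have X: "braid_word_on r (T_runs rs @ word_power (sigma_run 0 r) (int s))"
    using braid_word_on_T_runs[OF T] braid_word_on_power[OF braid_word_on_sigma_run[of 0 r r]] by simp
  have Rn: "braid_word_on r (word_power (sigma_run 0 r) e)" for e
    by (intro braid_word_on_power braid_word_on_sigma_run) simp
  consider "e = 0" | "e = 1 \<or> e = - 1" | "e \<notin> {-1, 0, 1}" by fastforce
  then show ?case
  proof cases
    case 1
    \<comment> \<open>Once the run on \<open>n\<close> strands is gone, \<open>n - r\<close> further
      strands are free and join the \<open>a\<close> free ones.\<close>
    define b where "b = a + n - r"
    have b: "a + n = b + r" using r by (simp add: b_def)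
    let ?X = "T_runs rs @ word_power (sigma_run 0 r) (int s)"
    have Xn: "braid_word_on n ?X" by (rule braid_word_on_mono[OF X]) (use r in simp)
    have "link_eq (a + n) (shift_word a ?X) (a + n) ?X" by (rule link_eq_shift[OF Xn])
    also have "link_eq (a + n) ?X (a + n) (shift_word b ?X)"
      by (rule link_eq_shift_back[OF X]) (simp add: b)
    finally have "link_eq (a + n) (shift_word a ?X) (b + r) (shift_word b ?X)" by (simp add: b)
    then show ?thesis using is_T_link_eq IH[of "int s" b] 1 runs by simp
  next
    case 2
    let ?X = "T_runs rs @ word_power (sigma_run 0 r) (int s)"
    have "link_eq (a + n) (shift_word a (?X @ word_power (sigma_run 0 n) e)) (a + r) (shift_word a (?X @ word_power (sigma_run 0 r) e))"
      using 2 r X by (intro destabilize_run) auto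
    also have "link_eq (a + r) (shift_word a (?X @ word_power (sigma_run 0 r) e)) (a + r) (shift_word a (T_runs rs @ word_power (sigma_run 0 r) (int s + e)))"
    proof -
      have eq: "braid_eq (word_power (sigma_run 0 r) (int s) @ word_power (sigma_run 0 r) e) (word_power (sigma_run 0 r) (int s + e))"
      proof (cases "e = 1")
        case True
        have "int s + e = int (s + 1)" "e = int 1" by (simp_all add: True)
        then show ?thesis by (simp only: word_power_of_nat word_pow_add braid_eq_refl)
      next
        case False
        then have "e = - int 1" using 2 by simp
        then show ?thesis using word_power_add_right[of "sigma_run 0 r" s 1] by simp
      qed
      let ?Y = "T_runs rs @ word_power (sigma_run 0 r) (int s + e)"
      have "link_eq (a + r) (shift_word a (?X @ word_power (sigma_run 0 r) e)) (a + r) (?X @ word_power (sigma_run 0 r) e)"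
        using X Rn by (intro link_eq_shift) auto
      also have "link_eq (a + r) (?X @ word_power (sigma_run 0 r) e) (a + r) ?Y"
        using braid_eq_left[OF eq, of "T_runs rs"] X Rn braid_word_on_mono[of r _ "a + r"]
        by (intro link_eq_braid_eq) auto
      also have "link_eq (a + r) ?Y (a + r) (shift_word a ?Y)"
        using X Rn by (intro link_eq_shift_back[of r]) auto
      finally show ?thesis .
    qed
    finally show ?thesis using is_T_link_eq IH[of "int s + e" a] 2 r runs by auto
  next
    case 3
    then show ?thesis using is_T_link_standard[OF snoc.prems(1) _ _ snoc.prems(3)] r by simp
  qed
qed

section \<open>The permutation of a Lorenz braid\<close>

text \<open>The left fold appends transpositions at the end; splitting off the one of the first
  letter permits induction on words and shows \<open>strand_at\<close> to be inverse to
  \<open>word_pos\<close>.\<close>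

lemma strand_at_simps [simp]:
  "strand_at [] = id" "strand_at (l # w) = letter_swap l \<circ> strand_at w"
proof -
  define F where "F = (\<lambda>\<pi> (i :: nat, e :: bool). \<pi> \<circ> Transposition.transpose i (i + 1) :: nat \<Rightarrow> nat)"
  have F: "F \<pi> l = \<pi> \<circ> letter_swap l" for \<pi> l by (cases l) (simp add: F_def letter_swap_def)
  have strand: "strand_at w = foldl F id w" for w by (simp only: strand_at_def F_def)
  have "foldl F \<rho> w = \<rho> \<circ> foldl F id w" for \<rho> w
  proof (induction w arbitrary: \<rho>)
    case (Cons l w)
    show ?case
      using Cons.IH[of "\<rho> \<circ> letter_swap l"] Cons.IH[of "id \<circ> letter_swap l"]
      by (simp only: foldl_Cons F comp_assoc id_comp)
  qed simp
  from this[of "id \<circ> letter_swap l" w] show "strand_at (l # w) = letter_swap l \<circ> strand_at w"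
    by (simp only: strand foldl_Cons F id_comp)
qed (simp add: strand_at_def)

lemma strand_at_append: "strand_at (u @ v) = strand_at u \<circ> strand_at v"
  by (induction u) (auto simp: fun_eq_iff)

lemma word_pos_strand_at: "word_pos w (strand_at w q) = q"
  by (induction w arbitrary: q) auto

lemma strand_at_word_pos: "strand_at w (word_pos w j) = j"
  by (induction w arbitrary: j) auto

lemma bij_strand_at: "braid_word_on m w \<Longrightarrow> bij_betw (strand_at w) {1..m} {1..m}"
proof (induction w)
  case (Cons l w)
  then show ?case
    using bij_betw_trans[OF Cons.IH bij_letter_swap[of l m]] by (simp add: o_def)
qed simp

lemma strand_at_outside: "braid_word_on m w \<Longrightarrow> q \<notin> {1..m} \<Longrightarrow> strand_at w q = q"
  by (induction w) (auto simp: letter_swap_def Transposition.transpose_def)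

text \<open>Lorenz words are specified through starting positions of strands, \<open>layered\<close>
  through current ones; \<open>strand_at\<close> translates between them.\<close>

lemma layered_positive:
  assumes "\<And>k. k < length w \<Longrightarrow> snd (w ! k) \<and>
    h (strand_at (take k w) (fst (w ! k) + 1)) < h (strand_at (take k w) (fst (w ! k)))"
  shows "layered h w"
  using assms
proof (induction w arbitrary: h)
  case (Cons l w)
  have "layered (h \<circ> letter_swap l) w"
    using Cons.prems[of "Suc _"] by (intro Cons.IH) simp
  then show ?case using Cons.prems[of 0] by simp
qed simp

text \<open>At the first disagreement, the smaller of the two values would have to be taken by the
  other map at an earlier point, where the maps still agree.\<close>

lemma strict_mono_on_image_unique:
  fixes g h :: "nat \<Rightarrow> nat"
  assumes "strict_mono_on C g" "strict_mono_on C h" "g ` C = h ` C" "x \<in> C"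
  shows "g x = h x"
  using assms(4)
proof (induction x rule: less_induct)
  case (less x)
  have *: False if mono: "strict_mono_on C g" "strict_mono_on C h" and eq: "g ` C = h ` C"
    and IH: "\<And>y. y < x \<Longrightarrow> y \<in> C \<Longrightarrow> g y = h y" and lt: "g x < h x" for g h :: "nat \<Rightarrow> nat"
  proof -
    obtain y where y: "y \<in> C" "g x = h y" using eq less.prems by (metis imageE imageI)
    then have "y < x"
      using mono(2) lt less.prems
      by (metis strict_mono_onD linorder_neqE_nat less_asym less_irrefl)
    then show False
      using IH[of y] y strict_mono_onD[OF mono(1) y(1) less.prems] by simp
  qed
  show ?case
    using *[OF assms(1,2,3) less.IH] *[OF assms(2,1) assms(3)[symmetric]] less.IH
    by (metis linorder_neqE_nat)
qed

lemma lorenz_lambda_word_on: "lorenz_lambda_word N p f w \<Longrightarrow> braid_word_on N w"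
  unfolding lorenz_lambda_word_def braid_word_on_def by auto

text \<open>The left strands are the upper ones and have the smaller starting positions, so every
  such word is layered for the heights \<open>- j\<close>, and layered words with the same
  permutation are equal. The permutation is given by \<open>f\<close> on the left strands and by
  monotonicity on the right strands.\<close>

lemma lorenz_lambda_unique:
  assumes w: "lorenz_lambda_word N p f w" and w': "lorenz_lambda_word N p f w'"
    and f: "f ` {1..p} \<subseteq> {1..N}"
  shows "braid_eq w w'"
proof (rule braid_eq_layered[where h = "\<lambda>j. - real j"])
  have lay: "layered (\<lambda>j. - real j) w" if "lorenz_lambda_word N p f w" for w
  proof (rule layered_positive)
    fix k assume k: "k < length w"
    have "snd (w ! k)" using that nth_mem[OF k] unfolding lorenz_lambda_word_def by (auto simp: case_prod_beta)
    moreover have "strand_at (take k w) (fst (w ! k)) \<in> {1..p}" "strand_at (take k w) (fst (w ! k) + 1) \<in> {p + 1..N}"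
      using that k unfolding lorenz_lambda_word_def by blast+
    ultimately show "snd (w ! k) \<and>
      - real (strand_at (take k w) (fst (w ! k) + 1)) < - real (strand_at (take k w) (fst (w ! k)))" by simp
  qed
  show "layered (\<lambda>j. - real j) w" "layered (\<lambda>j. - real j) w'" using lay w w' by blast+
  let ?C = "{1..N} - f ` {1..p}"
  have img: "strand_at w ` ?C = {1..N} - {1..p}" if w: "lorenz_lambda_word N p f w" for w
  proof -
    have bij: "bij_betw (strand_at w) {1..N} {1..N}" by (rule bij_strand_at[OF lorenz_lambda_word_on[OF w]])
    have "strand_at w (f i) = i" if "i \<in> {1..p}" for i using w that unfolding lorenz_lambda_word_def by blast
    then have "strand_at w ` f ` {1..p} = {1..p}" by (force simp: image_image)
    then show ?thesis
      using inj_on_image_set_diff[OF bij_betw_imp_inj_on[OF bij], of "{1..N}" "f ` {1..p}"] f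
        bij_betw_imp_surj_on[OF bij] by simp
  qed
  have "strand_at w q = strand_at w' q" for q
  proof -
    consider "q \<notin> {1..N}" | "q \<in> f ` {1..p}" | "q \<in> ?C" by blast
    then show ?thesis
    proof cases
      case 1
      then show ?thesis using strand_at_outside lorenz_lambda_word_on w w' by metis
    next
      case 2
      then show ?thesis using w w' unfolding lorenz_lambda_word_def by auto
    next
      case 3
      show ?thesis
      proof (rule strict_mono_on_image_unique[OF _ _ _ 3])
        show "strict_mono_on ?C (strand_at w)" "strict_mono_on ?C (strand_at w')"
          using w w' unfolding lorenz_lambda_word_def by blast+
        show "strand_at w ` ?C = strand_at w' ` ?C" using img w w' by simp
      qed
    qed
  qed
  then have eq: "strand_at w = strand_at w'" by blast
  show "word_pos w = word_pos w'"
  proof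
    fix j
    show "word_pos w j = word_pos w' j"
      using word_pos_strand_at[of w "word_pos w' j"] strand_at_word_pos[of w' j] eq by simp
  qed
qed (simp add: inj_def)

text \<open>Each crossing is recorded by the starting positions of its two strands, so that crossing
  at most once becomes distinctness of a list that is easy to compute for runs.\<close>

primrec crossings :: "braid_word \<Rightarrow> (nat \<times> nat) list" where
  "crossings [] = []"
| "crossings (l # w) = (fst l, fst l + 1) # map (map_prod (letter_swap l) (letter_swap l)) (crossings w)"

lemma length_crossings [simp]: "length (crossings w) = length w"
  by (induction w) auto

lemma crossings_nth:
  "k < length w \<Longrightarrow> crossings w ! k = (strand_at (take k w) (fst (w ! k)), strand_at (take k w) (fst (w ! k) + 1))"
  by (induction w arbitrary: k) (auto simp: nth_Cons split: nat.split)

lemma crossings_append: "crossings (u @ v) = crossings u @ map (map_prod (strand_at u) (strand_at u)) (crossings v)"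
  by (induction u) (auto simp: prod.map_comp)

lemma letter_swap_shift: "letter_swap (i + a, e) (q + a) = letter_swap (i, f) q + a"
  by (simp add: letter_swap_def Transposition.transpose_def)

lemma strand_at_shift: "strand_at (shift_word a w) (q + a) = strand_at w q + a"
proof (induction w arbitrary: q)
  case (Cons l w)
  then show ?case using letter_swap_shift[of "fst l" a "snd l" _ "snd l"] by simp
qed simp

lemma strand_at_shift_fixed:
  assumes "\<And>l. l \<in> set w \<Longrightarrow> 1 \<le> fst l" "q \<le> a"
  shows "strand_at (shift_word a w) q = q"
  using assms(1)
proof (induction w)
  case (Cons l w)
  have "letter_swap (fst l + a, snd l) q = q"
    using Cons.prems[of l] assms(2) by (auto simp: letter_swap_def Transposition.transpose_def)
  then show ?case using Cons by simp
qed simp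

lemma crossings_shift: "crossings (shift_word a w) = map (map_prod (\<lambda>q. q + a) (\<lambda>q. q + a)) (crossings w)"
proof (induction w)
  case (Cons l w)
  have "letter_swap (fst l + a, snd l) (q + a) = letter_swap l q + a" for q
    using letter_swap_shift[of "fst l" a "snd l" q "snd l"] by simp
  then show ?case using Cons by (auto simp: prod.map_comp o_def)
qed simp

lemma strand_at_run:
  "strand_at (sigma_run 0 (d + 1)) q = (if q = d + 1 then 1 else if 1 \<le> q \<and> q \<le> d then q + 1 else q)"
proof (induction d arbitrary: q)
  case (Suc d)
  have run: "sigma_run 0 (Suc d + 1) = sigma_run 0 (d + 1) @ [(d + 1, True)]"
    using sigma_run_snoc[of "d + 1" 0] by simp
  show ?case
    unfolding run strand_at_append
    using Suc.IH by (auto simp: letter_swap_def Transposition.transpose_def)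
qed simp

lemma crossings_run: "crossings (sigma_run 0 (d + 1)) = map (\<lambda>j. (1, j + 1)) [1..<d + 1]"
proof (induction d)
  case (Suc d)
  have run: "sigma_run 0 (Suc d + 1) = sigma_run 0 (d + 1) @ [(d + 1, True)]"
    using sigma_run_snoc[of "d + 1" 0] by simp
  show ?case
    unfolding run crossings_append Suc.IH using strand_at_run[of d "d + 1"] strand_at_run[of d "d + 2"] by simp
qed simp

text \<open>Names the right strands that the next left strand is going to cross: if every left
  strand ends beyond position \<open>q\<close>, that position is left to right strand number
  \<open>q\<close>.\<close>

lemma strand_at_lorenz_braid_low:
  assumes "\<And>d. d \<in> set ds \<Longrightarrow> q \<le> d" "1 \<le> q"
  shows "strand_at (lorenz_braid 0 ds) q = length ds + q"
  using assms(1)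
proof (induction ds)
  case (Cons d ds)
  have "lorenz_braid 0 (d # ds) = shift_word 1 (lorenz_braid 0 ds) @ sigma_run 0 (d + 1)" by (simp add: shift_lorenz_braid)
  then have "strand_at (lorenz_braid 0 (d # ds)) q = strand_at (shift_word 1 (lorenz_braid 0 ds)) (q + 1)"
    using strand_at_run[of d q] Cons.prems[of d] assms(2) by (simp add: strand_at_append del: lorenz_braid.simps)
  then show ?case using strand_at_shift[of 1 "lorenz_braid 0 ds" q] Cons by simp
qed simp

text \<open>Induction on the left strands: a new first strand shifts the crossings of the others by
  one and afterwards passes over the first \<open>d\<close> right strands in their order.\<close>

lemma lorenz_braid_strands:
  assumes "sorted ds" "\<And>d. d \<in> set ds \<Longrightarrow> d \<le> n"
  shows "(\<forall>i\<in>{1..length ds}. strand_at (lorenz_braid 0 ds) (i + ds ! (i - 1)) = i) \<and>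
    strict_mono_on ({1..length ds + n} - (\<lambda>i. i + ds ! (i - 1)) ` {1..length ds}) (strand_at (lorenz_braid 0 ds)) \<and>
    distinct (crossings (lorenz_braid 0 ds)) \<and>
    (\<forall>c\<in>set (crossings (lorenz_braid 0 ds)). fst c \<in> {1..length ds} \<and> snd c \<in> {length ds + 1..length ds + n})"
  using assms
proof (induction ds)
  case Nil
  then show ?case by (simp add: strict_mono_on_def)
next
  case (Cons d ds)
  let ?p = "length ds"
  let ?f = "\<lambda>i. i + ds ! (i - 1)" and ?f' = "\<lambda>i. i + (d # ds) ! (i - 1)"
  define g where "g = strand_at (lorenz_braid 0 ds)"
  define G where "G = strand_at (shift_word 1 (lorenz_braid 0 ds))"
  have dn: "d \<le> n" and d_le: "\<And>d'. d' \<in> set ds \<Longrightarrow> d \<le> d'" using Cons.prems by auto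
  have IH: "\<And>i. i \<in> {1..?p} \<Longrightarrow> g (?f i) = i" "strict_mono_on ({1..?p + n} - ?f ` {1..?p}) g"
    "distinct (crossings (lorenz_braid 0 ds))"
    "\<And>c. c \<in> set (crossings (lorenz_braid 0 ds)) \<Longrightarrow> fst c \<in> {1..?p} \<and> snd c \<in> {?p + 1..?p + n}"
    using Cons unfolding g_def by auto
  have lorenz_braid: "lorenz_braid 0 (d # ds) = shift_word 1 (lorenz_braid 0 ds) @ sigma_run 0 (d + 1)" by (simp add: shift_lorenz_braid)
  have letters: "1 \<le> fst l" if "l \<in> set (lorenz_braid 0 ds)" for l
    using braid_word_on_lorenz_braid[of ds n 0] Cons.prems(2) that by (auto simp: braid_word_on_def)
  have G1: "G 1 = 1" unfolding G_def by (rule strand_at_shift_fixed[OF letters]) simp_all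
  have GS: "G (q + 1) = g q + 1" for q unfolding G_def g_def by (rule strand_at_shift)
  have S: "strand_at (lorenz_braid 0 (d # ds)) q = G (if q = d + 1 then 1 else if 1 \<le> q \<and> q \<le> d then q + 1 else q)" for q
    unfolding lorenz_braid strand_at_append G_def using strand_at_run[of d q] by simp
  have ge: "d \<le> ds ! (i - 1)" if "i \<in> {1..?p}" for i using that by (intro d_le nth_mem) auto
  have 1: "strand_at (lorenz_braid 0 (d # ds)) (?f' i) = i" if i: "i \<in> {1..length (d # ds)}" for i
  proof (cases "i = 1")
    case True
    then show ?thesis using S[of "d + 1"] G1 by simp
  next
    case False
    define j where "j = i - 1"
    have j: "j \<in> {1..?p}" "i = j + 1" using i False by (auto simp: j_def)
    have "?f' i = ?f j + 1" using j by (auto simp: nth_Cons split: nat.split)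
    moreover have "d + 1 < ?f j + 1" using ge[OF j(1)] j(1) by auto
    ultimately show ?thesis using S[of "?f j + 1"] GS[of "?f j"] IH(1)[OF j(1)] j(2) by simp
  qed
  have 2: "strict_mono_on ({1..length (d # ds) + n} - ?f' ` {1..length (d # ds)}) (strand_at (lorenz_braid 0 (d # ds)))"
  proof (rule strict_mono_onI)
    fix x y assume x: "x \<in> {1..length (d # ds) + n} - ?f' ` {1..length (d # ds)}"
      and y: "y \<in> {1..length (d # ds) + n} - ?f' ` {1..length (d # ds)}" and xy: "x < y"
    \<comment> \<open>\<open>c\<close> removes the final position \<open>d + 1\<close> of the new
      strand and closes the gap, which turns positions into those of the shorter braid.\<close>
    define c where "c x = (if x \<le> d then x else x - 1)" for x :: nat
    have c: "c x \<in> {1..?p + n} - ?f ` {1..?p}" "strand_at (lorenz_braid 0 (d # ds)) x = g (c x) + 1" "x \<noteq> d + 1"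
      if x: "x \<in> {1..length (d # ds) + n} - ?f' ` {1..length (d # ds)}" for x
    proof -
      have notf: "x \<noteq> ?f' i" if "i \<in> {1..length (d # ds)}" for i using x that by blast
      show xd: "x \<noteq> d + 1" using notf[of 1] by simp
      have "c x \<noteq> ?f j" if j: "j \<in> {1..?p}" for j
      proof
        assume e: "c x = ?f j"
        have "d < ?f j" using ge[OF j] j by auto
        then have "x = ?f j + 1" using e by (auto simp: c_def split: if_splits)
        also have "\<dots> = ?f' (j + 1)" using j by (auto simp: nth_Cons split: nat.split)
        finally have "x = ?f' (j + 1)" .
        moreover have "j + 1 \<in> {1..length (d # ds)}" using j by simp
        ultimately show False using notf by blast
      qed
      moreover have "c x \<in> {1..?p + n}" using x xd dn by (auto simp: c_def)
      ultimately show "c x \<in> {1..?p + n} - ?f ` {1..?p}" by blast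
      show "strand_at (lorenz_braid 0 (d # ds)) x = g (c x) + 1"
      proof (cases "x \<le> d")
        case True
        then show ?thesis using S[of x] GS[of x] x by (simp add: c_def)
      next
        case False
        then show ?thesis using S[of x] GS[of "x - 1"] xd by (simp add: c_def)
      qed
    qed
    have "c x < c y" using xy c(3)[OF x] c(3)[OF y] by (auto simp: c_def)
    then show "strand_at (lorenz_braid 0 (d # ds)) x < strand_at (lorenz_braid 0 (d # ds)) y"
      using strict_mono_onD[OF IH(2) c(1)[OF x] c(1)[OF y]] c(2)[OF x] c(2)[OF y] by simp
  qed
  have cr: "crossings (lorenz_braid 0 (d # ds)) = map (map_prod (\<lambda>q. q + 1) (\<lambda>q. q + 1)) (crossings (lorenz_braid 0 ds)) @
      map (\<lambda>j. (1, ?p + 1 + j)) [1..<d + 1]"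
  proof -
    have "(map_prod G G \<circ> (\<lambda>j. (1, j + 1))) j = (1, ?p + 1 + j)" if "j \<in> set [1..<d + 1]" for j
    proof -
      have j: "1 \<le> j" "j \<le> d" using that by auto
      have "g j = ?p + j"
        unfolding g_def by (rule strand_at_lorenz_braid_low) (use d_le j in \<open>auto intro: order_trans\<close>)
      then show ?thesis using GS[of j] G1 by simp
    qed
    then have "map (map_prod G G) (map (\<lambda>j. (1, j + 1)) [1..<d + 1]) = map (\<lambda>j. (1, ?p + 1 + j)) [1..<d + 1]"
      unfolding map_map by (intro map_cong refl)
    then show ?thesis
      unfolding lorenz_braid crossings_append crossings_shift crossings_run G_def[symmetric] by (rule arg_cong)
  qed
  have "inj (map_prod (\<lambda>q. q + 1) (\<lambda>q. q + 1 :: nat) :: nat \<times> nat \<Rightarrow> nat \<times> nat)"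
    by (intro prod.inj_map) (auto simp: inj_def)
  then have d1: "distinct (map (map_prod (\<lambda>q. q + 1) (\<lambda>q. q + 1)) (crossings (lorenz_braid 0 ds)))"
    unfolding distinct_map using IH(3) inj_on_subset[OF _ subset_UNIV] by blast
  have d2: "distinct (map (\<lambda>j. (1::nat, ?p + 1 + j)) [1..<d + 1])"
    by (simp add: distinct_map inj_on_def del: upt_Suc)
  have A: "2 \<le> fst c \<and> fst c \<in> {1..?p + 1} \<and> snd c \<in> {?p + 2..?p + 1 + n}"
    if "c \<in> set (map (map_prod (\<lambda>q. q + 1) (\<lambda>q. q + 1)) (crossings (lorenz_braid 0 ds)))" for c
  proof -
    have "c \<in> map_prod (\<lambda>q. q + 1) (\<lambda>q. q + 1) ` set (crossings (lorenz_braid 0 ds))"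
      using that unfolding set_map .
    then obtain c' where c': "c' \<in> set (crossings (lorenz_braid 0 ds))" "c = map_prod (\<lambda>q. q + 1) (\<lambda>q. q + 1) c'"
      by (elim imageE)
    then show ?thesis using IH(4)[OF c'(1)] by (simp add: c'(2))
  qed
  have B: "fst c = 1 \<and> snd c \<in> {?p + 2..?p + 1 + n}" if "c \<in> set (map (\<lambda>j. (1::nat, ?p + 1 + j)) [1..<d + 1])" for c
  proof -
    have "c \<in> (\<lambda>j. (1::nat, ?p + 1 + j)) ` set [1..<d + 1]" using that unfolding set_map .
    then obtain j where "j \<in> set [1..<d + 1]" "c = (1, ?p + 1 + j)" by (elim imageE)
    then show ?thesis using dn by auto
  qed
  have 3: "distinct (crossings (lorenz_braid 0 (d # ds)))"
    unfolding cr distinct_append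
  proof (intro conjI d1 d2 equals0I)
    fix c assume "c \<in> set (map (map_prod (\<lambda>q. q + 1) (\<lambda>q. q + 1)) (crossings (lorenz_braid 0 ds))) \<inter>
      set (map (\<lambda>j. (1, ?p + 1 + j)) [1..<d + 1])"
    then show False using A[of c] B[of c] by simp
  qed
  have 4: "fst c \<in> {1..length (d # ds)} \<and> snd c \<in> {length (d # ds) + 1..length (d # ds) + n}"
    if "c \<in> set (crossings (lorenz_braid 0 (d # ds)))" for c
    using that A[of c] B[of c] unfolding cr set_append Un_iff by auto
  show ?case using 1 2 3 4 by blast
qed

lemma lorenz_braid_lorenz:
  assumes "sorted ds" "\<And>d. d \<in> set ds \<Longrightarrow> d \<le> n"
  shows "lorenz_lambda_word (length ds + n) (length ds) (\<lambda>i. i + ds ! (i - 1)) (lorenz_braid 0 ds)"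
proof -
  let ?w = "lorenz_braid 0 ds"
  note L = lorenz_braid_strands[OF assms]
  have nth: "strand_at (take k ?w) (fst (?w ! k)) = fst (crossings ?w ! k)"
    "strand_at (take k ?w) (fst (?w ! k) + 1) = snd (crossings ?w ! k)"
    "fst (crossings ?w ! k) \<in> {1..length ds}" "snd (crossings ?w ! k) \<in> {length ds + 1..length ds + n}"
    if "k < length ?w" for k
    using crossings_nth[OF that] L nth_mem[of k "crossings ?w"] that by auto
  have "snd l" if "l \<in> set (lorenz_braid a ds)" for l a
    using that by (induction ds arbitrary: a) (auto simp: sigma_run_set simp del: sigma_run_0_1)
  then have letters: "\<forall>(i, e)\<in>set ?w. 1 \<le> i \<and> i < length ds + n \<and> e"
    using braid_word_on_lorenz_braid[of ds n 0] assms(2) unfolding braid_word_on_def by fastforce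
  have "inj_on (\<lambda>k. {strand_at (take k ?w) (fst (?w ! k)), strand_at (take k ?w) (fst (?w ! k) + 1)}) {..<length ?w}"
  proof (rule inj_onI)
    fix k k' assume k: "k \<in> {..<length ?w}" "k' \<in> {..<length ?w}"
      and eq: "{strand_at (take k ?w) (fst (?w ! k)), strand_at (take k ?w) (fst (?w ! k) + 1)} =
        {strand_at (take k' ?w) (fst (?w ! k')), strand_at (take k' ?w) (fst (?w ! k') + 1)}"
    have kk: "k < length ?w" "k' < length ?w" using k by auto
    \<comment> \<open>An unordered pair determines the ordered one, because its first entry is a
      left strand and its second a right strand.\<close>
    have "crossings ?w ! k = crossings ?w ! k'"
      using eq nth(3,4)[OF kk(1)] nth(3,4)[OF kk(2)]
      unfolding nth(1,2)[OF kk(1)] nth(1,2)[OF kk(2)] by (auto simp: doubleton_eq_iff prod_eq_iff)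
    then show "k = k'" using L kk by (simp add: nth_eq_iff_index_eq)
  qed
  then show ?thesis
    unfolding lorenz_lambda_word_def using letters L nth by simp
qed

section \<open>Lorenz-like links and generalised T-links\<close>

lemma sorted_split_zeros:
  assumes "sorted (ds :: nat list)"
  obtains z ds' where "ds = replicate z 0 @ ds'" "sorted ds'" "\<And>d. d \<in> set ds' \<Longrightarrow> 1 \<le> d"
proof -
  have "\<exists>z ds'. ds = replicate z 0 @ ds' \<and> sorted ds' \<and> (\<forall>d\<in>set ds'. 1 \<le> d)"
    using assms
  proof (induction ds)
    case (Cons d ds)
    show ?case
    proof (cases "d = 0")
      case True
      obtain z ds' where "ds = replicate z 0 @ ds'" "sorted ds'" "\<forall>d\<in>set ds'. 1 \<le> d"
        using Cons by auto
      then show ?thesis using True by (intro exI[of _ "Suc z"] exI[of _ ds']) simp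
    next
      case False
      then show ?thesis using Cons.prems by (intro exI[of _ 0] exI[of _ "d # ds"]) auto
    qed
  qed simp
  then show thesis using that by blast
qed

text \<open>Equal displacements are collected into powers of runs. Displacement 1 yields the empty
  run and disappears; displacement \<open>n\<close> contributes to the last exponent
  \<open>s\<close>.\<close>

lemma sorted_group:
  assumes "sorted ds" "\<And>d. d \<in> set ds \<Longrightarrow> 1 \<le> d \<and> d \<le> n"
  shows "\<exists>rs s. T_exponents rs n \<and> fst ` set rs \<subseteq> set ds \<and>
    concat (map (sigma_run 0) ds) = T_runs rs @ word_pow (sigma_run 0 n) s"
  using assms
proof (induction ds)
  case Nil
  show ?case by (rule exI[of _ "[]"], rule exI[of _ 0]) (simp add: T_exponents_def)
next
  case (Cons d ds)
  obtain rs s where rs: "T_exponents rs n" "fst ` set rs \<subseteq> set ds"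
    "concat (map (sigma_run 0) ds) = T_runs rs @ word_pow (sigma_run 0 n) s"
    using Cons by auto
  have d: "1 \<le> d" "d \<le> n" "\<And>x. x \<in> set rs \<Longrightarrow> d \<le> fst x" using Cons.prems rs(2) by auto
  consider "d = 1" | "d = n" "2 \<le> d" | "2 \<le> d" "d < n" using d by linarith
  then show ?case
  proof cases
    case 1
    then show ?thesis using rs by (intro exI[of _ rs] exI[of _ s]) auto
  next
    case 2
    have "rs = []"
    proof (rule ccontr)
      assume "rs \<noteq> []"
      then obtain x where "x \<in> set rs" by (cases rs) auto
      then show False using d(3)[of x] 2 rs(1) by (force simp: T_exponents_def)
    qed
    then show ?thesis using rs 2 by (intro exI[of _ "[]"] exI[of _ "Suc s"]) auto
  next
    case 3
    show ?thesis
    proof (cases "rs \<noteq> [] \<and> fst (hd rs) = d")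
      case True
      then obtain t rs' where r: "rs = (d, t) # rs'" by (cases rs) auto
      then show ?thesis using rs by (intro exI[of _ "(d, Suc t) # rs'"] exI[of _ s]) (auto simp: T_exponents_def)
    next
      case False
      have "d < fst x" if x: "x \<in> set rs" for x
      proof -
        obtain y rs' where r: "rs = y # rs'" using x by (cases rs) auto
        have "d < fst y" using False d(3)[of y] r by auto
        moreover have "fst y \<le> fst x" using x rs(1) r by (auto simp: T_exponents_def)
        ultimately show ?thesis by simp
      qed
      then show ?thesis using rs 3 by (intro exI[of _ "(d, 1) # rs"] exI[of _ s]) (auto simp: T_exponents_def)
    qed
  qed
qed

lemma strict_mono_gap:
  fixes f :: "nat \<Rightarrow> nat"
  assumes "strict_mono_on {1..p} f" "1 \<le> i" "i \<le> j" "j \<le> p"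
  shows "f i + (j - i) \<le> f j"
  using assms(3,4)
proof (induction j rule: dec_induct)
  case (step j)
  then have "f j < f (Suc j)" using strict_mono_onD[OF assms(1), of j "Suc j"] assms(2) by simp
  then show ?case using step by simp
qed simp

text \<open>The displacement \<open>f i - i\<close> is the number of right strands that the left
  strand \<open>i\<close> crosses. Strict monotonicity of \<open>f\<close> is weak monotonicity of
  the displacements.\<close>

lemma lorenz_displacements:
  assumes f: "f ` {1..p} \<subseteq> {1..N}" "strict_mono_on {1..p} f" and p: "p \<le> N"
  obtains ds where "length ds = p" "sorted ds" "\<And>d. d \<in> set ds \<Longrightarrow> d \<le> N - p"
    "\<And>i. i \<in> {1..p} \<Longrightarrow> f i = i + ds ! (i - 1)"
proof
  let ?ds = "map (\<lambda>i. f (i + 1) - (i + 1)) [0..<p]"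
  have ge: "i \<le> f i" if "i \<in> {1..p}" for i
  proof -
    have "f 1 \<in> {1..N}" using that by (intro subsetD[OF f(1)] imageI) simp
    then have "1 \<le> f 1" by simp
    then show ?thesis using strict_mono_gap[OF f(2), of 1 i] that by auto
  qed
  show "length ?ds = p" by simp
  show "sorted ?ds"
    unfolding sorted_iff_nth_mono
  proof (intro allI impI)
    fix i j assume "i \<le> j" "j < length ?ds"
    then have ij: "i \<le> j" "j < p" by auto
    then show "?ds ! i \<le> ?ds ! j"
      using strict_mono_gap[OF f(2), of "i + 1" "j + 1"] ge[of "i + 1"] ge[of "j + 1"] by simp
  qed
  show "d \<le> N - p" if "d \<in> set ?ds" for d
  proof -
    obtain i where i: "i < p" "d = f (i + 1) - (i + 1)" using \<open>d \<in> _\<close> by auto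
    have "f p \<in> {1..N}" using i by (intro subsetD[OF f(1)] imageI) simp
    then have "f p \<le> N" by simp
    then show ?thesis using strict_mono_gap[OF f(2), of "i + 1" p] i by auto
  qed
  show "f i = i + ?ds ! (i - 1)" if "i \<in> {1..p}" for i
    using ge[OF that] that by auto
qed

lemma lorenz_word_on:
  assumes "p \<le> N" "braid_word_on N w"
  shows "braid_word_on N (word_power (half_twist 0 p) 0 @ word_power (half_twist p (N - p)) u @ w)"
  using assms by (simp add: braid_word_on_power braid_word_on_half_twist)

lemma lorenz_is_T_link:
  assumes f: "f ` {1..p} \<subseteq> {1..N}" "strict_mono_on {1..p} f" and p: "p \<le> N" "1 \<le> N"
    and w: "lorenz_lambda_word N p f w" and v: "v \<le> 0"
  shows "is_T_link v N (word_power (half_twist 0 p) 0 @ word_power (half_twist p (N - p)) (2 * v) @ w)"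
proof -
  define n where "n = N - p"
  obtain ds where ds: "length ds = p" "sorted ds" "\<And>d. d \<in> set ds \<Longrightarrow> d \<le> n"
    and fds: "\<And>i. i \<in> {1..p} \<Longrightarrow> f i = i + ds ! (i - 1)"
    using lorenz_displacements[OF f p(1)] unfolding n_def by blast
  have N: "N = p + n" using p by (simp add: n_def)
  have img: "f ` {1..p} = (\<lambda>i. i + ds ! (i - 1)) ` {1..p}" using fds by (rule image_cong[OF refl])
  have "lorenz_lambda_word N p f (lorenz_braid 0 ds)"
    using lorenz_braid_lorenz[OF ds(2,3)] fds unfolding ds(1) N[symmetric] lorenz_lambda_word_def img by simp
  then have eq: "braid_eq w (lorenz_braid 0 ds)" using lorenz_lambda_unique[OF w _ f(1)] by blast
  obtain z ds' where z: "ds = replicate z 0 @ ds'" "sorted ds'" "\<And>d. d \<in> set ds' \<Longrightarrow> 1 \<le> d"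
    using sorted_split_zeros[OF ds(2)] by blast
  have pz: "p = z + length ds'" using ds(1) z(1) by simp
  have ds': "1 \<le> d \<and> d \<le> n" if "d \<in> set ds'" for d using z ds(3) that by auto
  \<comment> \<open>If there are no right strands, no left strand crosses anything, and all
    \<open>N\<close> strands are among the \<open>z\<close> free ones.\<close>
  have zn: "1 \<le> z + n"
  proof (rule ccontr)
    assume "\<not> 1 \<le> z + n"
    have "ds' = []"
    proof (rule ccontr)
      assume "ds' \<noteq> []"
      then show False using ds'[of "hd ds'"] \<open>\<not> 1 \<le> z + n\<close> by simp
    qed
    then show False using \<open>\<not> 1 \<le> z + n\<close> pz N p(2) by simp
  qed
  let ?V = "word_power (sigma_run 0 n) (v * int n)"
  have on: "braid_word_on N w" "braid_word_on N (lorenz_braid 0 ds)"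
    using lorenz_lambda_word_on[OF w] braid_word_on_lorenz_braid[of ds n 0] ds N by auto
  have "link_eq N (word_power (half_twist 0 p) 0 @ word_power (half_twist p (N - p)) (2 * v) @ w)
      N (word_power (half_twist p n) (2 * v) @ lorenz_braid 0 ds)"
  proof (rule link_eq_braid_eq)
    show "braid_eq (word_power (half_twist 0 p) 0 @ word_power (half_twist p (N - p)) (2 * v) @ w)
        (word_power (half_twist p n) (2 * v) @ lorenz_braid 0 ds)"
      using braid_eq_left[OF eq] by (simp add: n_def)
    show "braid_word_on N (word_power (half_twist p n) (2 * v) @ lorenz_braid 0 ds)"
      using on(2) N by (simp add: braid_word_on_power braid_word_on_half_twist)
  qed (rule lorenz_word_on[OF p(1) on(1)])
  also have "link_eq N (word_power (half_twist p n) (2 * v) @ lorenz_braid 0 ds)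
      (z + n) (shift_word z (concat (map (sigma_run 0) ds') @ ?V))"
    using lorenz_reduce[OF z(2) ds' zn v] by (simp add: pz N z(1))
  finally have red: "link_eq N (word_power (half_twist 0 p) 0 @ word_power (half_twist p (N - p)) (2 * v) @ w)
      (z + n) (shift_word z (concat (map (sigma_run 0) ds') @ ?V))" .
  show ?thesis
  proof (cases "n = 0")
    case True
    have "ds' = []"
    proof (rule ccontr)
      assume "ds' \<noteq> []"
      then have "1 \<le> hd ds' \<and> hd ds' \<le> n" by (intro ds' hd_in_set)
      then show False using True by linarith
    qed
    then show ?thesis
      using is_T_link_eq[OF red] is_T_link_unlink[OF zn v] True by simp
  next
    case False
    obtain rs s where rs: "T_exponents rs n"
      "concat (map (sigma_run 0) ds') = T_runs rs @ word_pow (sigma_run 0 n) s"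
      using sorted_group[OF z(2) ds'] by blast
    \<comment> \<open>The full twists contribute the exponent \<open>- k = v n\<close>, and the left
      strands that cross all right strands contribute \<open>s \<ge> 0\<close>. So the last exponent
      \<open>s - k\<close> satisfies the required bound.\<close>
    define k where "k = nat (- v) * n"
    have k: "v * int n = - int k" using v by (simp add: k_def)
    let ?e = "int s - int k"
    have onR: "braid_word_on n (word_power (sigma_run 0 n) e)" for e
      by (intro braid_word_on_power braid_word_on_sigma_run) simp
    have onT: "braid_word_on n (T_runs rs)" by (rule braid_word_on_T_runs[OF rs(1)])
    have "braid_eq (word_power (sigma_run 0 n) (int s) @ ?V) (word_power (sigma_run 0 n) ?e)"
      unfolding k by (rule word_power_add_right)
    then have eq: "braid_eq (T_runs rs @ word_power (sigma_run 0 n) (int s) @ ?V) (T_runs rs @ word_power (sigma_run 0 n) ?e)"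
      by (rule braid_eq_left)
    let ?Y = "T_runs rs @ word_power (sigma_run 0 n) (int s) @ ?V"
    let ?Z = "T_runs rs @ word_power (sigma_run 0 n) ?e"
    have Y: "braid_word_on n ?Y" and Z: "braid_word_on n ?Z" using onT onR by auto
    have "concat (map (sigma_run 0) ds') @ ?V = ?Y" by (simp add: rs(2) word_power_of_nat)
    note red[unfolded this]
    also have "link_eq (z + n) (shift_word z ?Y) (z + n) ?Y" by (rule link_eq_shift[OF Y])
    also have "link_eq (z + n) ?Y (z + n) ?Z"
      by (rule link_eq_braid_eq[OF eq]) (use Y Z braid_word_on_mono[of n _ "z + n"] in auto)
    also have "link_eq (z + n) ?Z (z + n) (shift_word z ?Z)" by (rule link_eq_shift_back[OF Z refl])
    finally have "link_eq N (word_power (half_twist 0 p) 0 @ word_power (half_twist p (N - p)) (2 * v) @ w)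
      (z + n) (shift_word z ?Z)" .
    moreover have "is_T_link v (z + n) (shift_word z ?Z)"
      using False k v by (intro is_T_link_runs rs(1)) auto
    ultimately show ?thesis by (rule is_T_link_eq)
  qed
qed

section \<open>From generalised T-links back to Lorenz-like links\<close>

lemma gen_T_parameters_mono:
  assumes "gen_T_parameters k r s" "1 \<le> i" "i < j" "j \<le> k + 1"
  shows "r i < r j"
  using assms(3,4)
proof (induction j rule: less_induct)
  case (less j)
  have j: "r (j - 1) < r j"
  proof -
    have "j - 1 \<in> {1..k}" "j - 1 + 1 = j" using less.prems assms(2) by auto
    then show ?thesis using assms(1) unfolding gen_T_parameters_def by metis
  qed
  show ?case
  proof (cases "i = j - 1")
    case False
    then have "r i < r (j - 1)" using less by auto
    then show ?thesis using j by simp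
  qed (use j in simp)
qed

text \<open>The displacements are read off from the parameters: \<open>d\<close> zeros,
  \<open>s i\<close> copies of \<open>r i\<close> for each \<open>i \<le> k\<close>, and
  \<open>t\<close> copies of the last \<open>r\<close>. The reduction of the resulting Lorenz braid
  is then used backwards.\<close>

lemma gen_T_is_lorenz:
  assumes T: "gen_T_parameters k r s" and s: "v * int (r (k + 1)) \<le> s (k + 1)" and v: "v \<le> 0"
  shows "\<exists>N p f w. 1 \<le> N \<and> p \<le> N \<and> f ` {1..p} \<subseteq> {1..N} \<and> strict_mono_on {1..p} f \<and> lorenz_lambda_word N p f w \<and>
    link_eq (d + r (k + 1)) (gen_T_word k r s d)
      N (word_power (half_twist 0 p) 0 @ word_power (half_twist p (N - p)) (2 * v) @ w)"
proof -
  define n where "n = r (k + 1)"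
  define rs where "rs = map (\<lambda>i. (r i, nat (s i))) [1..<k + 1]"
  have r1: "2 \<le> r 1" and spos: "\<And>i. i \<in> {1..k} \<Longrightarrow> 0 < s i" using T by (auto simp: gen_T_parameters_def)
  have r2: "2 \<le> r i" if "1 \<le> i" "i \<le> k + 1" for i
    using gen_T_parameters_mono[OF T, of 1 i] that r1 by (cases "i = 1") auto
  have n: "2 \<le> n" unfolding n_def by (rule r2) auto
  have rs: "T_exponents rs n"
    unfolding T_exponents_def
  proof
    show "sorted_wrt (<) (map fst rs)"
      using gen_T_parameters_mono[OF T] by (auto simp: rs_def sorted_wrt_iff_nth_less o_def simp del: upt_Suc)
    show "\<forall>x\<in>set rs. 2 \<le> fst x \<and> fst x < n \<and> 0 < snd x"
      using gen_T_parameters_mono[OF T] r2 spos by (auto simp: rs_def n_def simp del: upt_Suc)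
  qed
  define k' where "k' = nat (- v) * n"
  have k': "v * int n = - int k'" using v by (simp add: k'_def)
  \<comment> \<open>The number of left strands that have to cross all \<open>n\<close> right
    strands. That \<open>s (k + 1) - v n\<close> is not negative is the hypothesis on the last
    exponent.\<close>
  define t where "t = nat (s (k + 1) + int k')"
  have t: "s (k + 1) = int t - int k'" using s k' by (simp add: t_def n_def)
  have Tw: "gen_T_word k r s d = shift_word d (T_runs rs @ word_power (sigma_run 0 n) (s (k + 1)))"
    unfolding n_def by (rule gen_T_word_runs) (use spos in \<open>auto simp: rs_def less_imp_le simp del: upt_Suc\<close>)
  define ds' where "ds' = concat (map (\<lambda>(r, s). replicate s r) rs) @ replicate t n"
  have ds': "1 \<le> x \<and> x \<le> n" if "x \<in> set ds'" for x
    using that rs n by (auto simp: ds'_def T_exponents_def split: if_splits)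
  have sorted: "sorted ds'"
  proof -
    have "sorted (concat (map (\<lambda>(r, s). replicate s r) rs'))" if "sorted_wrt (<) (map fst rs')" for rs' :: "(nat \<times> nat) list"
      using that
    proof (induction rs')
      case (Cons x rs')
      then show ?case by (cases x) (fastforce simp: sorted_append split: if_splits)
    qed simp
    then have "sorted (concat (map (\<lambda>(r, s). replicate s r) rs))" using rs by (simp add: T_exponents_def)
    moreover have "x \<le> n" if "x \<in> set (concat (map (\<lambda>(r, s). replicate s r) rs))" for x
      using ds'[of x] that by (simp add: ds'_def)
    ultimately show ?thesis by (auto simp: ds'_def sorted_append)
  qed
  have runs: "concat (map (sigma_run 0) ds') = T_runs rs @ word_pow (sigma_run 0 n) t"
  proof -
    have "concat (map (sigma_run 0) (concat (map (\<lambda>(r, s). replicate s r) rs))) = T_runs rs" for rs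
      by (induction rs) auto
    then show ?thesis by (simp add: ds'_def)
  qed
  define ds where "ds = replicate d 0 @ ds'"
  define p where "p = length ds"
  have p: "p = d + length ds'" by (simp add: p_def ds_def)
  define f where "f i = i + ds ! (i - 1)" for i
  have sds: "sorted ds" using sorted by (auto simp: ds_def sorted_append)
  have dsn: "x \<le> n" if "x \<in> set ds" for x using that ds' by (auto simp: ds_def)
  have lorenz: "lorenz_lambda_word (p + n) p f (lorenz_braid 0 ds)"
    using lorenz_braid_lorenz[OF sds dsn] unfolding p_def f_def[abs_def] .
  have fim: "f ` {1..p} \<subseteq> {1..p + n}"
  proof clarify
    fix i assume i: "i \<in> {1..p}"
    then have "ds ! (i - 1) \<le> n" by (intro dsn nth_mem) (auto simp: p_def)
    then show "f i \<in> {1..p + n}" using i by (simp add: f_def)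
  qed
  have fmono: "strict_mono_on {1..p} f"
  proof (rule strict_mono_onI)
    fix i j assume "i \<in> {1..p}" "j \<in> {1..p}" "i < j"
    then have "ds ! (i - 1) \<le> ds ! (j - 1)" using sorted_nth_mono[OF sds, of "i - 1" "j - 1"] by (auto simp: p_def)
    then show "f i < f j" using \<open>i < j\<close> by (simp add: f_def)
  qed
  let ?V = "word_power (sigma_run 0 n) (v * int n)"
  let ?Y = "T_runs rs @ word_power (sigma_run 0 n) (int t) @ ?V"
  let ?Z = "T_runs rs @ word_power (sigma_run 0 n) (s (k + 1))"
  have onR: "braid_word_on n (word_power (sigma_run 0 n) e)" for e
    by (intro braid_word_on_power braid_word_on_sigma_run) simp
  have Y: "braid_word_on n ?Y" and Z: "braid_word_on n ?Z" using onR braid_word_on_T_runs[OF rs] by auto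
  have "braid_eq (word_power (sigma_run 0 n) (int t) @ ?V) (word_power (sigma_run 0 n) (s (k + 1)))"
    unfolding k' t by (rule word_power_add_right)
  then have eq: "braid_eq ?Y ?Z" by (rule braid_eq_left)
  have "link_eq (d + n) (shift_word d ?Z) (d + n) ?Z" by (rule link_eq_shift[OF Z])
  also have "link_eq (d + n) ?Z (d + n) ?Y"
    by (rule link_eq_braid_eq[OF braid_eq_sym[OF eq]]) (use Y Z braid_word_on_mono[of n _ "d + n"] in auto)
  also have "link_eq (d + n) ?Y (d + n) (shift_word d ?Y)" by (rule link_eq_shift_back[OF Y refl])
  also have "?Y = concat (map (sigma_run 0) ds') @ ?V" by (simp add: runs word_power_of_nat)
  also have "link_eq (d + n) (shift_word d (concat (map (sigma_run 0) ds') @ ?V)) (p + n) (word_power (half_twist p n) (2 * v) @ lorenz_braid 0 ds)"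
    using link_eq_sym[OF lorenz_reduce[OF sorted ds' _ v, of d]] n unfolding p ds_def by simp
  finally have "link_eq (d + r (k + 1)) (gen_T_word k r s d)
      (p + n) (word_power (half_twist 0 p) 0 @ word_power (half_twist p (p + n - p)) (2 * v) @ lorenz_braid 0 ds)"
    by (simp add: Tw n_def)
  then show ?thesis
    using lorenz fim fmono n by (intro exI[of _ "p + n"] exI[of _ p] exI[of _ f] exI[of _ "lorenz_braid 0 ds"]) simp
qed

theorem theorem3p10:
  fixes v :: int
  assumes "v \<le> 0"
  shows "(\<forall>k r s d. gen_T_parameters k r s \<and> s (k + 1) \<ge> v * int (r (k + 1)) \<longrightarrow>
            (\<exists>L\<in>lorenz_like_links 0 (2 * v). ambient_isotopic (gen_T_link k r s d) L)) \<and>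
         (\<forall>L\<in>lorenz_like_links 0 (2 * v).
            (\<exists>k r s d. gen_T_parameters k r s \<and> s (k + 1) \<ge> v * int (r (k + 1)) \<and>
               ambient_isotopic L (gen_T_link k r s d)) \<or>
            (v = 0 \<and> is_unlink L))"
proof (intro conjI allI impI ballI)
  fix k r s d assume "gen_T_parameters k r s \<and> s (k + 1) \<ge> v * int (r (k + 1))"
  then obtain N p f w where "1 \<le> N" "p \<le> N" "f ` {1..p} \<subseteq> {1..N}" "strict_mono_on {1..p} f" "lorenz_lambda_word N p f w"
    and eq: "link_eq (d + r (k + 1)) (gen_T_word k r s d)
      N (word_power (half_twist 0 p) 0 @ word_power (half_twist p (N - p)) (2 * v) @ w)"
    using gen_T_is_lorenz[of k r s v d] assms by blast
  then have "braid_closure N (word_power (half_twist 0 p) 0 @ word_power (half_twist p (N - p)) (2 * v) @ w)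
      \<in> lorenz_like_links 0 (2 * v)"
    unfolding lorenz_like_links_def by blast
  then show "\<exists>L\<in>lorenz_like_links 0 (2 * v). ambient_isotopic (gen_T_link k r s d) L"
    using eq unfolding link_eq_def gen_T_link_def by blast
next
  fix L assume "L \<in> lorenz_like_links 0 (2 * v)"
  then obtain N p f w where L: "L = braid_closure N (word_power (half_twist 0 p) 0 @ word_power (half_twist p (N - p)) (2 * v) @ w)"
    and "1 \<le> N" "p \<le> N" "f ` {1..p} \<subseteq> {1..N}" "strict_mono_on {1..p} f" "lorenz_lambda_word N p f w"
    unfolding lorenz_like_links_def by blast
  then have "is_T_link v N (word_power (half_twist 0 p) 0 @ word_power (half_twist p (N - p)) (2 * v) @ w)"
    using lorenz_is_T_link assms by blast
  then show "(\<exists>k r s d. gen_T_parameters k r s \<and> s (k + 1) \<ge> v * int (r (k + 1)) \<and>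
               ambient_isotopic L (gen_T_link k r s d)) \<or> (v = 0 \<and> is_unlink L)"
    unfolding is_T_link_def link_eq_def gen_T_link_def is_unlink_def L by blast
qed

end
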